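(* Let $A$ be an associative (unital) $\Bbbk$-algebra, let $\mathcal{W}(A)$ be the wreath product category with generating object $\uparrow$, and let $d\in\mathbb{N}$. Then there is an isomorphism of $\Bbbk$-algebras $$\mathrm{End}_{\mathcal{W}(A)}(\uparrow^{\otimes d})\cong A^{\otimes d}\rtimes S_d,$$ where $A^{\otimes d}\rtimes S_d$ (the $d$-th wreath product algebra associated to $A$) is the $\Bbbk$-module $A^{\otimes d}\otimes_{\Bbbk}\Bbbk S_d$ with multiplication determined by $$(\mathbf{a}_1\otimes\pi_1)(\mathbf{a}_2\otimes\pi_2)=\mathbf{a}_1(\pi_1\cdot\mathbf{a}_2)\otimes\pi_1\pi_2,\qquad \mathbf{a}_1,\mathbf{a}_2\in A^{\otimes d},\ \pi_1,\pi_2\in S_d,$$ and $\pi_1\cdot\mathbf{a}_2$ denotes the natural (left) action of $\pi_1\in S_d$ on $\mathbf{a}_2\in A^{\otimes d}$ by permutation of the factors.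
   Context: $\Bbbk$ is a fixed commutative ground ring; tensor products of modules are over $\Bbbk$; linear categories are $\Bbbk$-linear and monoidal categories are strict. A strict linear monoidal category is a category whose hom-sets are $\Bbbk$-modules with bilinear composition, with a bilinear, strictly associative tensor bifunctor $\otimes$ and a strict unit object. The endomorphism sets are $\Bbbk$-algebras under composition. A strict linear monoidal category presented by generating objects, generating morphisms and relations is the quotient of the free strict linear monoidal category on these generators (objects: the free monoid under $\otimes$ on the generating objects; morphisms freely generated, under composition, $\otimes$ and $\Bbbk$-linear combinations, by the generating morphisms, subject only to the axioms of a strict linear monoidal category) by the tensor ideal generated by the relations, i.e. the smallest family of submodules of the hom-modules which contains the relations and is closed under composing and tensoring on either side with arbitrary morphisms. The wreath product category $\mathcal{W}(A)$ is the strict linear monoidal category with one generating object $\uparrow$, generating morphisms $$s\colon\uparrow\otimes\uparrow\to\uparrow\otimes\uparrow,\qquad \beta_a\colon\uparrow\to\uparrow\quad(a\in A),$$ and relations, with $1=1_\uparrow$: (i) $s\circ s=1_{\uparrow\otimes\uparrow}$; (ii) $(s\otimes1)\circ(1\otimes s)\circ(s\otimes1)=(1\otimes s)\circ(s\otimes1)\circ(1\otimes s)$; (iii) $a\mapsto\beta_a$ is a homomorphism of unital $\Bbbk$-algebras $A\to\mathrm{End}(\uparrow)$: $\beta_{\lambda a+\mu b}=\lambda\beta_a+\mu\beta_b$, $\beta_a\circ\beta_b=\beta_{ab}$ and $\beta_{1_A}=1_\uparrow$, for all $\lambda,\mu\in\Bbbk$, $a,b\in A$; (iv) $s\circ(\beta_a\otimes1)=(1\otimes\beta_a)\circ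 s$ for all $a\in A$. *)

theory Defs
  imports
    "HOL-Algebra.Module"
    "HOL-Algebra.QuotRing"
    "HOL-Algebra.Product_Groups"
    "HOL-Algebra.Sym_Groups"
begin

section \<open>Associative algebras\<close>

text \<open>
  The locale \<^locale>\<open>algebra\<close> of the library asks for a commutative multiplication, so associative
  unital algebras are introduced here. As everywhere in HOL-Algebra, zero rings are allowed.
\<close>

locale assoc_algebra = module K A + ring A
  for K :: "('k, 'r) ring_scheme" and A :: "('k, 'a, 's) module_scheme" +
  assumes smult_mult_left:
      "\<lbrakk>r \<in> carrier K; x \<in> carrier A; y \<in> carrier A\<rbrakk> \<Longrightarrow>
        (r \<odot>\<^bsub>A\<^esub> x) \<otimes>\<^bsub>A\<^esub> y = r \<odot>\<^bsub>A\<^esub> (x \<otimes>\<^bsub>A\<^esub> y)"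
    and smult_mult_right:
      "\<lbrakk>r \<in> carrier K; x \<in> carrier A; y \<in> carrier A\<rbrakk> \<Longrightarrow>
        x \<otimes>\<^bsub>A\<^esub> (r \<odot>\<^bsub>A\<^esub> y) = r \<odot>\<^bsub>A\<^esub> (x \<otimes>\<^bsub>A\<^esub> y)"

definition isomorphic_algebras ::
  "('k, 'r) ring_scheme \<Rightarrow> ('k, 'a, 's) module_scheme \<Rightarrow> ('k, 'b, 't) module_scheme \<Rightarrow> bool"
  where "isomorphic_algebras K A B \<longleftrightarrow>
    assoc_algebra K A \<and> assoc_algebra K B \<and>
    (\<exists>h \<in> ring_iso A B. \<forall>r \<in> carrier K. \<forall>x \<in> carrier A. h (r \<odot>\<^bsub>A\<^esub> x) = r \<odot>\<^bsub>B\<^esub> h x)"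


section \<open>Free modules, quotients and tensor products\<close>

text \<open>
  The free module on a set consists of the finitely supported functions on it. It carries no
  multiplication; \<open>monoid_algebra\<close> below adds one.
\<close>

definition free_module :: "('k, 'r) ring_scheme \<Rightarrow> 'x set \<Rightarrow> ('k, 'x \<Rightarrow> 'k) module"
  where "free_module K X = \<lparr>
    carrier = {f. (\<forall>x. f x \<in> carrier K) \<and> finite {x. f x \<noteq> \<zero>\<^bsub>K\<^esub>} \<and> {x. f x \<noteq> \<zero>\<^bsub>K\<^esub>} \<subseteq> X},
    monoid.mult = (\<lambda>f g. undefined),
    one = undefined,
    zero = (\<lambda>x. \<zero>\<^bsub>K\<^esub>),
    add = (\<lambda>f g x. f x \<oplus>\<^bsub>K\<^esub> g x),
    smult = (\<lambda>r f x. r \<otimes>\<^bsub>K\<^esub> f x)\<rparr>"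

definition basis_elem :: "('k, 'r) ring_scheme \<Rightarrow> 'x \<Rightarrow> 'x \<Rightarrow> 'k"
  where "basis_elem K x = (\<lambda>y. if y = x then \<one>\<^bsub>K\<^esub> else \<zero>\<^bsub>K\<^esub>)"

text \<open>The linear (bilinear) map on free modules with prescribed values on basis elements.\<close>

definition lin_ext ::
  "('k, 'r) ring_scheme \<Rightarrow> ('k, 'm, 's) module_scheme \<Rightarrow> ('x \<Rightarrow> 'm) \<Rightarrow> ('x \<Rightarrow> 'k) \<Rightarrow> 'm"
  where "lin_ext K M \<phi> f = (\<Oplus>\<^bsub>M\<^esub>x \<in> {x. f x \<noteq> \<zero>\<^bsub>K\<^esub>}. f x \<odot>\<^bsub>M\<^esub> \<phi> x)"

definition bilin_ext ::
  "('k, 'r) ring_scheme \<Rightarrow> ('k, 'm, 's) module_scheme \<Rightarrow> ('x \<Rightarrow> 'y \<Rightarrow> 'm) \<Rightarrow>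
    ('x \<Rightarrow> 'k) \<Rightarrow> ('y \<Rightarrow> 'k) \<Rightarrow> 'm"
  where "bilin_ext K M \<phi> f g = lin_ext K M (\<lambda>x. lin_ext K M (\<phi> x) g) f"

definition monoid_algebra ::
  "('k, 'r) ring_scheme \<Rightarrow> ('x, 's) monoid_scheme \<Rightarrow> ('k, 'x \<Rightarrow> 'k) module"
  where "monoid_algebra K G = (free_module K (carrier G))\<lparr>
    monoid.mult := bilin_ext K (free_module K (carrier G)) (\<lambda>x y. basis_elem K (x \<otimes>\<^bsub>G\<^esub> y)),
    one := basis_elem K \<one>\<^bsub>G\<^esub>\<rparr>"

definition span_submodule ::
  "('k, 'r) ring_scheme \<Rightarrow> ('k, 'm, 's) module_scheme \<Rightarrow> 'm set \<Rightarrow> 'm set"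
  where "span_submodule K M S = \<Inter>{N. submodule N K M \<and> S \<subseteq> N}"

definition quot_module :: "('k, 'm, 's) module_scheme \<Rightarrow> 'm set \<Rightarrow> ('k, 'm set) module"
  where "quot_module M N = \<lparr>
    carrier = carrier (M Quot N),
    monoid.mult = monoid.mult (M Quot N),
    one = \<one>\<^bsub>M Quot N\<^esub>,
    zero = \<zero>\<^bsub>M Quot N\<^esub>,
    add = add (M Quot N),
    smult = (\<lambda>r U. \<Union>x\<in>U. N +>\<^bsub>M\<^esub> (r \<odot>\<^bsub>M\<^esub> x))\<rparr>"

definition bilinear_relations ::
  "('k, 'r) ring_scheme \<Rightarrow> ('k, 'm, 's) module_scheme \<Rightarrow> ('k, 'n, 't) module_scheme \<Rightarrow>
    ('m \<times> 'n \<Rightarrow> 'k) set"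
  where "bilinear_relations K M N =
    (let F = free_module K (carrier M \<times> carrier N); e = (\<lambda>x y. basis_elem K (x, y)) in
      {e (x \<oplus>\<^bsub>M\<^esub> x') y \<ominus>\<^bsub>F\<^esub> (e x y \<oplus>\<^bsub>F\<^esub> e x' y) | x x' y.
        x \<in> carrier M \<and> x' \<in> carrier M \<and> y \<in> carrier N} \<union>
      {e x (y \<oplus>\<^bsub>N\<^esub> y') \<ominus>\<^bsub>F\<^esub> (e x y \<oplus>\<^bsub>F\<^esub> e x y') | x y y'.
        x \<in> carrier M \<and> y \<in> carrier N \<and> y' \<in> carrier N} \<union>
      {e (r \<odot>\<^bsub>M\<^esub> x) y \<ominus>\<^bsub>F\<^esub> (r \<odot>\<^bsub>F\<^esub> e x y) | r x y.
        r \<in> carrier K \<and> x \<in> carrier M \<and> y \<in> carrier N} \<union>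
      {e x (r \<odot>\<^bsub>N\<^esub> y) \<ominus>\<^bsub>F\<^esub> (r \<odot>\<^bsub>F\<^esub> e x y) | r x y.
        r \<in> carrier K \<and> x \<in> carrier M \<and> y \<in> carrier N})"

definition tensor_kernel ::
  "('k, 'r) ring_scheme \<Rightarrow> ('k, 'm, 's) module_scheme \<Rightarrow> ('k, 'n, 't) module_scheme \<Rightarrow>
    ('m \<times> 'n \<Rightarrow> 'k) set"
  where "tensor_kernel K M N =
    span_submodule K (free_module K (carrier M \<times> carrier N)) (bilinear_relations K M N)"

definition tensor_module ::
  "('k, 'r) ring_scheme \<Rightarrow> ('k, 'm, 's) module_scheme \<Rightarrow> ('k, 'n, 't) module_scheme \<Rightarrow>
    ('k, ('m \<times> 'n \<Rightarrow> 'k) set) module"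
  where "tensor_module K M N =
    quot_module (free_module K (carrier M \<times> carrier N)) (tensor_kernel K M N)"

definition pure_tensor ::
  "('k, 'r) ring_scheme \<Rightarrow> ('k, 'm, 's) module_scheme \<Rightarrow> ('k, 'n, 't) module_scheme \<Rightarrow>
    'm \<Rightarrow> 'n \<Rightarrow> ('m \<times> 'n \<Rightarrow> 'k) set"
  where "pure_tensor K M N x y =
    tensor_kernel K M N +>\<^bsub>free_module K (carrier M \<times> carrier N)\<^esub> basis_elem K (x, y)"


section \<open>Tensor powers of an algebra and the wreath product algebra\<close>

text \<open>
  The \<open>d\<close>-th tensor power is the quotient of the free module on \<open>d\<close>-tuples by the multilinearity
  relations. The tuples form a monoid under componentwise multiplication, and the product of the
  tensor power is induced by the one of the monoid algebra. For \<open>d = 0\<close> there is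
  exactly one tuple and no relation, so that the result is \<open>K\<close>.
\<close>

definition tuples :: "('k, 'a, 's) module_scheme \<Rightarrow> nat \<Rightarrow> (nat \<Rightarrow> 'a) monoid"
  where "tuples A d = product_group {1..d} (\<lambda>_. A)"

definition multilinear_relations ::
  "('k, 'r) ring_scheme \<Rightarrow> ('k, 'a, 's) module_scheme \<Rightarrow> nat \<Rightarrow> ((nat \<Rightarrow> 'a) \<Rightarrow> 'k) set"
  where "multilinear_relations K A d =
    (let F = monoid_algebra K (tuples A d); e = basis_elem K in
      {e (a(i := x \<oplus>\<^bsub>A\<^esub> y)) \<ominus>\<^bsub>F\<^esub> (e (a(i := x)) \<oplus>\<^bsub>F\<^esub> e (a(i := y))) | a i x y.
        a \<in> carrier (tuples A d) \<and> i \<in> {1..d} \<and> x \<in> carrier A \<and> y \<in> carrier A} \<union>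
      {e (a(i := r \<odot>\<^bsub>A\<^esub> x)) \<ominus>\<^bsub>F\<^esub> (r \<odot>\<^bsub>F\<^esub> e (a(i := x))) | a i r x.
        a \<in> carrier (tuples A d) \<and> i \<in> {1..d} \<and> r \<in> carrier K \<and> x \<in> carrier A})"

definition tensor_power_kernel ::
  "('k, 'r) ring_scheme \<Rightarrow> ('k, 'a, 's) module_scheme \<Rightarrow> nat \<Rightarrow> ((nat \<Rightarrow> 'a) \<Rightarrow> 'k) set"
  where "tensor_power_kernel K A d =
    span_submodule K (monoid_algebra K (tuples A d)) (multilinear_relations K A d)"

definition tensor_power ::
  "('k, 'r) ring_scheme \<Rightarrow> ('k, 'a, 's) module_scheme \<Rightarrow> nat \<Rightarrow>
    ('k, ((nat \<Rightarrow> 'a) \<Rightarrow> 'k) set) module"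
  where "tensor_power K A d =
    quot_module (monoid_algebra K (tuples A d)) (tensor_power_kernel K A d)"

definition pure_tensor_power ::
  "('k, 'r) ring_scheme \<Rightarrow> ('k, 'a, 's) module_scheme \<Rightarrow> nat \<Rightarrow> (nat \<Rightarrow> 'a) \<Rightarrow>
    ((nat \<Rightarrow> 'a) \<Rightarrow> 'k) set"
  where "pure_tensor_power K A d a =
    tensor_power_kernel K A d +>\<^bsub>monoid_algebra K (tuples A d)\<^esub> basis_elem K a"

text \<open>
  The left action of permutations on the tensor power: the factor in position \<open>i\<close> is moved to
  position \<open>\<pi> i\<close>. Here and in the product of the wreath product algebra, elements of a quotient of a
  free module are cosets of finitely supported functions; the union over all representatives
  is the common value of the expression on them.
\<close>

definition perm_action ::
  "('k, 'r) ring_scheme \<Rightarrow> ('k, 'a, 's) module_scheme \<Rightarrow> nat \<Rightarrow> (nat \<Rightarrow> nat) \<Rightarrow>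
    ((nat \<Rightarrow> 'a) \<Rightarrow> 'k) set \<Rightarrow> ((nat \<Rightarrow> 'a) \<Rightarrow> 'k) set"
  where "perm_action K A d \<pi> U =
    (\<Union>f\<in>U. lin_ext K (tensor_power K A d) (\<lambda>a. pure_tensor_power K A d (a \<circ> inv' \<pi>)) f)"

text \<open>
  The product is determined by
  \<open>(a \<otimes> \<pi>) (b \<otimes> \<sigma>) = a (\<pi> \<cdot> b) \<otimes> \<pi> \<sigma>\<close> for permutations \<open>\<pi>\<close>, \<open>\<sigma>\<close>. The inner \<open>bilin_ext\<close> extends
  this to pure tensors \<open>a \<otimes> x\<close> and \<open>b \<otimes> y\<close> with \<open>x\<close>, \<open>y\<close> in the group algebra, the outer one to
  arbitrary tensors.
\<close>

definition wreath_algebra ::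
  "('k, 'r) ring_scheme \<Rightarrow> ('k, 'a, 's) module_scheme \<Rightarrow> nat \<Rightarrow>
    ('k, (((nat \<Rightarrow> 'a) \<Rightarrow> 'k) set \<times> ((nat \<Rightarrow> nat) \<Rightarrow> 'k) \<Rightarrow> 'k) set) module"
  where "wreath_algebra K A d =
    (let B = tensor_power K A d; G = sym_group d; KG = monoid_algebra K G;
         W = tensor_module K B KG;
         basis_mult = (\<lambda>a b \<pi> \<sigma>.
           pure_tensor K B KG (a \<otimes>\<^bsub>B\<^esub> perm_action K A d \<pi> b) (basis_elem K (\<pi> \<otimes>\<^bsub>G\<^esub> \<sigma>)))
     in W\<lparr>
       monoid.mult := (\<lambda>U V. \<Union>f\<in>U. \<Union>g\<in>V.
         bilin_ext K W (\<lambda>(a, x) (b, y). bilin_ext K W (basis_mult a b) x y) f g),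
       one := pure_tensor K B KG \<one>\<^bsub>B\<^esub> \<one>\<^bsub>KG\<^esub>\<rparr>)"


section \<open>Strict linear monoidal categories by generators and relations\<close>

text \<open>
  The data of a strict linear monoidal category. Every element of the type \<open>'o\<close> is an object, and
  composition is written in the usual order, so that \<open>g \<cdot> f\<close> is \<open>f\<close> followed by \<open>g\<close>.
\<close>

record ('k, 'o, 'm) lin_mon_cat =
  Mor :: "'o \<Rightarrow> 'o \<Rightarrow> 'm set"
  ident :: "'o \<Rightarrow> 'm"
  mcomp :: "'m \<Rightarrow> 'm \<Rightarrow> 'm" (infixl \<open>\<cdot>\<index>\<close> 70)
  tens_obj :: "'o \<Rightarrow> 'o \<Rightarrow> 'o"
  unit_obj :: "'o"
  tens :: "'m \<Rightarrow> 'm \<Rightarrow> 'm" (infixl \<open>\<boxtimes>\<index>\<close> 75)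
  mzero :: "'o \<Rightarrow> 'o \<Rightarrow> 'm"
  madd :: "'m \<Rightarrow> 'm \<Rightarrow> 'm" (infixl \<open>\<boxplus>\<index>\<close> 65)
  mscale :: "'k \<Rightarrow> 'm \<Rightarrow> 'm" (infixr \<open>\<star>\<index>\<close> 72)

definition obj_power :: "('k, 'o, 'm, 's) lin_mon_cat_scheme \<Rightarrow> 'o \<Rightarrow> nat \<Rightarrow> 'o"
  where "obj_power C X d = (tens_obj C X ^^ d) (unit_obj C)"

definition End_algebra :: "('k, 'o, 'm, 's) lin_mon_cat_scheme \<Rightarrow> 'o \<Rightarrow> ('k, 'm) module"
  where "End_algebra C X = \<lparr>
    carrier = Mor C X X,
    monoid.mult = mcomp C,
    one = ident C X,
    zero = mzero C X X,
    add = madd C,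
    smult = mscale C\<rparr>"

text \<open>
  The quotient by an equivalence relation \<open>E\<close> on morphisms which relates only parallel morphisms and
  is compatible with all operations. Morphisms are equivalence classes.
\<close>

definition quot_category ::
  "('k, 'o, 'm, 's) lin_mon_cat_scheme \<Rightarrow> ('m \<times> 'm) set \<Rightarrow> ('k, 'o, 'm set) lin_mon_cat"
  where "quot_category C E = \<lparr>
    Mor = (\<lambda>X Y. Mor C X Y // E),
    ident = (\<lambda>X. E `` {ident C X}),
    mcomp = (\<lambda>U V. E `` {g \<cdot>\<^bsub>C\<^esub> f | g f. g \<in> U \<and> f \<in> V}),
    tens_obj = tens_obj C,
    unit_obj = unit_obj C,
    tens = (\<lambda>U V. E `` {f \<boxtimes>\<^bsub>C\<^esub> g | f g. f \<in> U \<and> g \<in> V}),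
    mzero = (\<lambda>X Y. E `` {mzero C X Y}),
    madd = (\<lambda>U V. E `` {f \<boxplus>\<^bsub>C\<^esub> g | f g. f \<in> U \<and> g \<in> V}),
    mscale = (\<lambda>r U. E `` {r \<star>\<^bsub>C\<^esub> f | f. f \<in> U})\<rparr>"

subsection \<open>Free strict linear monoidal categories\<close>

text \<open>
  Morphisms of the free category are formal expressions modulo the axioms of a
  strict linear monoidal category. Objects are words in the generating objects, the elements
  of the type \<open>'o\<close>.
\<close>

datatype ('k, 'o, 'g) mexpr =
    Gen 'g
  | Ident "'o list"
  | Comp "('k, 'o, 'g) mexpr" "('k, 'o, 'g) mexpr"
  | Tens "('k, 'o, 'g) mexpr" "('k, 'o, 'g) mexpr"
  | Zero "'o list" "'o list"
  | Add "('k, 'o, 'g) mexpr" "('k, 'o, 'g) mexpr"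
  | Scale 'k "('k, 'o, 'g) mexpr"

record ('o, 'g) signature =
  gens :: "'g set"
  source :: "'g \<Rightarrow> 'o list"
  target :: "'g \<Rightarrow> 'o list"

inductive typed ::
  "('k, 'r) ring_scheme \<Rightarrow> ('o, 'g) signature \<Rightarrow> 'o list \<Rightarrow> 'o list \<Rightarrow> ('k, 'o, 'g) mexpr \<Rightarrow> bool"
  for K :: "('k, 'r) ring_scheme" and \<Sigma> :: "('o, 'g) signature"
  where
    typed_Gen: "g \<in> gens \<Sigma> \<Longrightarrow> typed K \<Sigma> (source \<Sigma> g) (target \<Sigma> g) (Gen g)"
  | typed_Ident: "typed K \<Sigma> X X (Ident X)"
  | typed_Comp: "typed K \<Sigma> Y Z t \<Longrightarrow> typed K \<Sigma> X Y u \<Longrightarrow> typed K \<Sigma> X Z (Comp t u)"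
  | typed_Tens: "typed K \<Sigma> X Y t \<Longrightarrow> typed K \<Sigma> X' Y' u \<Longrightarrow>
      typed K \<Sigma> (X @ X') (Y @ Y') (Tens t u)"
  | typed_Zero: "typed K \<Sigma> X Y (Zero X Y)"
  | typed_Add: "typed K \<Sigma> X Y t \<Longrightarrow> typed K \<Sigma> X Y u \<Longrightarrow> typed K \<Sigma> X Y (Add t u)"
  | typed_Scale: "r \<in> carrier K \<Longrightarrow> typed K \<Sigma> X Y t \<Longrightarrow> typed K \<Sigma> X Y (Scale r t)"

definition expr_category ::
  "('k, 'r) ring_scheme \<Rightarrow> ('o, 'g) signature \<Rightarrow> ('k, 'o list, ('k, 'o, 'g) mexpr) lin_mon_cat"
  where "expr_category K \<Sigma> = \<lparr>
    Mor = (\<lambda>X Y. {t. typed K \<Sigma> X Y t}),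
    ident = Ident,
    mcomp = Comp,
    tens_obj = (@),
    unit_obj = [],
    tens = Tens,
    mzero = Zero,
    madd = Add,
    mscale = Scale\<rparr>"

inductive free_eq ::
  "('k, 'r) ring_scheme \<Rightarrow> ('o, 'g) signature \<Rightarrow> ('k, 'o, 'g) mexpr \<Rightarrow> ('k, 'o, 'g) mexpr \<Rightarrow> bool"
  for K :: "('k, 'r) ring_scheme" and \<Sigma> :: "('o, 'g) signature"
  where
    \<comment> \<open>equivalence relation compatible with the operations\<close>
    refl: "typed K \<Sigma> X Y t \<Longrightarrow> free_eq K \<Sigma> t t"
  | sym: "free_eq K \<Sigma> t u \<Longrightarrow> free_eq K \<Sigma> u t"
  | trans: "free_eq K \<Sigma> t u \<Longrightarrow> free_eq K \<Sigma> u v \<Longrightarrow> free_eq K \<Sigma> t v"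
  | cong_Comp: "typed K \<Sigma> Y Z t \<Longrightarrow> typed K \<Sigma> X Y u \<Longrightarrow>
      free_eq K \<Sigma> t t' \<Longrightarrow> free_eq K \<Sigma> u u' \<Longrightarrow> free_eq K \<Sigma> (Comp t u) (Comp t' u')"
  | cong_Tens: "free_eq K \<Sigma> t t' \<Longrightarrow> free_eq K \<Sigma> u u' \<Longrightarrow> free_eq K \<Sigma> (Tens t u) (Tens t' u')"
  | cong_Add: "typed K \<Sigma> X Y t \<Longrightarrow> typed K \<Sigma> X Y u \<Longrightarrow>
      free_eq K \<Sigma> t t' \<Longrightarrow> free_eq K \<Sigma> u u' \<Longrightarrow> free_eq K \<Sigma> (Add t u) (Add t' u')"
  | cong_Scale: "r \<in> carrier K \<Longrightarrow> free_eq K \<Sigma> t t' \<Longrightarrow> free_eq K \<Sigma> (Scale r t) (Scale r t')"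
    \<comment> \<open>hom-sets are modules\<close>
  | add_assoc: "typed K \<Sigma> X Y t \<Longrightarrow> typed K \<Sigma> X Y u \<Longrightarrow> typed K \<Sigma> X Y v \<Longrightarrow>
      free_eq K \<Sigma> (Add (Add t u) v) (Add t (Add u v))"
  | add_comm: "typed K \<Sigma> X Y t \<Longrightarrow> typed K \<Sigma> X Y u \<Longrightarrow> free_eq K \<Sigma> (Add t u) (Add u t)"
  | add_zero: "typed K \<Sigma> X Y t \<Longrightarrow> free_eq K \<Sigma> (Add t (Zero X Y)) t"
  | add_minus: "typed K \<Sigma> X Y t \<Longrightarrow> free_eq K \<Sigma> (Add t (Scale (\<ominus>\<^bsub>K\<^esub> \<one>\<^bsub>K\<^esub>) t)) (Zero X Y)"
  | scale_one: "typed K \<Sigma> X Y t \<Longrightarrow> free_eq K \<Sigma> (Scale \<one>\<^bsub>K\<^esub> t) t"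
  | scale_mult: "r \<in> carrier K \<Longrightarrow> q \<in> carrier K \<Longrightarrow> typed K \<Sigma> X Y t \<Longrightarrow>
      free_eq K \<Sigma> (Scale (r \<otimes>\<^bsub>K\<^esub> q) t) (Scale r (Scale q t))"
  | scale_add_left: "r \<in> carrier K \<Longrightarrow> q \<in> carrier K \<Longrightarrow> typed K \<Sigma> X Y t \<Longrightarrow>
      free_eq K \<Sigma> (Scale (r \<oplus>\<^bsub>K\<^esub> q) t) (Add (Scale r t) (Scale q t))"
  | scale_add_right: "r \<in> carrier K \<Longrightarrow> typed K \<Sigma> X Y t \<Longrightarrow> typed K \<Sigma> X Y u \<Longrightarrow>
      free_eq K \<Sigma> (Scale r (Add t u)) (Add (Scale r t) (Scale r u))"
    \<comment> \<open>category with bilinear composition\<close>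
  | comp_assoc: "typed K \<Sigma> Y Z t \<Longrightarrow> typed K \<Sigma> X Y u \<Longrightarrow> typed K \<Sigma> W X v \<Longrightarrow>
      free_eq K \<Sigma> (Comp (Comp t u) v) (Comp t (Comp u v))"
  | comp_ident_left: "typed K \<Sigma> X Y t \<Longrightarrow> free_eq K \<Sigma> (Comp (Ident Y) t) t"
  | comp_ident_right: "typed K \<Sigma> X Y t \<Longrightarrow> free_eq K \<Sigma> (Comp t (Ident X)) t"
  | comp_add_left: "typed K \<Sigma> Y Z t \<Longrightarrow> typed K \<Sigma> Y Z u \<Longrightarrow> typed K \<Sigma> X Y v \<Longrightarrow>
      free_eq K \<Sigma> (Comp (Add t u) v) (Add (Comp t v) (Comp u v))"
  | comp_add_right: "typed K \<Sigma> Y Z t \<Longrightarrow> typed K \<Sigma> X Y u \<Longrightarrow> typed K \<Sigma> X Y v \<Longrightarrow>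
      free_eq K \<Sigma> (Comp t (Add u v)) (Add (Comp t u) (Comp t v))"
  | comp_scale_left: "r \<in> carrier K \<Longrightarrow> typed K \<Sigma> Y Z t \<Longrightarrow> typed K \<Sigma> X Y u \<Longrightarrow>
      free_eq K \<Sigma> (Comp (Scale r t) u) (Scale r (Comp t u))"
  | comp_scale_right: "r \<in> carrier K \<Longrightarrow> typed K \<Sigma> Y Z t \<Longrightarrow> typed K \<Sigma> X Y u \<Longrightarrow>
      free_eq K \<Sigma> (Comp t (Scale r u)) (Scale r (Comp t u))"
    \<comment> \<open>bilinear, strictly associative tensor bifunctor with strict unit\<close>
  | tens_ident: "free_eq K \<Sigma> (Tens (Ident X) (Ident Y)) (Ident (X @ Y))"
  | interchange: "typed K \<Sigma> Y Z t \<Longrightarrow> typed K \<Sigma> X Y u \<Longrightarrow>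
      typed K \<Sigma> Y' Z' t' \<Longrightarrow> typed K \<Sigma> X' Y' u' \<Longrightarrow>
      free_eq K \<Sigma> (Tens (Comp t u) (Comp t' u')) (Comp (Tens t t') (Tens u u'))"
  | tens_assoc: "typed K \<Sigma> X Y t \<Longrightarrow> typed K \<Sigma> X' Y' u \<Longrightarrow> typed K \<Sigma> X'' Y'' v \<Longrightarrow>
      free_eq K \<Sigma> (Tens (Tens t u) v) (Tens t (Tens u v))"
  | tens_unit_left: "typed K \<Sigma> X Y t \<Longrightarrow> free_eq K \<Sigma> (Tens (Ident []) t) t"
  | tens_unit_right: "typed K \<Sigma> X Y t \<Longrightarrow> free_eq K \<Sigma> (Tens t (Ident [])) t"
  | tens_add_left: "typed K \<Sigma> X Y t \<Longrightarrow> typed K \<Sigma> X Y u \<Longrightarrow> typed K \<Sigma> X' Y' v \<Longrightarrow>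
      free_eq K \<Sigma> (Tens (Add t u) v) (Add (Tens t v) (Tens u v))"
  | tens_add_right: "typed K \<Sigma> X Y t \<Longrightarrow> typed K \<Sigma> X' Y' u \<Longrightarrow> typed K \<Sigma> X' Y' v \<Longrightarrow>
      free_eq K \<Sigma> (Tens t (Add u v)) (Add (Tens t u) (Tens t v))"
  | tens_scale_left: "r \<in> carrier K \<Longrightarrow> typed K \<Sigma> X Y t \<Longrightarrow> typed K \<Sigma> X' Y' u \<Longrightarrow>
      free_eq K \<Sigma> (Tens (Scale r t) u) (Scale r (Tens t u))"
  | tens_scale_right: "r \<in> carrier K \<Longrightarrow> typed K \<Sigma> X Y t \<Longrightarrow> typed K \<Sigma> X' Y' u \<Longrightarrow>
      free_eq K \<Sigma> (Tens t (Scale r u)) (Scale r (Tens t u))"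

definition free_category ::
  "('k, 'r) ring_scheme \<Rightarrow> ('o, 'g) signature \<Rightarrow>
    ('k, 'o list, ('k, 'o, 'g) mexpr set) lin_mon_cat"
  where "free_category K \<Sigma> = quot_category (expr_category K \<Sigma>) {(t, u). free_eq K \<Sigma> t u}"

definition free_gen ::
  "('k, 'r) ring_scheme \<Rightarrow> ('o, 'g) signature \<Rightarrow> 'g \<Rightarrow> ('k, 'o, 'g) mexpr set"
  where "free_gen K \<Sigma> g = {(t, u). free_eq K \<Sigma> t u} `` {Gen g}"

subsection \<open>Tensor ideals and presented categories\<close>

text \<open>
  A relation \<open>f = g\<close> between parallel morphisms is given as the pair \<open>(f, g)\<close> and contributes
  the morphism \<open>f - g\<close> to the tensor ideal.
\<close>

inductive tensor_ideal ::
  "('k, 'r) ring_scheme \<Rightarrow> ('k, 'o, 'm, 's) lin_mon_cat_scheme \<Rightarrow> ('m \<times> 'm) set \<Rightarrow>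
    'o \<Rightarrow> 'o \<Rightarrow> 'm \<Rightarrow> bool"
  for K :: "('k, 'r) ring_scheme" and C :: "('k, 'o, 'm, 's) lin_mon_cat_scheme"
    and R :: "('m \<times> 'm) set"
  where
    relation: "(f, g) \<in> R \<Longrightarrow> f \<in> Mor C X Y \<Longrightarrow> g \<in> Mor C X Y \<Longrightarrow>
      tensor_ideal K C R X Y (f \<boxplus>\<^bsub>C\<^esub> (\<ominus>\<^bsub>K\<^esub> \<one>\<^bsub>K\<^esub>) \<star>\<^bsub>C\<^esub> g)"
  | zero: "tensor_ideal K C R X Y (mzero C X Y)"
  | add: "tensor_ideal K C R X Y f \<Longrightarrow> tensor_ideal K C R X Y g \<Longrightarrow>
      tensor_ideal K C R X Y (f \<boxplus>\<^bsub>C\<^esub> g)"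
  | scale: "r \<in> carrier K \<Longrightarrow> tensor_ideal K C R X Y f \<Longrightarrow> tensor_ideal K C R X Y (r \<star>\<^bsub>C\<^esub> f)"
  | comp_left: "g \<in> Mor C Y Z \<Longrightarrow> tensor_ideal K C R X Y f \<Longrightarrow> tensor_ideal K C R X Z (g \<cdot>\<^bsub>C\<^esub> f)"
  | comp_right: "tensor_ideal K C R Y Z f \<Longrightarrow> g \<in> Mor C X Y \<Longrightarrow> tensor_ideal K C R X Z (f \<cdot>\<^bsub>C\<^esub> g)"
  | tens_left: "g \<in> Mor C X' Y' \<Longrightarrow> tensor_ideal K C R X Y f \<Longrightarrow>
      tensor_ideal K C R (tens_obj C X' X) (tens_obj C Y' Y) (g \<boxtimes>\<^bsub>C\<^esub> f)"
  | tens_right: "tensor_ideal K C R X Y f \<Longrightarrow> g \<in> Mor C X' Y' \<Longrightarrow>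
      tensor_ideal K C R (tens_obj C X X') (tens_obj C Y Y') (f \<boxtimes>\<^bsub>C\<^esub> g)"

definition ideal_congruence ::
  "('k, 'r) ring_scheme \<Rightarrow> ('k, 'o, 'm, 's) lin_mon_cat_scheme \<Rightarrow> ('m \<times> 'm) set \<Rightarrow> ('m \<times> 'm) set"
  where "ideal_congruence K C R = {(f, g). \<exists>X Y. f \<in> Mor C X Y \<and> g \<in> Mor C X Y \<and>
    tensor_ideal K C R X Y (f \<boxplus>\<^bsub>C\<^esub> (\<ominus>\<^bsub>K\<^esub> \<one>\<^bsub>K\<^esub>) \<star>\<^bsub>C\<^esub> g)}"

definition presented_category ::
  "('k, 'r) ring_scheme \<Rightarrow> ('o, 'g) signature \<Rightarrow>
    (('k, 'o, 'g) mexpr set \<times> ('k, 'o, 'g) mexpr set) set \<Rightarrow>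
    ('k, 'o list, ('k, 'o, 'g) mexpr set set) lin_mon_cat"
  where "presented_category K \<Sigma> R =
    quot_category (free_category K \<Sigma>) (ideal_congruence K (free_category K \<Sigma>) R)"


section \<open>The wreath product category\<close>

text \<open>The single generating object is the element of \<^typ>\<open>unit\<close>, so that objects are words \<open>unit list\<close>.\<close>

datatype 'a wreath_gen = Crossing | Token 'a

abbreviation up :: "unit list"
  where "up \<equiv> [()]"

definition wreath_signature :: "('k, 'a, 's) module_scheme \<Rightarrow> (unit, 'a wreath_gen) signature"
  where "wreath_signature A = \<lparr>
    gens = insert Crossing (Token ` carrier A),
    source = case_wreath_gen (up @ up) (\<lambda>_. up),
    target = case_wreath_gen (up @ up) (\<lambda>_. up)\<rparr>"

definition wreath_relations ::
  "('k, 'r) ring_scheme \<Rightarrow> ('k, 'a, 's) module_scheme \<Rightarrow>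
    (('k, unit, 'a wreath_gen) mexpr set \<times> ('k, unit, 'a wreath_gen) mexpr set) set"
  where "wreath_relations K A =
    (let F = free_category K (wreath_signature A);
         s = free_gen K (wreath_signature A) Crossing;
         \<beta> = (\<lambda>a. free_gen K (wreath_signature A) (Token a));
         i = ident F up
     in
      {(s \<cdot>\<^bsub>F\<^esub> s, ident F (up @ up))} \<union>
      {((s \<boxtimes>\<^bsub>F\<^esub> i) \<cdot>\<^bsub>F\<^esub> (i \<boxtimes>\<^bsub>F\<^esub> s) \<cdot>\<^bsub>F\<^esub> (s \<boxtimes>\<^bsub>F\<^esub> i), (i \<boxtimes>\<^bsub>F\<^esub> s) \<cdot>\<^bsub>F\<^esub> (s \<boxtimes>\<^bsub>F\<^esub> i) \<cdot>\<^bsub>F\<^esub> (i \<boxtimes>\<^bsub>F\<^esub> s))} \<union>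
      {(\<beta> (l \<odot>\<^bsub>A\<^esub> a \<oplus>\<^bsub>A\<^esub> m \<odot>\<^bsub>A\<^esub> b), l \<star>\<^bsub>F\<^esub> \<beta> a \<boxplus>\<^bsub>F\<^esub> m \<star>\<^bsub>F\<^esub> \<beta> b) | l m a b.
        l \<in> carrier K \<and> m \<in> carrier K \<and> a \<in> carrier A \<and> b \<in> carrier A} \<union>
      {(\<beta> a \<cdot>\<^bsub>F\<^esub> \<beta> b, \<beta> (a \<otimes>\<^bsub>A\<^esub> b)) | a b. a \<in> carrier A \<and> b \<in> carrier A} \<union>
      {(\<beta> \<one>\<^bsub>A\<^esub>, i)} \<union>
      {(s \<cdot>\<^bsub>F\<^esub> (\<beta> a \<boxtimes>\<^bsub>F\<^esub> i), (i \<boxtimes>\<^bsub>F\<^esub> \<beta> a) \<cdot>\<^bsub>F\<^esub> s) | a. a \<in> carrier A})"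

definition wreath_category ::
  "('k, 'r) ring_scheme \<Rightarrow> ('k, 'a, 's) module_scheme \<Rightarrow>
    ('k, unit list, ('k, unit, 'a wreath_gen) mexpr set set) lin_mon_cat"
  where "wreath_category K A =
    presented_category K (wreath_signature A) (wreath_relations K A)"

end

theory Submission
  imports Defs
begin

text \<open>
  Both algebras are generated by crossings of neighbouring strands and by tokens, that is elements
  of \<open>A\<close> placed on one strand, and both satisfy the same relations; the locale \<open>wreath_system\<close> records
  them for an arbitrary algebra. In such an algebra let \<open>elem a \<pi>\<close> be the product of the tokens
  \<open>a 1, \<dots>, a d\<close> on the strands \<open>1, \<dots>, d\<close> and, to the right of them, of a fixed word in the crossings whose
  permutation is \<open>\<pi>\<close>.
  These elements are multilinear in \<open>a\<close>, and left multiplication by a token or a crossing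
  maps them to elements of the same form (\<open>\<beta>_elem\<close>, \<open>S_elem\<close>). For crossings this is Coxeter's presentation
  of the symmetric group: \<open>S_normal_word\<close> says that a crossing times the word chosen for \<open>\<pi>\<close> equals
  the word chosen for the composite permutation.

  In the endomorphism algebra of the \<open>d\<close>-th tensor power of the generating object the elements
  \<open>elem a \<pi>\<close> span (\<open>elems_span\<close>). Indeed every morphism is built from the generators by composition,
  tensor product and linear combination; morphisms between tensor powers of different length
  vanish, and by induction all others, padded by identities to \<open>d\<close> strands, preserve the span
  (\<open>all_stable\<close>), which contains the identity.

  In the wreath product algebra \<open>elem a \<pi>\<close> is the tensor \<open>a \<otimes> \<pi>\<close>. These tensors
  span (\<open>wreath_elem_spans\<close>), and a family of elements of a module that is multilinear in \<open>a\<close> for each \<open>\<pi>\<close>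
  is the family of values of a linear map (\<open>wreath_lift\<close>). Hence there is a linear map \<open>G\<close> from the wreath product
  algebra to the endomorphism algebra which sends \<open>a \<otimes> \<pi>\<close> to \<open>elem a \<pi>\<close>.

  For the inverse, a formal expression is evaluated in the wreath product algebra by
  replacing each generator with the crossing or token on the strands that it occupies
  (\<open>eval\<close>). The evaluation of a subexpression depends on the number of strands to its left, but all values lie in
  one algebra, so that no products between wreath product algebras for different \<open>d\<close> are
  needed. The axioms of a strict linear monoidal category hold because elements supported on
  disjoint sets of strands commute (\<open>free_eq_eval\<close>), and the defining relations hold in the wreath product algebra
  (\<open>relation_eval\<close>, \<open>tensor_ideal_eval\<close>). The result is an algebra homomorphism \<open>F\<close> which sends
  \<open>elem a \<pi>\<close> to \<open>a \<otimes> \<pi>\<close>. As \<open>F \<circ> G\<close> and \<open>G \<circ> F\<close> are linear and fix spanning sets, they are identities.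

  The same principle makes the cosets and unions in the definition of the wreath product algebra
  manageable: its product is bilinear, therefore associativity needs to be verified only for the
  tensors \<open>a \<otimes> \<pi>\<close> (\<open>assoc_algebraI_spans\<close>, \<open>wreath_elem_mult\<close>).
\<close>

section \<open>Linear maps and spanning sets\<close>

definition linear_map ::
  "('k, 'r) ring_scheme \<Rightarrow> ('k, 'm, 's) module_scheme \<Rightarrow> ('k, 'n, 't) module_scheme \<Rightarrow> ('m \<Rightarrow> 'n) \<Rightarrow> bool"
  where "linear_map K M N h \<longleftrightarrow> h \<in> carrier M \<rightarrow> carrier N \<and>
    (\<forall>x \<in> carrier M. \<forall>y \<in> carrier M. h (x \<oplus>\<^bsub>M\<^esub> y) = h x \<oplus>\<^bsub>N\<^esub> h y) \<and>
    (\<forall>r \<in> carrier K. \<forall>x \<in> carrier M. h (r \<odot>\<^bsub>M\<^esub> x) = r \<odot>\<^bsub>N\<^esub> h x)"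

definition bilinear_map ::
  "('k, 'r) ring_scheme \<Rightarrow> ('k, 'm, 's) module_scheme \<Rightarrow> ('k, 'n, 't) module_scheme \<Rightarrow>
    ('k, 'p, 'u) module_scheme \<Rightarrow> ('m \<Rightarrow> 'n \<Rightarrow> 'p) \<Rightarrow> bool"
  where "bilinear_map K M N P \<phi> \<longleftrightarrow>
    (\<forall>x \<in> carrier M. linear_map K N P (\<phi> x)) \<and> (\<forall>y \<in> carrier N. linear_map K M P (\<lambda>x. \<phi> x y))"

definition spans ::
  "('k, 'r) ring_scheme \<Rightarrow> ('k, 'm, 's) module_scheme \<Rightarrow> 'm set \<Rightarrow> bool"
  where "spans K M S \<longleftrightarrow> S \<subseteq> carrier M \<and> span_submodule K M S = carrier M"

lemma linear_mapI:
  assumes "\<And>x. x \<in> carrier M \<Longrightarrow> h x \<in> carrier N"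
    and "\<And>x y. x \<in> carrier M \<Longrightarrow> y \<in> carrier M \<Longrightarrow> h (x \<oplus>\<^bsub>M\<^esub> y) = h x \<oplus>\<^bsub>N\<^esub> h y"
    and "\<And>r x. r \<in> carrier K \<Longrightarrow> x \<in> carrier M \<Longrightarrow> h (r \<odot>\<^bsub>M\<^esub> x) = r \<odot>\<^bsub>N\<^esub> h x"
  shows "linear_map K M N h"
  using assms by (auto simp: linear_map_def)

lemma linear_mapD:
  assumes "linear_map K M N h"
  shows linear_map_closed: "x \<in> carrier M \<Longrightarrow> h x \<in> carrier N"
    and linear_map_add: "x \<in> carrier M \<Longrightarrow> y \<in> carrier M \<Longrightarrow> h (x \<oplus>\<^bsub>M\<^esub> y) = h x \<oplus>\<^bsub>N\<^esub> h y"
    and linear_map_smult: "r \<in> carrier K \<Longrightarrow> x \<in> carrier M \<Longrightarrow> h (r \<odot>\<^bsub>M\<^esub> x) = r \<odot>\<^bsub>N\<^esub> h x"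
  using assms by (auto simp: linear_map_def)

lemma linear_map_zero:
  assumes "module K M" "module K N" "linear_map K M N h"
  shows "h \<zero>\<^bsub>M\<^esub> = \<zero>\<^bsub>N\<^esub>"
proof -
  interpret M: module K M by fact
  interpret N: module K N by fact
  show ?thesis
    using linear_map_smult[OF assms(3), of "\<zero>\<^bsub>K\<^esub>" "\<zero>\<^bsub>M\<^esub>"]
      linear_map_closed[OF assms(3), of "\<zero>\<^bsub>M\<^esub>"] by simp
qed

lemma linear_map_uminus:
  assumes "module K M" "module K N" "linear_map K M N h" "x \<in> carrier M"
  shows "h (\<ominus>\<^bsub>M\<^esub> x) = \<ominus>\<^bsub>N\<^esub> h x"
proof -
  interpret M: module K M by fact
  interpret N: module K N by fact
  have "h ((\<ominus>\<^bsub>K\<^esub> \<one>\<^bsub>K\<^esub>) \<odot>\<^bsub>M\<^esub> x) = (\<ominus>\<^bsub>K\<^esub> \<one>\<^bsub>K\<^esub>) \<odot>\<^bsub>N\<^esub> h x"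
    using linear_map_smult[OF assms(3)] assms(4) by simp
  then show ?thesis
    using assms(4) linear_map_closed[OF assms(3,4)]
    by (simp add: M.smult_l_minus N.smult_l_minus)
qed

lemma linear_map_minus:
  assumes "module K M" "module K N" "linear_map K M N h" "x \<in> carrier M" "y \<in> carrier M"
  shows "h (x \<ominus>\<^bsub>M\<^esub> y) = h x \<ominus>\<^bsub>N\<^esub> h y"
proof -
  interpret M: module K M by fact
  show ?thesis
    using assms by (simp add: a_minus_def linear_map_add[OF assms(3)] linear_map_uminus)
qed

lemma linear_map_comp:
  assumes "linear_map K M N f" "linear_map K N P g"
  shows "linear_map K M P (\<lambda>x. g (f x))"
  using assms by (auto simp: linear_map_def Pi_iff)

lemma linear_map_kernel_submodule:
  assumes "module K M" "module K N" "linear_map K M N h"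
  shows "submodule {x \<in> carrier M. h x = \<zero>\<^bsub>N\<^esub>} K M"
proof -
  interpret M: module K M by fact
  interpret N: module K N by fact
  show ?thesis
    using linear_map_zero[OF assms] linear_map_uminus[OF assms] linear_mapD[OF assms(3)]
    by (intro M.submoduleI) auto
qed

lemma submodule_zero: "submodule N K M \<Longrightarrow> \<zero>\<^bsub>M\<^esub> \<in> N"
  using subgroup.one_closed[of N "add_monoid M"] by (simp add: submodule_def)

lemma span_submodule_submodule:
  assumes "module K M" "S \<subseteq> carrier M"
  shows "submodule (span_submodule K M S) K M"
proof -
  interpret M: module K M by fact
  have c: "submodule (carrier M) K M" by (rule M.carrier_is_submodule)
  show ?thesis
  proof (rule M.submoduleI)
    show "span_submodule K M S \<subseteq> carrier M"
      using c assms(2) by (auto simp: span_submodule_def)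
  next
    show "\<zero>\<^bsub>M\<^esub> \<in> span_submodule K M S"
      by (auto simp: span_submodule_def submodule_zero)
  qed (auto simp: span_submodule_def dest: M.submoduleE)
qed

lemma span_submodule_superset: "S \<subseteq> span_submodule K M S"
  by (auto simp: span_submodule_def)

lemma span_submodule_least: "submodule N K M \<Longrightarrow> S \<subseteq> N \<Longrightarrow> span_submodule K M S \<subseteq> N"
  by (auto simp: span_submodule_def)

lemma linear_map_zero_on_span:
  assumes "module K M" "module K N" "linear_map K M N h" "S \<subseteq> carrier M"
    and "\<And>s. s \<in> S \<Longrightarrow> h s = \<zero>\<^bsub>N\<^esub>" "x \<in> span_submodule K M S"
  shows "h x = \<zero>\<^bsub>N\<^esub>"
  using span_submodule_least[OF linear_map_kernel_submodule[OF assms(1-3)], of S] assms(4-6) by blast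

text \<open>
  The elements with the property form a submodule. Closure under negation need not be asked for,
  since negation is multiplication by the scalar \<open>-1\<close>.
\<close>

lemma spans_induct [consumes 3, case_names base zero add smult]:
  assumes "module K M" "spans K M S" "x \<in> carrier M"
    and base: "\<And>s. s \<in> S \<Longrightarrow> P s"
    and zero: "P \<zero>\<^bsub>M\<^esub>"
    and add: "\<And>x y. x \<in> carrier M \<Longrightarrow> y \<in> carrier M \<Longrightarrow> P x \<Longrightarrow> P y \<Longrightarrow> P (x \<oplus>\<^bsub>M\<^esub> y)"
    and smult: "\<And>r x. r \<in> carrier K \<Longrightarrow> x \<in> carrier M \<Longrightarrow> P x \<Longrightarrow> P (r \<odot>\<^bsub>M\<^esub> x)"
  shows "P x"
proof -
  interpret M: module K M by fact
  have "submodule {x \<in> carrier M. P x} K M"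
  proof (rule M.submoduleI)
    fix a assume "a \<in> {x \<in> carrier M. P x}"
    moreover from this have "\<ominus>\<^bsub>M\<^esub> a = (\<ominus>\<^bsub>K\<^esub> \<one>\<^bsub>K\<^esub>) \<odot>\<^bsub>M\<^esub> a"
      by (simp add: M.smult_l_minus)
    ultimately show "\<ominus>\<^bsub>M\<^esub> a \<in> {x \<in> carrier M. P x}"
      using smult[of "\<ominus>\<^bsub>K\<^esub> \<one>\<^bsub>K\<^esub>" a] by simp
  qed (auto simp: zero add smult)
  then have "span_submodule K M S \<subseteq> {x \<in> carrier M. P x}"
    using assms(2) base by (intro span_submodule_least) (auto simp: spans_def)
  then show ?thesis using assms(2,3) by (auto simp: spans_def)
qed

lemma spansI:
  assumes "module K M" "S \<subseteq> carrier M"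
    and "\<And>N. submodule N K M \<Longrightarrow> S \<subseteq> N \<Longrightarrow> carrier M \<subseteq> N"
  shows "spans K M S"
proof -
  have "span_submodule K M S \<subseteq> carrier M"
    by (rule module.submoduleE(1)[OF assms(1) span_submodule_submodule[OF assms(1,2)]])
  then show ?thesis
    using assms(2) assms(3)[OF span_submodule_submodule[OF assms(1,2)] span_submodule_superset]
    by (simp add: spans_def)
qed

lemma linear_map_eqI:
  assumes "module K M" "module K N" "spans K M S" "linear_map K M N f" "linear_map K M N g"
    and "\<And>s. s \<in> S \<Longrightarrow> f s = g s" "x \<in> carrier M"
  shows "f x = g x"
  using assms(1,3,7)
proof (induction x rule: spans_induct)
  case zero
  then show ?case by (simp add: linear_map_zero[OF assms(1,2)] assms(4,5))
qed (simp_all add: assms(6) linear_mapD[OF assms(4)] linear_mapD[OF assms(5)])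

lemma bilinear_mapD:
  assumes "bilinear_map K M N P \<phi>"
  shows bilinear_map_left: "y \<in> carrier N \<Longrightarrow> linear_map K M P (\<lambda>x. \<phi> x y)"
    and bilinear_map_right: "x \<in> carrier M \<Longrightarrow> linear_map K N P (\<phi> x)"
  using assms by (auto simp: bilinear_map_def)

lemma bilinear_map_closed:
  "bilinear_map K M N P \<phi> \<Longrightarrow> x \<in> carrier M \<Longrightarrow> y \<in> carrier N \<Longrightarrow> \<phi> x y \<in> carrier P"
  by (meson bilinear_map_right linear_map_closed)

text \<open>
  The preimage of a submodule under a linear map is a submodule, in the form of an induction
  over the spanning set.
\<close>

lemma linear_image_spans:
  assumes "module K M" "module K N" "spans K M S" "linear_map K M N h" "h ` carrier M = carrier N"
  shows "spans K N (h ` S)"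
proof (rule spansI[OF assms(2)])
  interpret N: module K N by fact
  show "h ` S \<subseteq> carrier N" using assms(3,5) by (auto simp: spans_def)
  fix L assume L: "submodule L K N" "h ` S \<subseteq> L"
  have "h x \<in> L" if "x \<in> carrier M" for x
    using assms(1,3) that
  proof (induction x rule: spans_induct)
    case zero
    then show ?case
      using linear_map_zero[OF assms(1,2,4)] submodule_zero[OF L(1)] by simp
  next
    case (base s)
    then show ?case using L(2) by auto
  next
    case (add x y)
    then show ?case
      using N.submoduleE(5)[OF L(1)] by (simp add: linear_map_add[OF assms(4)])
  next
    case (smult r x)
    then show ?case
      using N.submoduleE(4)[OF L(1)] by (simp add: linear_map_smult[OF assms(4)])
  qed
  then have "h ` carrier M \<subseteq> L" by (rule image_subsetI)
  then show "carrier N \<subseteq> L" by (simp only: assms(5))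
qed

section \<open>Free modules and linear extension\<close>

lemma free_module_simps [simp]:
  "\<zero>\<^bsub>free_module K X\<^esub> = (\<lambda>x. \<zero>\<^bsub>K\<^esub>)"
  "f \<oplus>\<^bsub>free_module K X\<^esub> g = (\<lambda>x. f x \<oplus>\<^bsub>K\<^esub> g x)"
  "r \<odot>\<^bsub>free_module K X\<^esub> f = (\<lambda>x. r \<otimes>\<^bsub>K\<^esub> f x)"
  by (simp_all add: free_module_def)

lemma free_module_carrier:
  "f \<in> carrier (free_module K X) \<longleftrightarrow>
    (\<forall>x. f x \<in> carrier K) \<and> finite {x. f x \<noteq> \<zero>\<^bsub>K\<^esub>} \<and> {x. f x \<noteq> \<zero>\<^bsub>K\<^esub>} \<subseteq> X"
  by (simp add: free_module_def)

lemma free_module_module: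
  assumes "cring K"
  shows "module K (free_module K X)"
proof -
  interpret K: cring K by fact
  have closed: "(\<lambda>x. f x \<oplus>\<^bsub>K\<^esub> g x) \<in> carrier (free_module K X)"
    if "f \<in> carrier (free_module K X)" "g \<in> carrier (free_module K X)" for f g
  proof -
    have "{x. f x \<oplus>\<^bsub>K\<^esub> g x \<noteq> \<zero>\<^bsub>K\<^esub>} \<subseteq> {x. f x \<noteq> \<zero>\<^bsub>K\<^esub>} \<union> {x. g x \<noteq> \<zero>\<^bsub>K\<^esub>}" by auto
    with that show ?thesis
      unfolding free_module_carrier by (auto intro: finite_subset)
  qed
  have smult: "(\<lambda>x. r \<otimes>\<^bsub>K\<^esub> f x) \<in> carrier (free_module K X)"
    if "r \<in> carrier K" "f \<in> carrier (free_module K X)" for r f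
  proof -
    have "{x. r \<otimes>\<^bsub>K\<^esub> f x \<noteq> \<zero>\<^bsub>K\<^esub>} \<subseteq> {x. f x \<noteq> \<zero>\<^bsub>K\<^esub>}" using that(1) by auto
    with that show ?thesis
      unfolding free_module_carrier by (auto intro: finite_subset)
  qed
  have val: "f x \<in> carrier K" if "f \<in> carrier (free_module K X)" for f x
    using that by (simp add: free_module_carrier)
  have ab: "abelian_group (free_module K X)"
  proof (rule abelian_groupI)
    fix f assume f: "f \<in> carrier (free_module K X)"
    show "\<exists>g \<in> carrier (free_module K X). g \<oplus>\<^bsub>free_module K X\<^esub> f = \<zero>\<^bsub>free_module K X\<^esub>"
      using smult[of "\<ominus>\<^bsub>K\<^esub> \<one>\<^bsub>K\<^esub>", OF _ f] val[OF f]
      by (intro bexI[of _ "\<lambda>x. (\<ominus>\<^bsub>K\<^esub> \<one>\<^bsub>K\<^esub>) \<otimes>\<^bsub>K\<^esub> f x"])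
        (auto simp: K.l_minus K.l_neg)
    show "\<zero>\<^bsub>free_module K X\<^esub> \<oplus>\<^bsub>free_module K X\<^esub> f = f"
      using val[OF f] by simp
  next
    show "\<zero>\<^bsub>free_module K X\<^esub> \<in> carrier (free_module K X)"
      by (simp add: free_module_carrier)
  qed (simp_all add: closed val K.a_ac)
  show ?thesis
    by (rule moduleI[OF assms ab])
      (simp_all add: smult val K.l_distr K.r_distr K.m_assoc)
qed

lemma basis_elem_closed:
  assumes "cring K" "x \<in> X"
  shows "basis_elem K x \<in> carrier (free_module K X)"
proof -
  interpret K: cring K by fact
  have "{y. basis_elem K x y \<noteq> \<zero>\<^bsub>K\<^esub>} \<subseteq> {x}" by (auto simp: basis_elem_def)
  then show ?thesis
    using assms(2) by (auto simp: free_module_carrier basis_elem_def intro: finite_subset)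
qed

text \<open>
  Induction on a finite set that contains the support: a function is a multiple of a basis
  element plus a function whose support has one point less.
\<close>

lemma basis_spans:
  assumes "cring K"
  shows "spans K (free_module K X) (basis_elem K ` X)"
proof (rule spansI[OF free_module_module[OF assms]])
  interpret K: cring K by fact
  interpret F: module K "free_module K X" by (rule free_module_module[OF assms])
  show "basis_elem K ` X \<subseteq> carrier (free_module K X)"
    using basis_elem_closed[OF assms] by auto
  fix N assume N: "submodule N K (free_module K X)" "basis_elem K ` X \<subseteq> N"
  have "f \<in> N" if "finite T" "f \<in> carrier (free_module K X)" "{x. f x \<noteq> \<zero>\<^bsub>K\<^esub>} \<subseteq> T" for T f
    using that
  proof (induction T arbitrary: f)
    case empty
    then have "f = \<zero>\<^bsub>free_module K X\<^esub>" by auto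
    moreover have "\<zero>\<^bsub>free_module K X\<^esub> \<in> N" by (rule submodule_zero[OF N(1)])
    ultimately show ?case by metis
  next
    case (insert t T)
    show ?case
    proof (cases "f t = \<zero>\<^bsub>K\<^esub>")
      case True
      then show ?thesis using insert by (intro insert.IH) auto
    next
      case False
      then have tX: "t \<in> X" using insert.prems by (auto simp: free_module_carrier)
      have sub: "{x. (f(t := \<zero>\<^bsub>K\<^esub>)) x \<noteq> \<zero>\<^bsub>K\<^esub>} \<subseteq> {x. f x \<noteq> \<zero>\<^bsub>K\<^esub>}" by auto
      have c: "f(t := \<zero>\<^bsub>K\<^esub>) \<in> carrier (free_module K X)"
        using insert.prems finite_subset[OF sub] by (auto simp: free_module_carrier)
      have "f(t := \<zero>\<^bsub>K\<^esub>) \<in> N" using insert.prems(2) by (intro insert.IH[OF c]) auto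
      moreover have "f t \<odot>\<^bsub>free_module K X\<^esub> basis_elem K t \<in> N"
        using N(2) tX insert.prems(1)
        by (intro F.submoduleE(4)[OF N(1)]) (auto simp: free_module_carrier)
      ultimately have "f(t := \<zero>\<^bsub>K\<^esub>) \<oplus>\<^bsub>free_module K X\<^esub> (f t \<odot>\<^bsub>free_module K X\<^esub> basis_elem K t) \<in> N"
        by (rule F.submoduleE(5)[OF N(1)])
      moreover have "f(t := \<zero>\<^bsub>K\<^esub>) \<oplus>\<^bsub>free_module K X\<^esub> (f t \<odot>\<^bsub>free_module K X\<^esub> basis_elem K t) = f"
        using insert.prems(1) by (auto simp: basis_elem_def free_module_carrier)
      ultimately show ?thesis by metis
    qed
  qed
  then show "carrier (free_module K X) \<subseteq> N"
    by (auto simp: free_module_carrier)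
qed

text \<open>
  The support of a sum of two functions can be smaller than the union of their supports. Summing
  over any finite set that contains the support makes linear extensions of different functions
  comparable.
\<close>

lemma lin_ext_superset:
  assumes "module K M" "\<phi> \<in> X \<rightarrow> carrier M" "f \<in> carrier (free_module K X)"
    and "finite T" "{x. f x \<noteq> \<zero>\<^bsub>K\<^esub>} \<subseteq> T" "T \<subseteq> X"
  shows "lin_ext K M \<phi> f = (\<Oplus>\<^bsub>M\<^esub>x\<in>T. f x \<odot>\<^bsub>M\<^esub> \<phi> x)"
proof -
  interpret M: module K M by fact
  have "(\<Oplus>\<^bsub>M\<^esub>x\<in>{x. f x \<noteq> \<zero>\<^bsub>K\<^esub>}. f x \<odot>\<^bsub>M\<^esub> \<phi> x) = (\<Oplus>\<^bsub>M\<^esub>x\<in>T. f x \<odot>\<^bsub>M\<^esub> \<phi> x)"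
    using assms by (intro M.add.finprod_mono_neutral_cong_left)
      (auto simp: free_module_carrier Pi_iff subset_iff intro!: M.smult_closed)
  then show ?thesis by (simp add: lin_ext_def)
qed

text \<open>
  Existence in the universal property of the free module. Uniqueness is \<open>linear_map_eqI\<close> for
  \<open>basis_spans\<close>.
\<close>

lemma lin_ext_linear:
  assumes "module K M" "\<phi> \<in> X \<rightarrow> carrier M"
  shows "linear_map K (free_module K X) M (lin_ext K M \<phi>)"
proof -
  interpret M: module K M by fact
  interpret F: module K "free_module K X" by (rule free_module_module[OF M.R.is_cring])
  have in_X: "\<phi> x \<in> carrier M" if "x \<in> X" for x using assms(2) that by auto
  show ?thesis
  proof (rule linear_mapI)
    fix f assume f: "f \<in> carrier (free_module K X)"
    then show "lin_ext K M \<phi> f \<in> carrier M"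
      unfolding lin_ext_def
      by (intro M.finsum_closed) (auto simp: free_module_carrier intro!: in_X)
  next
    fix f g assume f: "f \<in> carrier (free_module K X)" and g: "g \<in> carrier (free_module K X)"
    let ?T = "{x. f x \<noteq> \<zero>\<^bsub>K\<^esub>} \<union> {x. g x \<noteq> \<zero>\<^bsub>K\<^esub>}"
    have T: "finite ?T" "?T \<subseteq> X" and val: "\<And>x. f x \<in> carrier K" "\<And>x. g x \<in> carrier K"
      using f g by (auto simp: free_module_carrier)
    have 1: "lin_ext K M \<phi> f = (\<Oplus>\<^bsub>M\<^esub>x\<in>?T. f x \<odot>\<^bsub>M\<^esub> \<phi> x)"
      "lin_ext K M \<phi> g = (\<Oplus>\<^bsub>M\<^esub>x\<in>?T. g x \<odot>\<^bsub>M\<^esub> \<phi> x)"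
      using T by (intro lin_ext_superset[OF assms] f g; auto)+
    have "lin_ext K M \<phi> (f \<oplus>\<^bsub>free_module K X\<^esub> g)
        = (\<Oplus>\<^bsub>M\<^esub>x\<in>?T. (f \<oplus>\<^bsub>free_module K X\<^esub> g) x \<odot>\<^bsub>M\<^esub> \<phi> x)"
      using T f g by (intro lin_ext_superset[OF assms] F.a_closed) auto
    also have "\<dots> = (\<Oplus>\<^bsub>M\<^esub>x\<in>?T. f x \<odot>\<^bsub>M\<^esub> \<phi> x \<oplus>\<^bsub>M\<^esub> g x \<odot>\<^bsub>M\<^esub> \<phi> x)"
      using T val in_X by (intro M.finsum_cong') (auto intro!: M.smult_l_distr in_X)
    also have "\<dots> = (\<Oplus>\<^bsub>M\<^esub>x\<in>?T. f x \<odot>\<^bsub>M\<^esub> \<phi> x) \<oplus>\<^bsub>M\<^esub> (\<Oplus>\<^bsub>M\<^esub>x\<in>?T. g x \<odot>\<^bsub>M\<^esub> \<phi> x)"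
      using T val in_X by (intro M.finsum_addf) auto
    finally show "lin_ext K M \<phi> (f \<oplus>\<^bsub>free_module K X\<^esub> g) = lin_ext K M \<phi> f \<oplus>\<^bsub>M\<^esub> lin_ext K M \<phi> g"
      by (simp only: 1)
  next
    fix r f assume r: "r \<in> carrier K" and f: "f \<in> carrier (free_module K X)"
    let ?T = "{x. f x \<noteq> \<zero>\<^bsub>K\<^esub>}"
    have T: "finite ?T" "?T \<subseteq> X" and val: "\<And>x. f x \<in> carrier K"
      using f by (auto simp: free_module_carrier)
    have "lin_ext K M \<phi> (r \<odot>\<^bsub>free_module K X\<^esub> f)
        = (\<Oplus>\<^bsub>M\<^esub>x\<in>?T. (r \<odot>\<^bsub>free_module K X\<^esub> f) x \<odot>\<^bsub>M\<^esub> \<phi> x)"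
      using T f r by (intro lin_ext_superset[OF assms] F.smult_closed) auto
    also have "\<dots> = (\<Oplus>\<^bsub>M\<^esub>x\<in>?T. r \<odot>\<^bsub>M\<^esub> (f x \<odot>\<^bsub>M\<^esub> \<phi> x))"
      using T val r in_X by (intro M.finsum_cong') (auto intro!: M.smult_assoc1 in_X)
    also have "\<dots> = r \<odot>\<^bsub>M\<^esub> (\<Oplus>\<^bsub>M\<^esub>x\<in>?T. f x \<odot>\<^bsub>M\<^esub> \<phi> x)"
      using T val r in_X by (intro M.finsum_smult_ldistr[symmetric]) auto
    finally show "lin_ext K M \<phi> (r \<odot>\<^bsub>free_module K X\<^esub> f) = r \<odot>\<^bsub>M\<^esub> lin_ext K M \<phi> f"
      by (simp only: lin_ext_def)
  qed
qed

lemma lin_ext_basis: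
  assumes "module K M" "\<phi> \<in> X \<rightarrow> carrier M" "x \<in> X"
  shows "lin_ext K M \<phi> (basis_elem K x) = \<phi> x"
proof -
  interpret M: module K M by fact
  have x: "\<phi> x \<in> carrier M" using assms by auto
  have "lin_ext K M \<phi> (basis_elem K x) = (\<Oplus>\<^bsub>M\<^esub>y\<in>{x}. basis_elem K x y \<odot>\<^bsub>M\<^esub> \<phi> y)"
    using assms basis_elem_closed[OF M.R.is_cring assms(3)]
    by (intro lin_ext_superset[OF assms(1,2)]) (auto simp: basis_elem_def)
  also have "\<dots> = \<phi> x" using x by (simp add: basis_elem_def)
  finally show ?thesis .
qed

text \<open>
  Products below are linear extensions of linear extensions. Their linearity in one argument
  comes from the fact that a linear extension depends linearly on the prescribed values.
\<close>

lemma lin_ext_param_linear: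
  assumes "module K L" "module K M" "f \<in> carrier (free_module K X)"
    and lin: "\<And>x. x \<in> X \<Longrightarrow> linear_map K L M (\<lambda>l. \<phi> l x)"
  shows "linear_map K L M (\<lambda>l. lin_ext K M (\<phi> l) f)"
proof -
  interpret K: cring K using assms(1) by (simp add: module_def)
  interpret L: module K L by fact
  interpret M: module K M by fact
  have c: "\<phi> l \<in> X \<rightarrow> carrier M" if "l \<in> carrier L" for l
    using linear_map_closed[OF lin that] by auto
  have supp: "finite {x. f x \<noteq> \<zero>\<^bsub>K\<^esub>}" "\<And>x. f x \<noteq> \<zero>\<^bsub>K\<^esub> \<Longrightarrow> x \<in> X" "\<And>x. f x \<in> carrier K"
    using assms(3) by (auto simp: free_module_carrier)
  show ?thesis
  proof (rule linear_mapI)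
    fix l assume "l \<in> carrier L"
    then show "lin_ext K M (\<phi> l) f \<in> carrier M"
      using linear_map_closed[OF lin_ext_linear[OF assms(2) c]] assms(3) by blast
  next
    fix l l' assume l: "l \<in> carrier L" "l' \<in> carrier L"
    have "lin_ext K M (\<phi> (l \<oplus>\<^bsub>L\<^esub> l')) f
        = (\<Oplus>\<^bsub>M\<^esub>x\<in>{x. f x \<noteq> \<zero>\<^bsub>K\<^esub>}. f x \<odot>\<^bsub>M\<^esub> \<phi> l x \<oplus>\<^bsub>M\<^esub> f x \<odot>\<^bsub>M\<^esub> \<phi> l' x)"
      unfolding lin_ext_def using l supp c
      by (intro M.finsum_cong')
        (auto simp: linear_map_add[OF lin] M.smult_r_distr Pi_iff)
    also have "\<dots> = lin_ext K M (\<phi> l) f \<oplus>\<^bsub>M\<^esub> lin_ext K M (\<phi> l') f"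
      unfolding lin_ext_def using l supp c by (intro M.finsum_addf) (auto simp: Pi_iff)
    finally show "lin_ext K M (\<phi> (l \<oplus>\<^bsub>L\<^esub> l')) f = lin_ext K M (\<phi> l) f \<oplus>\<^bsub>M\<^esub> lin_ext K M (\<phi> l') f" .
  next
    fix r l assume l: "r \<in> carrier K" "l \<in> carrier L"
    have "lin_ext K M (\<phi> (r \<odot>\<^bsub>L\<^esub> l)) f = (\<Oplus>\<^bsub>M\<^esub>x\<in>{x. f x \<noteq> \<zero>\<^bsub>K\<^esub>}. r \<odot>\<^bsub>M\<^esub> (f x \<odot>\<^bsub>M\<^esub> \<phi> l x))"
      unfolding lin_ext_def
    proof (intro M.finsum_cong' refl)
      fix x assume "x \<in> {x. f x \<noteq> \<zero>\<^bsub>K\<^esub>}"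
      then have x: "x \<in> X" "\<phi> l x \<in> carrier M" using supp c l by auto
      show "f x \<odot>\<^bsub>M\<^esub> \<phi> (r \<odot>\<^bsub>L\<^esub> l) x = r \<odot>\<^bsub>M\<^esub> (f x \<odot>\<^bsub>M\<^esub> \<phi> l x)"
        using x l supp(3) K.m_comm
        by (simp add: linear_map_smult[OF lin] flip: M.smult_assoc1)
    qed (use supp c l in \<open>auto simp: Pi_iff\<close>)
    also have "\<dots> = r \<odot>\<^bsub>M\<^esub> lin_ext K M (\<phi> l) f"
      unfolding lin_ext_def using l supp c
      by (intro M.finsum_smult_ldistr[symmetric]) (auto simp: Pi_iff)
    finally show "lin_ext K M (\<phi> (r \<odot>\<^bsub>L\<^esub> l)) f = r \<odot>\<^bsub>M\<^esub> lin_ext K M (\<phi> l) f" .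
  qed
qed

lemma bilin_ext_bilinear:
  assumes "module K M" "\<And>x y. x \<in> X \<Longrightarrow> y \<in> Y \<Longrightarrow> \<phi> x y \<in> carrier M"
  shows "bilinear_map K (free_module K X) (free_module K Y) M (bilin_ext K M \<phi>)"
proof -
  interpret M: module K M by fact
  note cl = lin_ext_linear[OF assms(1)]
  have inner: "linear_map K (free_module K Y) M (lin_ext K M (\<phi> x))" if "x \<in> X" for x
    using assms(2) that by (intro cl) auto
  show ?thesis
    unfolding bilinear_map_def bilin_ext_def
  proof (intro conjI ballI)
    fix f assume "f \<in> carrier (free_module K X)"
    then show "linear_map K (free_module K Y) M (\<lambda>g. lin_ext K M (\<lambda>x. lin_ext K M (\<phi> x) g) f)"
      using inner by (intro lin_ext_param_linear[OF free_module_module[OF M.R.is_cring] assms(1)])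
  next
    fix g assume "g \<in> carrier (free_module K Y)"
    then show "linear_map K (free_module K X) M (\<lambda>f. lin_ext K M (\<lambda>x. lin_ext K M (\<phi> x) g) f)"
      using inner by (intro cl) (auto dest: linear_map_closed)
  qed
qed

lemma bilin_ext_basis:
  assumes "module K M" "\<And>x y. x \<in> X \<Longrightarrow> y \<in> Y \<Longrightarrow> \<phi> x y \<in> carrier M" "x \<in> X" "y \<in> Y"
  shows "bilin_ext K M \<phi> (basis_elem K x) (basis_elem K y) = \<phi> x y"
proof -
  interpret M: module K M by fact
  have y: "basis_elem K y \<in> carrier (free_module K Y)"
    using basis_elem_closed[OF M.R.is_cring assms(4)] .
  have "lin_ext K M (\<phi> x') (basis_elem K y) = \<phi> x' y" if "x' \<in> X" for x'
    using assms that by (intro lin_ext_basis[where X = Y]) auto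
  then show ?thesis
    unfolding bilin_ext_def using assms
    by (subst lin_ext_basis[where X = X]) auto
qed

section \<open>Quotient modules\<close>

lemma submodule_abelian_subgroup:
  assumes "module K M" "submodule N K M"
  shows "abelian_subgroup N M"
proof -
  interpret M: module K M by fact
  show ?thesis
    using assms(2) M.abelian_group_axioms
    by (auto intro!: abelian_subgroupI3 additive_subgroup.intro simp: submodule_def)
qed

lemma quot_module_carrier: "carrier (quot_module M N) = (\<lambda>x. N +>\<^bsub>M\<^esub> x) ` carrier M"
  by (auto simp: quot_module_def FactRing_def A_RCOSETS_def')

lemma quot_module_zero: "\<zero>\<^bsub>quot_module M N\<^esub> = N"
  by (simp add: quot_module_def FactRing_def)

lemma quot_module_add:
  assumes "module K M" "submodule N K M" "x \<in> carrier M" "y \<in> carrier M"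
  shows "(N +>\<^bsub>M\<^esub> x) \<oplus>\<^bsub>quot_module M N\<^esub> (N +>\<^bsub>M\<^esub> y) = N +>\<^bsub>M\<^esub> (x \<oplus>\<^bsub>M\<^esub> y)"
proof -
  interpret abelian_subgroup N M by (rule submodule_abelian_subgroup[OF assms(1,2)])
  show ?thesis
    using assms(3,4) by (simp add: quot_module_def FactRing_def a_rcos_sum)
qed

lemma coset_eq_iff:
  assumes "module K M" "submodule N K M" "x \<in> carrier M" "y \<in> carrier M"
  shows "N +>\<^bsub>M\<^esub> x = N +>\<^bsub>M\<^esub> y \<longleftrightarrow> x \<ominus>\<^bsub>M\<^esub> y \<in> N"
proof -
  interpret M: module K M by fact
  interpret abelian_subgroup N M by (rule submodule_abelian_subgroup[OF assms(1,2)])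
  show ?thesis
    using assms(3,4) a_rcos_module[of y x] a_rcos_self[of x]
      a_repr_independence'[of x y]
    by (auto simp: a_minus_def)
qed

lemma coset_self:
  assumes "module K M" "submodule N K M" "x \<in> carrier M"
  shows "x \<in> N +>\<^bsub>M\<^esub> x"
proof -
  interpret abelian_subgroup N M by (rule submodule_abelian_subgroup[OF assms(1,2)])
  show ?thesis using a_rcos_self assms(3) .
qed

text \<open>
  This is why operations on cosets may be defined by a union over all representatives.
\<close>

lemma linear_map_const_on_coset:
  assumes "module K M" "module K P" "submodule N K M" "linear_map K M P h"
    and "\<And>n. n \<in> N \<Longrightarrow> h n = \<zero>\<^bsub>P\<^esub>" "x \<in> carrier M" "y \<in> N +>\<^bsub>M\<^esub> x"
  shows "y \<in> carrier M" "h y = h x"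
proof -
  interpret M: module K M by fact
  interpret P: module K P by fact
  obtain n where n: "n \<in> N" "y = n \<oplus>\<^bsub>M\<^esub> x"
    using assms(7) by (auto simp: a_r_coset_def')
  moreover from n have "n \<in> carrier M" using M.submoduleE(1)[OF assms(3)] by auto
  ultimately show "y \<in> carrier M" "h y = h x"
    using assms(4-6) linear_map_closed[OF assms(4,6)] by (auto simp: linear_map_add)
qed

text \<open>
  Two representatives of a coset differ by an element of \<open>N\<close>, hence so do their multiples, and
  all sets in the union that defines the scalar multiple coincide.
\<close>

lemma coset_smult:
  assumes "module K M" "submodule N K M" "r \<in> carrier K" "x \<in> carrier M"
  shows "r \<odot>\<^bsub>quot_module M N\<^esub> (N +>\<^bsub>M\<^esub> x) = N +>\<^bsub>M\<^esub> (r \<odot>\<^bsub>M\<^esub> x)"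
proof -
  interpret M: module K M by fact
  interpret abelian_subgroup N M by (rule submodule_abelian_subgroup[OF assms(1,2)])
  have "N +>\<^bsub>M\<^esub> (r \<odot>\<^bsub>M\<^esub> y) = N +>\<^bsub>M\<^esub> (r \<odot>\<^bsub>M\<^esub> x)" if y: "y \<in> N +>\<^bsub>M\<^esub> x" for y
  proof -
    have yc: "y \<in> carrier M" using a_elemrcos_carrier[OF assms(4) y] .
    have "N +>\<^bsub>M\<^esub> y = N +>\<^bsub>M\<^esub> x" using a_repr_independence'[OF y assms(4)] by simp
    then have "r \<odot>\<^bsub>M\<^esub> (y \<ominus>\<^bsub>M\<^esub> x) \<in> N"
      using coset_eq_iff[OF assms(1,2) yc assms(4)] M.submoduleE(4)[OF assms(2,3)] by simp
    then show ?thesis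
      using yc assms by (simp add: coset_eq_iff a_minus_def M.smult_r_distr M.smult_r_minus)
  qed
  then have "(\<Union>y\<in>N +>\<^bsub>M\<^esub> x. N +>\<^bsub>M\<^esub> (r \<odot>\<^bsub>M\<^esub> y)) = (\<Union>y\<in>N +>\<^bsub>M\<^esub> x. N +>\<^bsub>M\<^esub> (r \<odot>\<^bsub>M\<^esub> x))"
    by (rule SUP_cong[OF HOL.refl])
  also have "\<dots> = N +>\<^bsub>M\<^esub> (r \<odot>\<^bsub>M\<^esub> x)"
    using coset_self[OF assms(1,2,4)] by (intro UN_constant[THEN HOL.trans]) auto
  finally show ?thesis by (simp add: quot_module_def)
qed

lemma quot_module_module:
  assumes "module K M" "submodule N K M"
  shows "module K (quot_module M N)"
proof -
  interpret M: module K M by fact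
  interpret abelian_subgroup N M by (rule submodule_abelian_subgroup[OF assms])
  have N: "N +>\<^bsub>M\<^esub> \<zero>\<^bsub>M\<^esub> = N"
    by (rule M.a_coset_add_zero[OF a_subset])
  have ab: "abelian_group (quot_module M N)"
  proof (rule abelian_groupI)
    show "\<zero>\<^bsub>quot_module M N\<^esub> \<in> carrier (quot_module M N)"
      using N by (force simp: quot_module_zero quot_module_carrier)
    fix U assume "U \<in> carrier (quot_module M N)"
    then obtain x where x: "x \<in> carrier M" "U = N +>\<^bsub>M\<^esub> x" by (auto simp: quot_module_carrier)
    then show "\<zero>\<^bsub>quot_module M N\<^esub> \<oplus>\<^bsub>quot_module M N\<^esub> U = U"
      using quot_module_add[OF assms M.zero_closed x(1)] N by (simp add: quot_module_zero)
    show "\<exists>V \<in> carrier (quot_module M N). V \<oplus>\<^bsub>quot_module M N\<^esub> U = \<zero>\<^bsub>quot_module M N\<^esub>"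
      using x N by (intro bexI[of _ "N +>\<^bsub>M\<^esub> (\<ominus>\<^bsub>M\<^esub> x)"])
        (auto simp: quot_module_carrier quot_module_add[OF assms] quot_module_zero M.l_neg)
  qed (auto simp: quot_module_carrier quot_module_add[OF assms] M.a_ac)
  show ?thesis
    by (rule moduleI[OF M.R.is_cring ab])
      (auto simp: quot_module_carrier coset_smult[OF assms] quot_module_add[OF assms]
        M.smult_l_distr M.smult_r_distr M.smult_assoc1)
qed

lemma coset_linear:
  assumes "module K M" "submodule N K M"
  shows "linear_map K M (quot_module M N) (\<lambda>x. N +>\<^bsub>M\<^esub> x)"
  by (rule linear_mapI) (auto simp: quot_module_carrier coset_smult[OF assms] quot_module_add[OF assms])

text \<open>
  The universal property of the quotient. The induced map takes the value at an arbitrary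
  representative.
\<close>

lemma quot_module_lift:
  assumes "module K M" "module K P" "submodule N K M" "linear_map K M P h"
    and "\<And>n. n \<in> N \<Longrightarrow> h n = \<zero>\<^bsub>P\<^esub>"
  obtains g where "linear_map K (quot_module M N) P g" "\<And>x. x \<in> carrier M \<Longrightarrow> g (N +>\<^bsub>M\<^esub> x) = h x"
proof -
  interpret M: module K M by fact
  define g where "g U = h (SOME x. x \<in> U)" for U
  have g: "g (N +>\<^bsub>M\<^esub> x) = h x" if "x \<in> carrier M" for x
    unfolding g_def
    using linear_map_const_on_coset(2)[OF assms that] coset_self[OF assms(1,3) that]
    by (metis someI)
  have "linear_map K (quot_module M N) P g"
    by (rule linear_mapI)
      (auto simp: quot_module_carrier coset_smult[OF assms(1,3)] quot_module_add[OF assms(1,3)] g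
        linear_mapD[OF assms(4)])
  with g show ?thesis using that by blast
qed

section \<open>Associative algebras\<close>

lemma assoc_algebra_ring: "assoc_algebra K M \<Longrightarrow> ring M"
  and assoc_algebra_module: "assoc_algebra K M \<Longrightarrow> module K M"
  by (simp_all add: assoc_algebra_def)

lemma assoc_algebra_mult_bilinear:
  assumes "assoc_algebra K M"
  shows "bilinear_map K M M M (\<lambda>x y. x \<otimes>\<^bsub>M\<^esub> y)"
proof -
  interpret M: ring M by (rule assoc_algebra_ring[OF assms])
  interpret assoc_algebra K M by fact
  show ?thesis
    by (auto simp: bilinear_map_def M.l_distr M.r_distr smult_mult_left smult_mult_right
        intro!: linear_mapI)
qed

text \<open>
  Both sides of the associative law are linear in each argument. Therefore elements of the
  spanning set can be replaced by arbitrary elements, one argument at a time.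
\<close>

lemma assoc_algebraI_spans:
  assumes "module K M" "spans K M S" "\<one>\<^bsub>M\<^esub> \<in> carrier M"
    and bil: "bilinear_map K M M M (\<lambda>x y. x \<otimes>\<^bsub>M\<^esub> y)"
    and assoc: "\<And>x y z. x \<in> S \<Longrightarrow> y \<in> S \<Longrightarrow> z \<in> S \<Longrightarrow> (x \<otimes>\<^bsub>M\<^esub> y) \<otimes>\<^bsub>M\<^esub> z = x \<otimes>\<^bsub>M\<^esub> (y \<otimes>\<^bsub>M\<^esub> z)"
    and one: "\<And>x. x \<in> S \<Longrightarrow> \<one>\<^bsub>M\<^esub> \<otimes>\<^bsub>M\<^esub> x = x" "\<And>x. x \<in> S \<Longrightarrow> x \<otimes>\<^bsub>M\<^esub> \<one>\<^bsub>M\<^esub> = x"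
  shows "assoc_algebra K M"
proof -
  interpret M: module K M by fact
  note l = bilinear_map_left[OF bil] and r = bilinear_map_right[OF bil]
  note cl = bilinear_map_closed[OF bil]
  have S: "x \<in> carrier M" if "x \<in> S" for x using that assms(2) by (auto simp: spans_def)
  have id: "linear_map K M M (\<lambda>x. x)" by (rule linear_mapI) auto
  have a1: "(x \<otimes>\<^bsub>M\<^esub> y) \<otimes>\<^bsub>M\<^esub> z = x \<otimes>\<^bsub>M\<^esub> (y \<otimes>\<^bsub>M\<^esub> z)" if "x \<in> S" "y \<in> S" "z \<in> carrier M" for x y z
  proof (rule linear_map_eqI[OF assms(1,1,2), where f = "\<lambda>z. (x \<otimes>\<^bsub>M\<^esub> y) \<otimes>\<^bsub>M\<^esub> z" and x = z])
    show "linear_map K M M (\<lambda>z. (x \<otimes>\<^bsub>M\<^esub> y) \<otimes>\<^bsub>M\<^esub> z)"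
      by (rule r[OF cl[OF S S]]) fact+
    show "linear_map K M M (\<lambda>z. x \<otimes>\<^bsub>M\<^esub> (y \<otimes>\<^bsub>M\<^esub> z))"
      by (rule linear_map_comp[OF r[OF S] r[OF S]]) fact+
  qed (use that assoc in auto)
  have a2: "(x \<otimes>\<^bsub>M\<^esub> y) \<otimes>\<^bsub>M\<^esub> z = x \<otimes>\<^bsub>M\<^esub> (y \<otimes>\<^bsub>M\<^esub> z)" if "x \<in> S" "y \<in> carrier M" "z \<in> carrier M" for x y z
  proof (rule linear_map_eqI[OF assms(1,1,2), where f = "\<lambda>y. (x \<otimes>\<^bsub>M\<^esub> y) \<otimes>\<^bsub>M\<^esub> z" and x = y])
    show "linear_map K M M (\<lambda>y. (x \<otimes>\<^bsub>M\<^esub> y) \<otimes>\<^bsub>M\<^esub> z)"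
      by (rule linear_map_comp[OF r[OF S] l]) fact+
    show "linear_map K M M (\<lambda>y. x \<otimes>\<^bsub>M\<^esub> (y \<otimes>\<^bsub>M\<^esub> z))"
      by (rule linear_map_comp[OF l r[OF S]]) fact+
  qed (use that a1 in auto)
  have a3: "(x \<otimes>\<^bsub>M\<^esub> y) \<otimes>\<^bsub>M\<^esub> z = x \<otimes>\<^bsub>M\<^esub> (y \<otimes>\<^bsub>M\<^esub> z)"
    if "x \<in> carrier M" "y \<in> carrier M" "z \<in> carrier M" for x y z
  proof (rule linear_map_eqI[OF assms(1,1,2), where f = "\<lambda>x. (x \<otimes>\<^bsub>M\<^esub> y) \<otimes>\<^bsub>M\<^esub> z" and x = x])
    show "linear_map K M M (\<lambda>x. (x \<otimes>\<^bsub>M\<^esub> y) \<otimes>\<^bsub>M\<^esub> z)"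
      by (rule linear_map_comp[OF l l]) fact+
    show "linear_map K M M (\<lambda>x. x \<otimes>\<^bsub>M\<^esub> (y \<otimes>\<^bsub>M\<^esub> z))"
      by (rule l[OF cl]) fact+
  qed (use that a2 in auto)
  have o1: "\<one>\<^bsub>M\<^esub> \<otimes>\<^bsub>M\<^esub> x = x" if "x \<in> carrier M" for x
    by (rule linear_map_eqI[OF assms(1,1,2) r[OF assms(3)] id one(1) that])
  have o2: "x \<otimes>\<^bsub>M\<^esub> \<one>\<^bsub>M\<^esub> = x" if "x \<in> carrier M" for x
    by (rule linear_map_eqI[OF assms(1,1,2) l[OF assms(3)] id one(2) that])
  have ring: "ring M"
    by (rule ringI[OF M.abelian_group_axioms])
      (auto intro!: monoidI simp: cl a3 o1 o2 assms(3) linear_map_add[OF l] linear_map_add[OF r])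
  show ?thesis
    by (intro assoc_algebra.intro assms(1) ring assoc_algebra_axioms.intro)
      (auto simp: linear_map_smult[OF l] linear_map_smult[OF r])
qed

text \<open>
  The elements \<open>x\<close> for which \<open>s \<otimes> x\<close> lies in the span form a submodule, so the condition on
  products of generators extends first from relations to their span and then from \<open>S\<close> to the
  whole algebra.
\<close>

lemma span_submodule_ideal:
  assumes "assoc_algebra K M" "spans K M S" "R \<subseteq> carrier M"
    and l: "\<And>s r. s \<in> S \<Longrightarrow> r \<in> R \<Longrightarrow> s \<otimes>\<^bsub>M\<^esub> r \<in> span_submodule K M R"
    and r: "\<And>s r. s \<in> S \<Longrightarrow> r \<in> R \<Longrightarrow> r \<otimes>\<^bsub>M\<^esub> s \<in> span_submodule K M R"
  shows "ideal (span_submodule K M R) M"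
proof -
  interpret M: ring M by (rule assoc_algebra_ring[OF assms(1)])
  interpret assoc_algebra K M by fact
  have modl: "module K M" by (rule module_axioms)
  note bil = assoc_algebra_mult_bilinear[OF assms(1)]
  let ?N = "span_submodule K M R"
  have N: "submodule ?N K M" by (rule span_submodule_submodule[OF modl assms(3)])
  note NE = submoduleE[OF N]
  have zero: "\<zero>\<^bsub>M\<^esub> \<in> ?N" by (rule submodule_zero[OF N])
  have pre: "submodule {x \<in> carrier M. h x \<in> ?N} K M" if h: "linear_map K M M h" for h
    using NE zero linear_mapD[OF h] linear_map_zero[OF modl modl h] linear_map_uminus[OF modl modl h]
    by (intro submoduleI) auto
  have Sc: "s \<in> carrier M" if "s \<in> S" for s using that assms(2) by (auto simp: spans_def)
  have Rc: "r \<in> carrier M" if "r \<in> R" for r using that assms(3) by auto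
  have 1: "s \<otimes>\<^bsub>M\<^esub> n \<in> ?N" "n \<otimes>\<^bsub>M\<^esub> s \<in> ?N" if sn: "s \<in> S" "n \<in> ?N" for s n
  proof -
    have "?N \<subseteq> {x \<in> carrier M. s \<otimes>\<^bsub>M\<^esub> x \<in> ?N}"
      using l sn Rc by (intro span_submodule_least[OF pre[OF bilinear_map_right[OF bil Sc[OF sn(1)]]]]) auto
    moreover have "?N \<subseteq> {x \<in> carrier M. x \<otimes>\<^bsub>M\<^esub> s \<in> ?N}"
      using r sn Rc by (intro span_submodule_least[OF pre[OF bilinear_map_left[OF bil Sc[OF sn(1)]]]]) auto
    ultimately show "s \<otimes>\<^bsub>M\<^esub> n \<in> ?N" "n \<otimes>\<^bsub>M\<^esub> s \<in> ?N" using sn by auto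
  qed
  have 2: "x \<otimes>\<^bsub>M\<^esub> n \<in> ?N" "n \<otimes>\<^bsub>M\<^esub> x \<in> ?N" if xn: "x \<in> carrier M" "n \<in> ?N" for x n
  proof -
    have n: "n \<in> carrier M" using NE(1) xn(2) by auto
    have S: "span_submodule K M S = carrier M" using assms(2) by (simp add: spans_def)
    have "span_submodule K M S \<subseteq> {x \<in> carrier M. n \<otimes>\<^bsub>M\<^esub> x \<in> ?N}"
      using 1 xn Sc by (intro span_submodule_least[OF pre[OF bilinear_map_right[OF bil n]]]) auto
    moreover have "span_submodule K M S \<subseteq> {x \<in> carrier M. x \<otimes>\<^bsub>M\<^esub> n \<in> ?N}"
      using 1 xn Sc by (intro span_submodule_least[OF pre[OF bilinear_map_left[OF bil n]]]) auto
    ultimately show "x \<otimes>\<^bsub>M\<^esub> n \<in> ?N" "n \<otimes>\<^bsub>M\<^esub> x \<in> ?N" using xn(1) by (auto simp: S)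
  qed
  show ?thesis
    using N 2 by (intro idealI M.ring_axioms) (auto simp: submodule_def)
qed

lemma quot_module_mult:
  assumes "ideal N M" "x \<in> carrier M" "y \<in> carrier M"
  shows "(N +>\<^bsub>M\<^esub> x) \<otimes>\<^bsub>quot_module M N\<^esub> (N +>\<^bsub>M\<^esub> y) = N +>\<^bsub>M\<^esub> (x \<otimes>\<^bsub>M\<^esub> y)"
  using ideal.rcoset_mult_add[OF assms] by (simp add: quot_module_def FactRing_def)

lemma quot_module_one: "\<one>\<^bsub>quot_module M N\<^esub> = N +>\<^bsub>M\<^esub> \<one>\<^bsub>M\<^esub>"
  by (simp add: quot_module_def FactRing_def)

lemma quot_module_assoc_algebra:
  assumes "assoc_algebra K M" "submodule N K M" "ideal N M"
  shows "assoc_algebra K (quot_module M N)"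
proof -
  interpret M: ring M by (rule assoc_algebra_ring[OF assms(1)])
  interpret assoc_algebra K M by fact
  have m: "module K M" by (rule module_axioms)
  have Q: "module K (quot_module M N)" by (rule quot_module_module[OF m assms(2)])
  interpret Q: module K "quot_module M N" by (rule Q)
  note rules = quot_module_carrier quot_module_mult[OF assms(3)] quot_module_add[OF m assms(2)]
    coset_smult[OF m assms(2)] quot_module_one
  have ring: "ring (quot_module M N)"
    by (rule ringI[OF Q.abelian_group_axioms])
      (auto intro!: monoidI simp: rules M.m_assoc M.l_distr M.r_distr)
  show ?thesis
    by (intro assoc_algebra.intro Q ring assoc_algebra_axioms.intro)
      (auto simp: rules smult_mult_left smult_mult_right)
qed

section \<open>Tensor products\<close>

context
  fixes K :: "('k, 'r) ring_scheme" and M :: "('k, 'm, 's) module_scheme"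
    and N :: "('k, 'n, 't) module_scheme"
  assumes M: "module K M" and N: "module K N"
begin

interpretation M: module K M by (rule M)
interpretation N: module K N by (rule N)

private abbreviation (input) "F \<equiv> free_module K (carrier M \<times> carrier N)"

lemma pairs_module: "module K F"
  by (rule free_module_module[OF M.R.is_cring])

interpretation F: module K F by (rule pairs_module)

lemma pair_closed: "x \<in> carrier M \<Longrightarrow> y \<in> carrier N \<Longrightarrow> basis_elem K (x, y) \<in> carrier F"
  by (rule basis_elem_closed[OF M.R.is_cring]) auto

lemma bilinear_relations_subset: "bilinear_relations K M N \<subseteq> carrier F"
  unfolding bilinear_relations_def Let_def
  by (auto simp del: free_module_simps intro!: F.minus_closed F.a_closed F.smult_closed pair_closed)

lemma tensor_kernel_submodule: "submodule (tensor_kernel K M N) K F"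
  unfolding tensor_kernel_def
  by (rule span_submodule_submodule[OF pairs_module bilinear_relations_subset])

lemma tensor_module_module: "module K (tensor_module K M N)"
  unfolding tensor_module_def by (rule quot_module_module[OF pairs_module tensor_kernel_submodule])

lemma tensor_relation_eq:
  assumes "f \<ominus>\<^bsub>F\<^esub> g \<in> bilinear_relations K M N" "f \<in> carrier F" "g \<in> carrier F"
  shows "tensor_kernel K M N +>\<^bsub>F\<^esub> f = tensor_kernel K M N +>\<^bsub>F\<^esub> g"
  using coset_eq_iff[OF pairs_module tensor_kernel_submodule assms(2,3)] assms(1)
    span_submodule_superset[of "bilinear_relations K M N" K F]
  unfolding tensor_kernel_def by blast

lemma pure_tensor_bilinear: "bilinear_map K M N (tensor_module K M N) (pure_tensor K M N)"
proof -
  note sub = tensor_kernel_submodule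
  note add = quot_module_add[OF pairs_module sub]
    and smult = coset_smult[OF pairs_module sub]
  have c: "pure_tensor K M N x y \<in> carrier (tensor_module K M N)"
    if "x \<in> carrier M" "y \<in> carrier N" for x y
    using pair_closed[OF that] by (auto simp: pure_tensor_def tensor_module_def quot_module_carrier)
  show ?thesis
    unfolding bilinear_map_def
  proof (intro conjI ballI linear_mapI c; assumption?)
    fix x y y' assume a: "x \<in> carrier M" "y \<in> carrier N" "y' \<in> carrier N"
    then show "pure_tensor K M N x (y \<oplus>\<^bsub>N\<^esub> y') =
        pure_tensor K M N x y \<oplus>\<^bsub>tensor_module K M N\<^esub> pure_tensor K M N x y'"
      unfolding pure_tensor_def tensor_module_def
      by (subst add; intro tensor_relation_eq pair_closed F.a_closed N.a_closed)
        (auto simp: bilinear_relations_def Let_def simp del: free_module_simps)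
  next
    fix x r y assume "x \<in> carrier M" "r \<in> carrier K" "y \<in> carrier N"
    then show "pure_tensor K M N x (r \<odot>\<^bsub>N\<^esub> y) = r \<odot>\<^bsub>tensor_module K M N\<^esub> pure_tensor K M N x y"
      unfolding pure_tensor_def tensor_module_def
      by (subst smult; (intro tensor_relation_eq pair_closed F.smult_closed N.smult_closed)?)
        (auto simp: bilinear_relations_def Let_def simp del: free_module_simps)
  next
    fix y x x' assume a: "y \<in> carrier N" "x \<in> carrier M" "x' \<in> carrier M"
    then show "pure_tensor K M N (x \<oplus>\<^bsub>M\<^esub> x') y =
        pure_tensor K M N x y \<oplus>\<^bsub>tensor_module K M N\<^esub> pure_tensor K M N x' y"
      unfolding pure_tensor_def tensor_module_def
      by (subst add; intro tensor_relation_eq pair_closed F.a_closed M.a_closed)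
        (auto simp: bilinear_relations_def Let_def simp del: free_module_simps)
  next
    fix y r x assume "y \<in> carrier N" "r \<in> carrier K" "x \<in> carrier M"
    then show "pure_tensor K M N (r \<odot>\<^bsub>M\<^esub> x) y = r \<odot>\<^bsub>tensor_module K M N\<^esub> pure_tensor K M N x y"
      unfolding pure_tensor_def tensor_module_def
      by (subst smult; (intro tensor_relation_eq pair_closed F.smult_closed M.smult_closed)?)
        (auto simp: bilinear_relations_def Let_def simp del: free_module_simps)
  qed
qed

text \<open>
  The kernel is spanned by the bilinearity relations, and a bilinear map sends each of them to
  zero.
\<close>

lemma bilinear_zero_on_tensor_kernel:
  assumes P: "module K P" and \<phi>: "bilinear_map K M N P (\<lambda>x y. \<phi> (x, y))"
    and n: "n \<in> tensor_kernel K M N"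
  shows "lin_ext K P \<phi> n = \<zero>\<^bsub>P\<^esub>"
proof -
  interpret P: module K P by fact
  have \<phi>c: "\<phi> (x, y) \<in> carrier P" if "x \<in> carrier M" "y \<in> carrier N" for x y
    using bilinear_map_closed[OF \<phi> that] .
  then have \<phi>X: "\<phi> \<in> carrier M \<times> carrier N \<rightarrow> carrier P" by auto
  have lin: "linear_map K F P (lin_ext K P \<phi>)"
    by (rule lin_ext_linear[OF P \<phi>X])
  have b: "lin_ext K P \<phi> (basis_elem K (x, y)) = \<phi> (x, y)" if "x \<in> carrier M" "y \<in> carrier N" for x y
    using that by (intro lin_ext_basis[OF P \<phi>X]) auto
  note l = linear_mapD[OF lin] and lm = linear_map_minus[OF pairs_module P lin]
  note left = linear_mapD[OF bilinear_map_left[OF \<phi>]] and right = linear_mapD[OF bilinear_map_right[OF \<phi>]]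
  have minus: "x \<ominus>\<^bsub>P\<^esub> x = \<zero>\<^bsub>P\<^esub>" if "x \<in> carrier P" for x
    using that by (simp add: a_minus_def P.r_neg)
  have "lin_ext K P \<phi> r = \<zero>\<^bsub>P\<^esub>" if "r \<in> bilinear_relations K M N" for r
    using that unfolding bilinear_relations_def Let_def
    by (auto simp del: free_module_simps
        simp: l lm b pair_closed F.smult_closed F.a_closed left right \<phi>c minus)
  then show ?thesis
    using linear_map_zero_on_span[OF pairs_module P lin bilinear_relations_subset] n
    unfolding tensor_kernel_def by blast
qed

text \<open>
  The universal property of the tensor product.
\<close>

lemma tensor_lift:
  assumes P: "module K P" and \<phi>: "bilinear_map K M N P \<phi>"
  obtains h where "linear_map K (tensor_module K M N) P h"
    "\<And>x y. x \<in> carrier M \<Longrightarrow> y \<in> carrier N \<Longrightarrow> h (pure_tensor K M N x y) = \<phi> x y"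
proof -
  interpret P: module K P by fact
  let ?\<phi> = "\<lambda>(x, y). \<phi> x y"
  have \<phi>X: "?\<phi> \<in> carrier M \<times> carrier N \<rightarrow> carrier P"
    using bilinear_map_closed[OF \<phi>] by auto
  have lin: "linear_map K F P (lin_ext K P ?\<phi>)"
    by (rule lin_ext_linear[OF P \<phi>X])
  obtain h where h: "linear_map K (tensor_module K M N) P h"
    "\<And>x. x \<in> carrier F \<Longrightarrow> h (tensor_kernel K M N +>\<^bsub>F\<^esub> x) = lin_ext K P ?\<phi> x"
    unfolding tensor_module_def
    using quot_module_lift[OF pairs_module P tensor_kernel_submodule lin]
      bilinear_zero_on_tensor_kernel[OF P, of ?\<phi>] \<phi> by auto
  show ?thesis
  proof (rule that[OF h(1)])
    fix x y assume xy: "x \<in> carrier M" "y \<in> carrier N"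
    then show "h (pure_tensor K M N x y) = \<phi> x y"
      unfolding pure_tensor_def
      by (simp add: h(2) pair_closed lin_ext_basis[OF P \<phi>X])
  qed
qed

text \<open>
  Spanning sets of the factors suffice: by bilinearity a submodule that contains the tensors of
  their elements contains all pure tensors, one factor at a time, and pure tensors are the
  images of the basis elements of a free module.
\<close>

lemma tensor_spans:
  assumes S: "spans K M S" and T: "spans K N T"
  shows "spans K (tensor_module K M N) {pure_tensor K M N s t | s t. s \<in> S \<and> t \<in> T}"
proof (rule spansI[OF tensor_module_module])
  let ?W = "tensor_module K M N"
  interpret W: module K ?W by (rule tensor_module_module)
  note bil = pure_tensor_bilinear
  have ST: "S \<subseteq> carrier M" "T \<subseteq> carrier N" using S T by (auto simp: spans_def)
  then show "{pure_tensor K M N s t | s t. s \<in> S \<and> t \<in> T} \<subseteq> carrier ?W"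
    using bilinear_map_closed[OF bil] by blast
  fix L assume L: "submodule L K ?W" "{pure_tensor K M N s t | s t. s \<in> S \<and> t \<in> T} \<subseteq> L"
  note LE = W.submoduleE[OF L(1)]
  have L0: "\<zero>\<^bsub>?W\<^esub> \<in> L" by (rule submodule_zero[OF L(1)])
  have 1: "pure_tensor K M N s y \<in> L" if "s \<in> S" "y \<in> carrier N" for s y
    using N T that(2)
  proof (induction y rule: spans_induct)
    case zero
    then show ?case
      using linear_map_zero[OF N tensor_module_module bilinear_map_right[OF bil]] L0 that ST by auto
  next
    case (base t)
    then show ?case using L(2) that(1) by blast
  next
    case (add y y')
    then show ?case
      using LE(5) that(1) ST by (simp add: linear_map_add[OF bilinear_map_right[OF bil]] subset_iff)
  next
    case (smult r y)
    then show ?case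
      using LE(4) that(1) ST by (simp add: linear_map_smult[OF bilinear_map_right[OF bil]] subset_iff)
  qed
  have 2: "pure_tensor K M N x y \<in> L" if "x \<in> carrier M" "y \<in> carrier N" for x y
    using M S that(1)
  proof (induction x rule: spans_induct)
    case zero
    then show ?case
      using linear_map_zero[OF M tensor_module_module bilinear_map_left[OF bil]] L0 that by auto
  next
    case (base s)
    then show ?case using 1 that(2) by blast
  next
    case (add x x')
    then show ?case
      using LE(5) that(2) by (simp add: linear_map_add[OF bilinear_map_left[OF bil]])
  next
    case (smult r x)
    then show ?case
      using LE(4) that(2) by (simp add: linear_map_smult[OF bilinear_map_left[OF bil]])
  qed
  have "spans K ?W ((\<lambda>f. tensor_kernel K M N +>\<^bsub>F\<^esub> f) ` (basis_elem K ` (carrier M \<times> carrier N)))"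
    unfolding tensor_module_def
    by (rule linear_image_spans[OF pairs_module
          quot_module_module[OF pairs_module tensor_kernel_submodule] basis_spans[OF M.R.is_cring]
          coset_linear[OF pairs_module tensor_kernel_submodule]])
      (simp add: quot_module_carrier)
  then have "carrier ?W = span_submodule K ?W
      ((\<lambda>f. tensor_kernel K M N +>\<^bsub>F\<^esub> f) ` (basis_elem K ` (carrier M \<times> carrier N)))"
    by (simp add: spans_def)
  also have "\<dots> \<subseteq> L"
    using 2 by (intro span_submodule_least[OF L(1)]) (auto simp: pure_tensor_def)
  finally show "carrier ?W \<subseteq> L" .
qed

end

section \<open>Monoid algebras\<close>

text \<open>
  The monoid algebra and the wreath product algebra arise from modules by replacing the product
  and the unit of a record. Facts about modules do not see this change.
\<close>

definition same_module :: "('k, 'm, 's) module_scheme \<Rightarrow> ('k, 'm, 's) module_scheme \<Rightarrow> bool"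
  where "same_module M M' \<longleftrightarrow> carrier M = carrier M' \<and> zero M = zero M' \<and> add M = add M' \<and>
    smult M = smult M'"

lemma same_module_cong:
  assumes "same_module M M'"
  shows same_module_module: "module K M \<longleftrightarrow> module K M'"
    and same_module_submodule: "submodule N K M \<longleftrightarrow> submodule N K M'"
    and same_module_linear_source: "linear_map K M P h \<longleftrightarrow> linear_map K M' P h"
    and same_module_linear_target: "linear_map K P M g \<longleftrightarrow> linear_map K P M' g"
    and same_module_spans: "spans K M S \<longleftrightarrow> spans K M' S"
proof -
  have 1: "add_monoid M = add_monoid M'" using assms by (simp add: same_module_def)
  show 2: "submodule N K M \<longleftrightarrow> submodule N K M'" for N
    using 1 assms by (simp add: submodule_def submodule_axioms_def same_module_def)
  show "module K M \<longleftrightarrow> module K M'"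
    using 1 assms
    by (simp add: module_def module_axioms_def abelian_group_def abelian_monoid_def
        abelian_group_axioms_def same_module_def)
  show "spans K M S \<longleftrightarrow> spans K M' S"
    using assms by (simp add: spans_def span_submodule_def 2 same_module_def)
qed (use assms in \<open>simp_all add: linear_map_def same_module_def\<close>)

lemma same_module_monoid_algebra: "same_module (monoid_algebra K G) (free_module K (carrier G))"
  by (simp add: same_module_def monoid_algebra_def)

lemma monoid_algebra_carrier: "carrier (monoid_algebra K G) = carrier (free_module K (carrier G))"
  by (simp add: monoid_algebra_def)

lemma monoid_algebra_one: "\<one>\<^bsub>monoid_algebra K G\<^esub> = basis_elem K \<one>\<^bsub>G\<^esub>"
  by (simp add: monoid_algebra_def)

text \<open>
  The product is the bilinear extension of the product of the monoid, so the algebra laws reduce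
  to the monoid laws on basis elements.
\<close>

lemma monoid_algebra_assoc_algebra:
  assumes "cring K" "Group.monoid G"
  shows "assoc_algebra K (monoid_algebra K G)"
    and "spans K (monoid_algebra K G) (basis_elem K ` carrier G)"
    and "x \<in> carrier G \<Longrightarrow> y \<in> carrier G \<Longrightarrow>
      basis_elem K x \<otimes>\<^bsub>monoid_algebra K G\<^esub> basis_elem K y = basis_elem K (x \<otimes>\<^bsub>G\<^esub> y)"
proof -
  interpret G: Group.monoid G by fact
  let ?F = "free_module K (carrier G)" and ?M = "monoid_algebra K G"
  note same = same_module_cong[OF same_module_monoid_algebra]
  have F: "module K ?F" by (rule free_module_module[OF assms(1)])
  have be: "basis_elem K x \<in> carrier ?F" if "x \<in> carrier G" for x
    by (rule basis_elem_closed[OF assms(1) that])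
  have mult: "(\<otimes>\<^bsub>?M\<^esub>) = bilin_ext K ?F (\<lambda>x y. basis_elem K (x \<otimes>\<^bsub>G\<^esub> y))"
    by (simp add: monoid_algebra_def)
  have b: "basis_elem K x \<otimes>\<^bsub>?M\<^esub> basis_elem K y = basis_elem K (x \<otimes>\<^bsub>G\<^esub> y)"
    if "x \<in> carrier G" "y \<in> carrier G" for x y
    unfolding mult using that by (intro bilin_ext_basis[OF F]) (auto intro: be)
  then show "x \<in> carrier G \<Longrightarrow> y \<in> carrier G \<Longrightarrow>
      basis_elem K x \<otimes>\<^bsub>?M\<^esub> basis_elem K y = basis_elem K (x \<otimes>\<^bsub>G\<^esub> y)" .
  show sp: "spans K ?M (basis_elem K ` carrier G)"
    by (simp add: same basis_spans[OF assms(1)])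
  show "assoc_algebra K ?M"
  proof (rule assoc_algebraI_spans[OF _ sp])
    have "bilinear_map K ?F ?F ?F (\<lambda>x y. x \<otimes>\<^bsub>?M\<^esub> y)"
      unfolding mult by (rule bilin_ext_bilinear[OF F]) (auto intro: be)
    then show "bilinear_map K ?M ?M ?M (\<lambda>x y. x \<otimes>\<^bsub>?M\<^esub> y)"
      by (simp add: bilinear_map_def same monoid_algebra_carrier)
  qed (auto simp: same F monoid_algebra_carrier monoid_algebra_one b be G.m_assoc)
qed

section \<open>Tensor powers of an algebra\<close>

text \<open>
  Linearity in each position is expressed by updating a tuple at this position, as in the
  relations that define the tensor power.
\<close>

definition multilinear_map ::
  "('k, 'r) ring_scheme \<Rightarrow> ('k, 'a, 's) module_scheme \<Rightarrow> nat \<Rightarrow> ('k, 'm, 't) module_scheme \<Rightarrow>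
    ((nat \<Rightarrow> 'a) \<Rightarrow> 'm) \<Rightarrow> bool"
  where "multilinear_map K A d M \<psi> \<longleftrightarrow>
    (\<forall>a \<in> carrier (tuples A d). \<psi> a \<in> carrier M \<and>
      (\<forall>i \<in> {1..d}. linear_map K A M (\<lambda>x. \<psi> (a(i := x)))))"

lemma multilinear_map_comp:
  assumes "multilinear_map K A d M \<psi>" "linear_map K M P h"
  shows "multilinear_map K A d P (\<lambda>a. h (\<psi> a))"
  unfolding multilinear_map_def
proof (intro ballI conjI)
  fix a i assume a: "a \<in> carrier (tuples A d)" and i: "i \<in> {1..d}"
  show "linear_map K A P (\<lambda>x. h (\<psi> (a(i := x))))"
    using assms(1) a i by (intro linear_map_comp[OF _ assms(2)]) (auto simp: multilinear_map_def)
qed (use assms in \<open>auto simp: multilinear_map_def linear_mapD\<close>)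

lemma tuples_carrier: "carrier (tuples A d) = (\<Pi>\<^sub>E i\<in>{1..d}. carrier A)"
  and tuples_mult: "x \<otimes>\<^bsub>tuples A d\<^esub> y = (\<lambda>i\<in>{1..d}. x i \<otimes>\<^bsub>A\<^esub> y i)"
  and tuples_one: "\<one>\<^bsub>tuples A d\<^esub> = (\<lambda>i\<in>{1..d}. \<one>\<^bsub>A\<^esub>)"
  by (simp_all add: tuples_def)

lemma tuples_nth: "a \<in> carrier (tuples A d) \<Longrightarrow> i \<in> {1..d} \<Longrightarrow> a i \<in> carrier A"
  by (auto simp: tuples_carrier)

lemma tuples_upd: "a \<in> carrier (tuples A d) \<Longrightarrow> i \<in> {1..d} \<Longrightarrow> x \<in> carrier A \<Longrightarrow> a(i := x) \<in> carrier (tuples A d)"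
  by (auto simp: tuples_carrier PiE_iff extensional_def)

lemma tuples_permute:
  assumes "a \<in> carrier (tuples A d)" "\<pi> permutes {1..d}"
  shows "a \<circ> \<pi> \<in> carrier (tuples A d)"
proof -
  have "\<pi> i \<in> {1..d}" if "i \<in> {1..d}" for i using permutes_in_image[OF assms(2)] that by blast
  moreover have "\<pi> i = i" if "i \<notin> {1..d}" for i using assms(2) that by (simp add: permutes_not_in)
  ultimately show ?thesis using assms(1)
    by (auto simp: tuples_carrier PiE_iff extensional_def simp del: atLeastAtMost_iff)
qed

lemma tuples_mult_permute:
  assumes "\<pi> permutes {1..d}"
  shows "(a \<otimes>\<^bsub>tuples A d\<^esub> b) \<circ> \<pi> = (a \<circ> \<pi>) \<otimes>\<^bsub>tuples A d\<^esub> (b \<circ> \<pi>)"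
  using permutes_in_image[OF assms] by (auto simp: tuples_mult fun_eq_iff restrict_def)

lemma tuples_one_permute:
  assumes "\<pi> permutes {1..d}"
  shows "\<one>\<^bsub>tuples A d\<^esub> \<circ> \<pi> = \<one>\<^bsub>tuples A d\<^esub>"
  using permutes_in_image[OF assms] by (auto simp: tuples_one fun_eq_iff restrict_def)

lemma tuples_monoid:
  assumes "Group.monoid A"
  shows "Group.monoid (tuples A d)"
proof -
  interpret A: Group.monoid A by fact
  show ?thesis
  proof (rule Group.monoid.intro)
    fix x y z assume "x \<in> carrier (tuples A d)" "y \<in> carrier (tuples A d)" "z \<in> carrier (tuples A d)"
    then show "x \<otimes>\<^bsub>tuples A d\<^esub> y \<otimes>\<^bsub>tuples A d\<^esub> z = x \<otimes>\<^bsub>tuples A d\<^esub> (y \<otimes>\<^bsub>tuples A d\<^esub> z)"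
      by (auto simp: tuples_mult tuples_nth A.m_assoc fun_eq_iff restrict_def)
  next
    fix x assume "x \<in> carrier (tuples A d)"
    then show "\<one>\<^bsub>tuples A d\<^esub> \<otimes>\<^bsub>tuples A d\<^esub> x = x" "x \<otimes>\<^bsub>tuples A d\<^esub> \<one>\<^bsub>tuples A d\<^esub> = x"
      by (auto simp: tuples_mult tuples_one tuples_carrier PiE_iff extensional_def restrict_def fun_eq_iff)
  qed (auto simp: tuples_carrier tuples_mult tuples_one PiE_iff)
qed

text \<open>
  The elements of the target are sets, and the union of a nonempty constant family is its value.
\<close>

lemma coset_UN:
  assumes "module K M" "module K P" "submodule N K M" "linear_map K M P h"
    and "\<And>n. n \<in> N \<Longrightarrow> h n = \<zero>\<^bsub>P\<^esub>" "x \<in> carrier M"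
  shows "(\<Union>y \<in> N +>\<^bsub>M\<^esub> x. h y) = h x"
proof -
  have "(\<Union>y \<in> N +>\<^bsub>M\<^esub> x. h y) = (\<Union>y \<in> N +>\<^bsub>M\<^esub> x. h x)"
    using linear_map_const_on_coset[OF assms] by (intro SUP_cong[OF HOL.refl])
  also have "\<dots> = h x"
    using coset_self[OF assms(1,3,6)] by (intro UN_constant[THEN HOL.trans]) auto
  finally show ?thesis .
qed

context
  fixes K :: "('k, 'r) ring_scheme" and A :: "('k, 'a, 's) module_scheme" and d :: nat
  assumes K: "cring K" and A: "assoc_algebra K A"
begin

interpretation K: cring K by (rule K)
interpretation A: ring A by (rule assoc_algebra_ring[OF A])
interpretation AM: module K A by (rule assoc_algebra_module[OF A])

private abbreviation (input) "TK \<equiv> monoid_algebra K (tuples A d)"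

lemma tuples_algebra: "assoc_algebra K TK"
  and tuples_spans: "spans K TK (basis_elem K ` carrier (tuples A d))"
  and tuples_basis_mult: "a \<in> carrier (tuples A d) \<Longrightarrow> b \<in> carrier (tuples A d) \<Longrightarrow>
      basis_elem K a \<otimes>\<^bsub>TK\<^esub> basis_elem K b = basis_elem K (a \<otimes>\<^bsub>tuples A d\<^esub> b)"
  using monoid_algebra_assoc_algebra[OF K tuples_monoid[OF A.monoid_axioms]] by auto

interpretation TK: ring TK by (rule assoc_algebra_ring[OF tuples_algebra])
interpretation TKM: module K TK by (rule assoc_algebra_module[OF tuples_algebra])

lemma tuple_basis_closed: "a \<in> carrier (tuples A d) \<Longrightarrow> basis_elem K a \<in> carrier TK"
  by (simp add: monoid_algebra_carrier basis_elem_closed[OF K])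

lemma multilinear_relation_addI:
  assumes "a \<in> carrier (tuples A d)" "i \<in> {1..d}" "x \<in> carrier A" "y \<in> carrier A"
  shows "basis_elem K (a(i := x \<oplus>\<^bsub>A\<^esub> y)) \<ominus>\<^bsub>TK\<^esub> (basis_elem K (a(i := x)) \<oplus>\<^bsub>TK\<^esub> basis_elem K (a(i := y)))
    \<in> multilinear_relations K A d"
  using assms unfolding multilinear_relations_def Let_def by blast

lemma multilinear_relation_smultI:
  assumes "a \<in> carrier (tuples A d)" "i \<in> {1..d}" "r \<in> carrier K" "x \<in> carrier A"
  shows "basis_elem K (a(i := r \<odot>\<^bsub>A\<^esub> x)) \<ominus>\<^bsub>TK\<^esub> (r \<odot>\<^bsub>TK\<^esub> basis_elem K (a(i := x)))
    \<in> multilinear_relations K A d"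
  using assms unfolding multilinear_relations_def Let_def by blast

lemma multilinear_relationE:
  assumes "q \<in> multilinear_relations K A d"
  obtains (add) a i x y where "a \<in> carrier (tuples A d)" "i \<in> {1..d}" "x \<in> carrier A" "y \<in> carrier A"
      "q = basis_elem K (a(i := x \<oplus>\<^bsub>A\<^esub> y)) \<ominus>\<^bsub>TK\<^esub> (basis_elem K (a(i := x)) \<oplus>\<^bsub>TK\<^esub> basis_elem K (a(i := y)))"
    | (smult) a i r x where "a \<in> carrier (tuples A d)" "i \<in> {1..d}" "r \<in> carrier K" "x \<in> carrier A"
      "q = basis_elem K (a(i := r \<odot>\<^bsub>A\<^esub> x)) \<ominus>\<^bsub>TK\<^esub> (r \<odot>\<^bsub>TK\<^esub> basis_elem K (a(i := x)))"
  using assms unfolding multilinear_relations_def Let_def by blast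

lemma multilinear_relations_subset: "multilinear_relations K A d \<subseteq> carrier TK"
proof
  fix q assume "q \<in> multilinear_relations K A d"
  then show "q \<in> carrier TK"
    by (cases q rule: multilinear_relationE)
      (auto intro!: TK.minus_closed TK.a_closed TKM.smult_closed tuple_basis_closed tuples_upd
        simp del: atLeastAtMost_iff)
qed

private abbreviation (input) "TN \<equiv> tensor_power_kernel K A d"

lemma tensor_power_kernel_submodule: "submodule TN K TK"
  unfolding tensor_power_kernel_def
  by (rule span_submodule_submodule[OF TKM.module_axioms multilinear_relations_subset])

lemma tuples_mult_upd:
  assumes "i \<in> {1..d}"
  shows "c \<otimes>\<^bsub>tuples A d\<^esub> a(i := x) = (c \<otimes>\<^bsub>tuples A d\<^esub> a)(i := c i \<otimes>\<^bsub>A\<^esub> x)"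
    and "a(i := x) \<otimes>\<^bsub>tuples A d\<^esub> c = (a \<otimes>\<^bsub>tuples A d\<^esub> c)(i := x \<otimes>\<^bsub>A\<^esub> c i)"
  using assms by (auto simp: tuples_mult fun_eq_iff)

text \<open>
  Multiplication by a fixed element of \<open>A\<close> is linear. Hence the product of a multilinearity
  relation with a tuple is again a multilinearity relation, and the relations span a two-sided
  ideal.
\<close>

lemma tensor_power_kernel_ideal: "ideal TN TK"
  unfolding tensor_power_kernel_def
proof (rule span_submodule_ideal[OF tuples_algebra tuples_spans multilinear_relations_subset])
  interpret T: Group.monoid "tuples A d" by (rule tuples_monoid[OF A.monoid_axioms])
  note bil = assoc_algebra_mult_bilinear[OF tuples_algebra]
  note TKm = TKM.module_axioms
  fix s q assume "s \<in> basis_elem K ` carrier (tuples A d)" and q: "q \<in> multilinear_relations K A d"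
  then obtain c where c: "c \<in> carrier (tuples A d)" "s = basis_elem K c" by auto
  note R = bilinear_map_right[OF bil tuple_basis_closed[OF c(1)]]
    and L = bilinear_map_left[OF bil tuple_basis_closed[OF c(1)]]
  have e: "basis_elem K v \<in> carrier TK" if "v \<in> carrier (tuples A d)" for v
    by (rule tuple_basis_closed[OF that])
  have add_eq: "s \<otimes>\<^bsub>TK\<^esub> (basis_elem K u \<ominus>\<^bsub>TK\<^esub> (basis_elem K v \<oplus>\<^bsub>TK\<^esub> basis_elem K w))
      = basis_elem K (c \<otimes>\<^bsub>tuples A d\<^esub> u) \<ominus>\<^bsub>TK\<^esub>
        (basis_elem K (c \<otimes>\<^bsub>tuples A d\<^esub> v) \<oplus>\<^bsub>TK\<^esub> basis_elem K (c \<otimes>\<^bsub>tuples A d\<^esub> w))"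
    "(basis_elem K u \<ominus>\<^bsub>TK\<^esub> (basis_elem K v \<oplus>\<^bsub>TK\<^esub> basis_elem K w)) \<otimes>\<^bsub>TK\<^esub> s
      = basis_elem K (u \<otimes>\<^bsub>tuples A d\<^esub> c) \<ominus>\<^bsub>TK\<^esub>
        (basis_elem K (v \<otimes>\<^bsub>tuples A d\<^esub> c) \<oplus>\<^bsub>TK\<^esub> basis_elem K (w \<otimes>\<^bsub>tuples A d\<^esub> c))"
    if u: "u \<in> carrier (tuples A d)" "v \<in> carrier (tuples A d)" "w \<in> carrier (tuples A d)" for u v w
    unfolding c(2) linear_map_minus[OF TKm TKm R e[OF u(1)] TK.a_closed[OF e[OF u(2)] e[OF u(3)]]]
      linear_map_minus[OF TKm TKm L e[OF u(1)] TK.a_closed[OF e[OF u(2)] e[OF u(3)]]]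
      linear_map_add[OF R e[OF u(2)] e[OF u(3)]] linear_map_add[OF L e[OF u(2)] e[OF u(3)]]
      tuples_basis_mult[OF c(1) u(1)] tuples_basis_mult[OF c(1) u(2)] tuples_basis_mult[OF c(1) u(3)]
      tuples_basis_mult[OF u(1) c(1)] tuples_basis_mult[OF u(2) c(1)] tuples_basis_mult[OF u(3) c(1)]
    by (rule HOL.refl)+
  have smult_eq: "s \<otimes>\<^bsub>TK\<^esub> (basis_elem K u \<ominus>\<^bsub>TK\<^esub> (r \<odot>\<^bsub>TK\<^esub> basis_elem K v))
      = basis_elem K (c \<otimes>\<^bsub>tuples A d\<^esub> u) \<ominus>\<^bsub>TK\<^esub> (r \<odot>\<^bsub>TK\<^esub> basis_elem K (c \<otimes>\<^bsub>tuples A d\<^esub> v))"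
    "(basis_elem K u \<ominus>\<^bsub>TK\<^esub> (r \<odot>\<^bsub>TK\<^esub> basis_elem K v)) \<otimes>\<^bsub>TK\<^esub> s
      = basis_elem K (u \<otimes>\<^bsub>tuples A d\<^esub> c) \<ominus>\<^bsub>TK\<^esub> (r \<odot>\<^bsub>TK\<^esub> basis_elem K (v \<otimes>\<^bsub>tuples A d\<^esub> c))"
    if u: "u \<in> carrier (tuples A d)" "v \<in> carrier (tuples A d)" and r: "r \<in> carrier K" for u v r
    unfolding c(2) linear_map_minus[OF TKm TKm R e[OF u(1)] TKM.smult_closed[OF r e[OF u(2)]]]
      linear_map_minus[OF TKm TKm L e[OF u(1)] TKM.smult_closed[OF r e[OF u(2)]]]
      linear_map_smult[OF R r e[OF u(2)]] linear_map_smult[OF L r e[OF u(2)]]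
      tuples_basis_mult[OF c(1) u(1)] tuples_basis_mult[OF c(1) u(2)]
      tuples_basis_mult[OF u(1) c(1)] tuples_basis_mult[OF u(2) c(1)]
    by (rule HOL.refl)+
  have "s \<otimes>\<^bsub>TK\<^esub> q \<in> multilinear_relations K A d \<and> q \<otimes>\<^bsub>TK\<^esub> s \<in> multilinear_relations K A d"
    using q
  proof (cases q rule: multilinear_relationE)
    case (add a i x y)
    have ci: "c i \<in> carrier A" using tuples_nth[OF c(1) add(2)] .
    note up = tuples_upd[OF add(1,2)]
    note eqs = add_eq[OF up[OF A.a_closed[OF add(3,4)]] up[OF add(3)] up[OF add(4)]]
    show ?thesis
      unfolding add(5) eqs tuples_mult_upd[OF add(2)] A.l_distr[OF add(3,4) ci] A.r_distr[OF add(3,4) ci]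
      by (intro conjI multilinear_relation_addI T.m_closed add A.m_closed ci c(1))
  next
    case (smult a i r x)
    have ci: "c i \<in> carrier A" using tuples_nth[OF c(1) smult(2)] .
    note up = tuples_upd[OF smult(1,2)]
    note eqs = smult_eq[OF up[OF AM.smult_closed[OF smult(3,4)]] up[OF smult(4)] smult(3)]
    show ?thesis
      unfolding smult(5) eqs tuples_mult_upd[OF smult(2)]
        assoc_algebra.smult_mult_left[OF A smult(3,4) ci]
        assoc_algebra.smult_mult_right[OF A smult(3) ci smult(4)]
      by (intro conjI multilinear_relation_smultI T.m_closed smult A.m_closed ci c(1))
  qed
  then show "s \<otimes>\<^bsub>TK\<^esub> q \<in> span_submodule K TK (multilinear_relations K A d)"
    "q \<otimes>\<^bsub>TK\<^esub> s \<in> span_submodule K TK (multilinear_relations K A d)"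
    by (auto intro: subsetD[OF span_submodule_superset])
qed

private abbreviation (input) "B \<equiv> tensor_power K A d"
private abbreviation (input) "ptp \<equiv> pure_tensor_power K A d"

lemma tensor_power_assoc_algebra: "assoc_algebra K B"
  unfolding tensor_power_def
  by (rule quot_module_assoc_algebra[OF tuples_algebra tensor_power_kernel_submodule
        tensor_power_kernel_ideal])

interpretation B: ring B by (rule assoc_algebra_ring[OF tensor_power_assoc_algebra])
interpretation BM: module K B by (rule assoc_algebra_module[OF tensor_power_assoc_algebra])

lemma pure_tensor_power_mult:
  "a \<in> carrier (tuples A d) \<Longrightarrow> b \<in> carrier (tuples A d) \<Longrightarrow> ptp a \<otimes>\<^bsub>B\<^esub> ptp b = ptp (a \<otimes>\<^bsub>tuples A d\<^esub> b)"
  unfolding tensor_power_def pure_tensor_power_def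
  by (simp add: quot_module_mult[OF tensor_power_kernel_ideal] tuple_basis_closed tuples_basis_mult)

lemma tensor_power_one: "\<one>\<^bsub>B\<^esub> = ptp \<one>\<^bsub>tuples A d\<^esub>"
  by (simp add: tensor_power_def pure_tensor_power_def quot_module_one monoid_algebra_one)

lemma pure_tensor_power_spans: "spans K B (ptp ` carrier (tuples A d))"
proof -
  have "spans K B ((\<lambda>x. TN +>\<^bsub>TK\<^esub> x) ` (basis_elem K ` carrier (tuples A d)))"
    unfolding tensor_power_def
    by (rule linear_image_spans[OF TKM.module_axioms
          quot_module_module[OF TKM.module_axioms tensor_power_kernel_submodule] tuples_spans
          coset_linear[OF TKM.module_axioms tensor_power_kernel_submodule]])
      (simp add: quot_module_carrier)
  then show ?thesis by (simp add: image_image pure_tensor_power_def)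
qed

lemma pure_tensor_power_closed: "a \<in> carrier (tuples A d) \<Longrightarrow> ptp a \<in> carrier B"
  using pure_tensor_power_spans by (auto simp: spans_def)

lemma pure_tensor_power_multilinear: "multilinear_map K A d B ptp"
  unfolding multilinear_map_def
proof (intro ballI conjI linear_mapI pure_tensor_power_closed tuples_upd)
  note sub = tensor_power_kernel_submodule and TKm = TKM.module_axioms
  have eq: "TN +>\<^bsub>TK\<^esub> f = TN +>\<^bsub>TK\<^esub> g"
    if "f \<ominus>\<^bsub>TK\<^esub> g \<in> multilinear_relations K A d" "f \<in> carrier TK" "g \<in> carrier TK" for f g
    using coset_eq_iff[OF TKm sub that(2,3)] that(1)
      span_submodule_superset[of "multilinear_relations K A d" K TK]
    unfolding tensor_power_kernel_def by blast
  fix a i x assume a: "a \<in> carrier (tuples A d)" "i \<in> {1..d}" "x \<in> carrier A"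
  {
    fix y assume y: "y \<in> carrier A"
    have "TN +>\<^bsub>TK\<^esub> basis_elem K (a(i := x \<oplus>\<^bsub>A\<^esub> y))
        = TN +>\<^bsub>TK\<^esub> (basis_elem K (a(i := x)) \<oplus>\<^bsub>TK\<^esub> basis_elem K (a(i := y)))"
      by (intro eq multilinear_relation_addI TK.a_closed tuple_basis_closed tuples_upd A.a_closed a y)
    then show "ptp (a(i := x \<oplus>\<^bsub>A\<^esub> y)) = ptp (a(i := x)) \<oplus>\<^bsub>B\<^esub> ptp (a(i := y))"
      unfolding pure_tensor_power_def tensor_power_def
        quot_module_add[OF TKm sub tuple_basis_closed[OF tuples_upd[OF a]]
          tuple_basis_closed[OF tuples_upd[OF a(1,2) y]]] .
  }
  {
    fix r assume r: "r \<in> carrier K"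
    have "TN +>\<^bsub>TK\<^esub> basis_elem K (a(i := r \<odot>\<^bsub>A\<^esub> x))
        = TN +>\<^bsub>TK\<^esub> (r \<odot>\<^bsub>TK\<^esub> basis_elem K (a(i := x)))"
      by (intro eq multilinear_relation_smultI TKM.smult_closed tuple_basis_closed tuples_upd
          AM.smult_closed a r)
    then show "ptp (a(i := r \<odot>\<^bsub>A\<^esub> x)) = r \<odot>\<^bsub>B\<^esub> ptp (a(i := x))"
      unfolding pure_tensor_power_def tensor_power_def
        coset_smult[OF TKm sub r tuple_basis_closed[OF tuples_upd[OF a]]] .
  }
qed

text \<open>
  As for two factors: the kernel is spanned by the multilinearity relations, which a multilinear
  map sends to zero.
\<close>

lemma multilinear_zero_on_kernel:
  assumes P: "module K P" and \<psi>: "multilinear_map K A d P \<psi>"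
  shows "linear_map K TK P (lin_ext K P \<psi>)"
    and "n \<in> TN \<Longrightarrow> lin_ext K P \<psi> n = \<zero>\<^bsub>P\<^esub>"
    and "a \<in> carrier (tuples A d) \<Longrightarrow> lin_ext K P \<psi> (basis_elem K a) = \<psi> a"
proof -
  interpret P: module K P by fact
  have \<psi>X: "\<psi> \<in> carrier (tuples A d) \<rightarrow> carrier P" using \<psi> by (auto simp: multilinear_map_def)
  show lin: "linear_map K TK P (lin_ext K P \<psi>)"
    using lin_ext_linear[OF P \<psi>X] by (simp add: same_module_cong[OF same_module_monoid_algebra])
  show b: "lin_ext K P \<psi> (basis_elem K a) = \<psi> a" if "a \<in> carrier (tuples A d)" for a
    by (rule lin_ext_basis[OF P \<psi>X that])
  have minus: "x \<ominus>\<^bsub>P\<^esub> x = \<zero>\<^bsub>P\<^esub>" if "x \<in> carrier P" for x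
    using that by (simp add: a_minus_def P.r_neg)
  have lm: "linear_map K A P (\<lambda>x. \<psi> (a(i := x)))" if "a \<in> carrier (tuples A d)" "i \<in> {1..d}" for a i
    using \<psi> that by (auto simp: multilinear_map_def)
  have "lin_ext K P \<psi> q = \<zero>\<^bsub>P\<^esub>" if "q \<in> multilinear_relations K A d" for q
    using that
  proof (cases q rule: multilinear_relationE)
    case (add a i x y)
    then show ?thesis
      using linear_mapD[OF lm[OF add(1,2)]]
      by (simp add: linear_mapD[OF lin] linear_map_minus[OF TKM.module_axioms P lin] b tuples_upd
          tuple_basis_closed TK.a_closed minus del: fun_upd_apply atLeastAtMost_iff)
  next
    case (smult a i r x)
    then show ?thesis
      using linear_mapD[OF lm[OF smult(1,2)]]
      by (simp add: linear_mapD[OF lin] linear_map_minus[OF TKM.module_axioms P lin] b tuples_upd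
          tuple_basis_closed TKM.smult_closed minus del: fun_upd_apply atLeastAtMost_iff)
  qed
  then show "lin_ext K P \<psi> n = \<zero>\<^bsub>P\<^esub>" if "n \<in> TN"
    using linear_map_zero_on_span[OF TKM.module_axioms P lin multilinear_relations_subset] that
    unfolding tensor_power_kernel_def by blast
qed

text \<open>
  The universal property of the tensor power.
\<close>

lemma tensor_power_lift:
  assumes P: "module K P" and \<psi>: "multilinear_map K A d P \<psi>"
  obtains h where "linear_map K B P h" "\<And>a. a \<in> carrier (tuples A d) \<Longrightarrow> h (ptp a) = \<psi> a"
proof -
  note z = multilinear_zero_on_kernel[OF assms]
  obtain h where h: "linear_map K B P h"
    "\<And>x. x \<in> carrier TK \<Longrightarrow> h (TN +>\<^bsub>TK\<^esub> x) = lin_ext K P \<psi> x"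
    unfolding tensor_power_def
    using quot_module_lift[OF TKM.module_axioms P tensor_power_kernel_submodule z(1,2)] by blast
  show ?thesis
    by (rule that[OF h(1)]) (simp add: pure_tensor_power_def h(2) tuple_basis_closed z(3))
qed

text \<open>
  Updating a tuple at position \<open>i\<close> and then permuting it is the same as permuting it and then
  updating it at position \<open>\<pi> i\<close>.
\<close>

lemma permuted_tensor_multilinear:
  assumes "\<pi> permutes {1..d}"
  shows "multilinear_map K A d B (\<lambda>a. ptp (a \<circ> inv' \<pi>))"
  unfolding multilinear_map_def
proof (intro ballI conjI)
  have inv: "inv' \<pi> permutes {1..d}" by (rule permutes_inv[OF assms])
  fix a assume a: "a \<in> carrier (tuples A d)"
  then show "ptp (a \<circ> inv' \<pi>) \<in> carrier B"
    using inv by (intro pure_tensor_power_closed tuples_permute)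
  fix i assume i: "i \<in> {1..d}"
  then have "\<pi> i \<in> {1..d}" using permutes_in_image[OF assms] by blast
  then have "linear_map K A B (\<lambda>x. ptp ((a \<circ> inv' \<pi>)(\<pi> i := x)))"
    using pure_tensor_power_multilinear tuples_permute[OF a inv] by (simp add: multilinear_map_def)
  moreover have "(a \<circ> inv' \<pi>)(\<pi> i := x) = a(i := x) \<circ> inv' \<pi>" for x
    using permutes_inv_eq[OF assms] permutes_inverses[OF assms] by (auto simp: fun_eq_iff)
  ultimately show "linear_map K A B (\<lambda>x. ptp (a(i := x) \<circ> inv' \<pi>))" by simp
qed

text \<open>
  The union over representatives is the map induced by a linear map that vanishes on the kernel
  of the tensor power.
\<close>

lemma perm_action_linear:
  assumes "\<pi> permutes {1..d}"
  shows "linear_map K B B (perm_action K A d \<pi>)"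
    and "a \<in> carrier (tuples A d) \<Longrightarrow> perm_action K A d \<pi> (ptp a) = ptp (a \<circ> inv' \<pi>)"
proof -
  let ?h = "lin_ext K B (\<lambda>a. ptp (a \<circ> inv' \<pi>))"
  note z = multilinear_zero_on_kernel[OF BM.module_axioms permuted_tensor_multilinear[OF assms]]
  note TKm = TKM.module_axioms and sub = tensor_power_kernel_submodule
  have val: "perm_action K A d \<pi> (TN +>\<^bsub>TK\<^esub> x) = ?h x" if "x \<in> carrier TK" for x
    unfolding perm_action_def
    by (rule coset_UN[OF TKm BM.module_axioms sub z(1,2) that])
  show "perm_action K A d \<pi> (ptp a) = ptp (a \<circ> inv' \<pi>)" if "a \<in> carrier (tuples A d)"
    using that by (simp add: pure_tensor_power_def[of K A d a] val tuple_basis_closed z(3))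
  show "linear_map K B B (perm_action K A d \<pi>)"
  proof (rule linear_mapI)
    have c: "carrier B = (\<lambda>x. TN +>\<^bsub>TK\<^esub> x) ` carrier TK"
      by (simp add: tensor_power_def quot_module_carrier)
    fix U assume "U \<in> carrier B"
    then obtain x where x: "x \<in> carrier TK" "U = TN +>\<^bsub>TK\<^esub> x" unfolding c by blast
    show "perm_action K A d \<pi> U \<in> carrier B"
      using x by (simp add: val linear_mapD[OF z(1)])
    {
      fix V assume "V \<in> carrier B"
      then obtain y where y: "y \<in> carrier TK" "V = TN +>\<^bsub>TK\<^esub> y" unfolding c by blast
      have "U \<oplus>\<^bsub>B\<^esub> V = TN +>\<^bsub>TK\<^esub> (x \<oplus>\<^bsub>TK\<^esub> y)"
        unfolding tensor_power_def x(2) y(2) by (rule quot_module_add[OF TKm sub x(1) y(1)])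
      then show "perm_action K A d \<pi> (U \<oplus>\<^bsub>B\<^esub> V) = perm_action K A d \<pi> U \<oplus>\<^bsub>B\<^esub> perm_action K A d \<pi> V"
        using x y by (simp add: val linear_mapD[OF z(1)] TK.a_closed)
    }
    fix r assume r: "r \<in> carrier K"
    have "r \<odot>\<^bsub>B\<^esub> U = TN +>\<^bsub>TK\<^esub> (r \<odot>\<^bsub>TK\<^esub> x)"
      unfolding tensor_power_def x(2) by (rule coset_smult[OF TKm sub r x(1)])
    then show "perm_action K A d \<pi> (r \<odot>\<^bsub>B\<^esub> U) = r \<odot>\<^bsub>B\<^esub> perm_action K A d \<pi> U"
      using x r by (simp add: val linear_mapD[OF z(1)] TKM.smult_closed)
  qed
qed

end

section \<open>Products on tensor products\<close>

lemma lin_ext_zero: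
  assumes "module K M" "\<And>x. x \<in> X \<Longrightarrow> \<phi> x = \<zero>\<^bsub>M\<^esub>" "f \<in> carrier (free_module K X)"
  shows "lin_ext K M \<phi> f = \<zero>\<^bsub>M\<^esub>"
proof -
  interpret M: module K M by fact
  show ?thesis
    unfolding lin_ext_def using assms
    by (intro M.add.finprod_one_eqI) (auto simp: free_module_carrier subset_iff)
qed

lemma bilin_ext_param_linear:
  assumes "module K L" "module K M" "f \<in> carrier (free_module K X)" "g \<in> carrier (free_module K Y)"
    and "\<And>x y. x \<in> X \<Longrightarrow> y \<in> Y \<Longrightarrow> linear_map K L M (\<lambda>l. \<phi> l x y)"
  shows "linear_map K L M (\<lambda>l. bilin_ext K M (\<phi> l) f g)"
  unfolding bilin_ext_def
  by (intro lin_ext_param_linear[OF assms(1,2,3)] lin_ext_param_linear[OF assms(1,2,4)] assms(5))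

text \<open>
  The product of the wreath product algebra is of this form: on pairs of pairs it is given by a
  map \<open>\<Psi>\<close> that is bilinear in either pair. With \<open>g\<close> fixed, the extension of \<open>\<Psi>\<close> is in \<open>f\<close> the
  linear extension of a bilinear map, and so vanishes on the kernel of the tensor product;
  likewise in \<open>g\<close>. Thus it is constant on pairs of cosets.
\<close>

lemma tensor_bilinear_product:
  assumes M: "module K M" and N: "module K N" and P: "module K P"
    and l: "\<And>q. q \<in> carrier M \<times> carrier N \<Longrightarrow> bilinear_map K M N P (\<lambda>x y. \<Psi> q (x, y))"
    and r: "\<And>q. q \<in> carrier M \<times> carrier N \<Longrightarrow> bilinear_map K M N P (\<lambda>x y. \<Psi> (x, y) q)"
  defines "\<mu> \<equiv> \<lambda>U V. \<Union>f\<in>U. \<Union>g\<in>V. bilin_ext K P \<Psi> f g"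
  shows "bilinear_map K (tensor_module K M N) (tensor_module K M N) P \<mu>"
    and "x \<in> carrier M \<Longrightarrow> y \<in> carrier N \<Longrightarrow> x' \<in> carrier M \<Longrightarrow> y' \<in> carrier N \<Longrightarrow>
      \<mu> (pure_tensor K M N x y) (pure_tensor K M N x' y') = \<Psi> (x, y) (x', y')"
proof -
  interpret P: module K P by fact
  let ?X = "carrier M \<times> carrier N" and ?N = "tensor_kernel K M N" and ?T = "tensor_module K M N"
  let ?F = "free_module K ?X"
  have K: "cring K" using P by (simp add: module_def)
  note sub = tensor_kernel_submodule[OF M N]
  have F: "module K ?F" by (rule pairs_module[OF M N])
  interpret F: module K ?F by (rule F)
  have \<Psi>c: "\<Psi> q q' \<in> carrier P" if "q \<in> ?X" "q' \<in> ?X" for q q'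
    using that bilinear_map_closed[OF l[OF that(1)]] by auto
  have bil: "bilinear_map K ?F ?F P (bilin_ext K P \<Psi>)"
    by (rule bilin_ext_bilinear[OF P \<Psi>c])
  note bl = bilinear_map_left[OF bil] and br = bilinear_map_right[OF bil]
  have z1: "bilin_ext K P \<Psi> n g = \<zero>\<^bsub>P\<^esub>" if n: "n \<in> ?N" and g: "g \<in> carrier ?F" for n g
    unfolding bilin_ext_def
  proof (rule bilinear_zero_on_tensor_kernel[OF M N P _ n])
    show "bilinear_map K M N P (\<lambda>x y. lin_ext K P (\<Psi> (x, y)) g)"
      unfolding bilinear_map_def
      using bilinear_map_left[OF r] bilinear_map_right[OF r]
      by (intro conjI ballI lin_ext_param_linear[OF _ P g] M N) auto
  qed
  have z2: "bilin_ext K P \<Psi> f n = \<zero>\<^bsub>P\<^esub>" if n: "n \<in> ?N" and f: "f \<in> carrier ?F" for n f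
    unfolding bilin_ext_def
    by (rule lin_ext_zero[OF P _ f]) (rule bilinear_zero_on_tensor_kernel[OF M N P l n])
  have val: "\<mu> (?N +>\<^bsub>?F\<^esub> f) (?N +>\<^bsub>?F\<^esub> g) = bilin_ext K P \<Psi> f g"
    if f: "f \<in> carrier ?F" and g: "g \<in> carrier ?F" for f g
  proof -
    have "(\<Union>g'\<in>?N +>\<^bsub>?F\<^esub> g. bilin_ext K P \<Psi> f' g') = bilin_ext K P \<Psi> f' g" if "f' \<in> ?N +>\<^bsub>?F\<^esub> f" for f'
    proof -
      have f': "f' \<in> carrier ?F"
        using linear_map_const_on_coset(1)[OF F P sub bl[OF g] z1[OF _ g] f that] .
      show ?thesis by (rule coset_UN[OF F P sub br[OF f'] z2[OF _ f'] g])
    qed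
    then have "\<mu> (?N +>\<^bsub>?F\<^esub> f) (?N +>\<^bsub>?F\<^esub> g) = (\<Union>f'\<in>?N +>\<^bsub>?F\<^esub> f. bilin_ext K P \<Psi> f' g)"
      unfolding \<mu>_def by (rule SUP_cong[OF HOL.refl])
    also have "\<dots> = bilin_ext K P \<Psi> f g"
      by (rule coset_UN[OF F P sub bl[OF g] z1[OF _ g] f])
    finally show ?thesis .
  qed
  have T: "carrier ?T = (\<lambda>x. ?N +>\<^bsub>?F\<^esub> x) ` carrier ?F"
    by (simp add: tensor_module_def quot_module_carrier)
  have add: "(?N +>\<^bsub>?F\<^esub> x) \<oplus>\<^bsub>?T\<^esub> (?N +>\<^bsub>?F\<^esub> y) = ?N +>\<^bsub>?F\<^esub> (x \<oplus>\<^bsub>?F\<^esub> y)"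
    if "x \<in> carrier ?F" "y \<in> carrier ?F" for x y
    unfolding tensor_module_def by (rule quot_module_add[OF F sub that])
  have smult: "c \<odot>\<^bsub>?T\<^esub> (?N +>\<^bsub>?F\<^esub> x) = ?N +>\<^bsub>?F\<^esub> (c \<odot>\<^bsub>?F\<^esub> x)"
    if "c \<in> carrier K" "x \<in> carrier ?F" for c x
    unfolding tensor_module_def by (rule coset_smult[OF F sub that])
  show "bilinear_map K ?T ?T P \<mu>"
    unfolding bilinear_map_def T
    by (auto simp: T add smult val linear_mapD[OF bl] linear_mapD[OF br] F.a_closed F.smult_closed
        simp del: free_module_simps intro!: linear_mapI)
  show "\<mu> (pure_tensor K M N x y) (pure_tensor K M N x' y') = \<Psi> (x, y) (x', y')"
    if "x \<in> carrier M" "y \<in> carrier N" "x' \<in> carrier M" "y' \<in> carrier N"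
    unfolding pure_tensor_def
    using that \<Psi>c by (simp add: val pair_closed[OF M N]) (intro bilin_ext_basis[OF P, where X = ?X and Y = ?X]; auto)
qed

section \<open>The wreath product algebra\<close>

text \<open>
  Products and linear maps on the wreath product algebra are determined by these tensors,
  written \<open>a \<otimes> \<pi>\<close> in comments.
\<close>

definition wreath_elem ::
  "('k, 'r) ring_scheme \<Rightarrow> ('k, 'a, 's) module_scheme \<Rightarrow> nat \<Rightarrow> (nat \<Rightarrow> 'a) \<Rightarrow> (nat \<Rightarrow> nat) \<Rightarrow>
    (((nat \<Rightarrow> 'a) \<Rightarrow> 'k) set \<times> ((nat \<Rightarrow> nat) \<Rightarrow> 'k) \<Rightarrow> 'k) set"
  where "wreath_elem K A d a \<pi> = pure_tensor K (tensor_power K A d) (monoid_algebra K (sym_group d))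
    (pure_tensor_power K A d a) (basis_elem K \<pi>)"

context
  fixes K :: "('k, 'r) ring_scheme" and A :: "('k, 'a, 's) module_scheme" and d :: nat
  assumes K: "cring K" and A: "assoc_algebra K A"
begin

interpretation K: cring K by (rule K)
interpretation A: ring A by (rule assoc_algebra_ring[OF A])
interpretation T: Group.monoid "tuples A d" by (rule tuples_monoid[OF A.monoid_axioms])

private abbreviation (input) "BB \<equiv> tensor_power K A d"
private abbreviation (input) "KG \<equiv> monoid_algebra K (sym_group d)"
private abbreviation (input) "W0 \<equiv> tensor_module K BB KG"
private abbreviation (input) "W \<equiv> wreath_algebra K A d"

interpretation B: ring BB by (rule assoc_algebra_ring[OF tensor_power_assoc_algebra[OF K A]])

lemma group_algebra: "assoc_algebra K KG"
  and group_algebra_spans: "spans K KG (basis_elem K ` {\<pi>. \<pi> permutes {1..d}})"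
proof -
  have G: "Group.monoid (sym_group d)" using sym_group_is_group by (simp add: group_def)
  show "assoc_algebra K KG" "spans K KG (basis_elem K ` {\<pi>. \<pi> permutes {1..d}})"
    using monoid_algebra_assoc_algebra(1,2)[OF K G] by (simp_all add: sym_group_def)
qed

lemma tensor_power_module: "module K BB" by (rule assoc_algebra_module[OF tensor_power_assoc_algebra[OF K A]])
lemma group_algebra_module: "module K KG" by (rule assoc_algebra_module[OF group_algebra])
lemma wreath_tensor_module: "module K W0" by (rule tensor_module_module[OF tensor_power_module group_algebra_module])

lemma perm_basis_closed: "\<pi> permutes {1..d} \<Longrightarrow> basis_elem K \<pi> \<in> carrier KG"
  using group_algebra_spans by (auto simp: spans_def)

text \<open>
  The two layers of the product of the wreath product algebra: pure tensors of the tensor power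
  with permutations, and their bilinear extension to the group algebra.
\<close>

definition basis_mult where
  "basis_mult a b \<pi> \<sigma> = pure_tensor K BB KG (a \<otimes>\<^bsub>BB\<^esub> perm_action K A d \<pi> b) (basis_elem K (\<pi> \<circ> \<sigma>))"

definition pair_mult where
  "pair_mult = (\<lambda>(a, x) (b, y). bilin_ext K W0 (basis_mult a b) x y)"

lemma wreath_algebra_alt:
  "W = W0\<lparr>monoid.mult := (\<lambda>U V. \<Union>f\<in>U. \<Union>g\<in>V. bilin_ext K W0 pair_mult f g),
     one := pure_tensor K BB KG \<one>\<^bsub>BB\<^esub> \<one>\<^bsub>KG\<^esub>\<rparr>"
  by (simp add: wreath_algebra_def Let_def pair_mult_def basis_mult_def[abs_def] sym_group_mult)

lemma same_module_wreath: "same_module W W0"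
  by (simp add: same_module_def wreath_algebra_alt)

lemma wreath_carrier: "carrier W = carrier W0"
  by (simp add: wreath_algebra_alt)

lemma basis_mult_bilinear:
  assumes \<pi>: "\<pi> permutes {1..d}" and \<sigma>: "\<sigma> permutes {1..d}"
  shows "bilinear_map K BB BB W0 (\<lambda>a b. basis_mult a b \<pi> \<sigma>)"
proof -
  have p: "basis_elem K (\<pi> \<circ> \<sigma>) \<in> carrier KG"
    by (rule perm_basis_closed[OF permutes_compose[OF \<sigma> \<pi>]])
  note t = bilinear_map_left[OF pure_tensor_bilinear[OF tensor_power_module group_algebra_module] p]
  note m = assoc_algebra_mult_bilinear[OF tensor_power_assoc_algebra[OF K A]]
  note act = perm_action_linear(1)[OF K A \<pi>]
  show ?thesis
    unfolding bilinear_map_def basis_mult_def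
    by (intro conjI ballI linear_map_comp[OF _ t] linear_map_comp[OF act] bilinear_map_left[OF m]
        bilinear_map_right[OF m] linear_map_closed[OF act])
qed

text \<open>
  In the group algebra argument the map is a linear extension, in the other one it depends
  linearly on the prescribed values.
\<close>

lemma pair_mult_bilinear:
  assumes q: "q \<in> carrier BB \<times> carrier KG"
  shows "bilinear_map K BB KG W0 (\<lambda>x y. pair_mult q (x, y))"
    and "bilinear_map K BB KG W0 (\<lambda>x y. pair_mult (x, y) q)"
proof -
  obtain b y where bq: "q = (b, y)" "b \<in> carrier BB" "y \<in> carrier KG" using q by auto
  let ?G = "{\<pi>. \<pi> permutes {1..d}}"
  have G: "carrier (sym_group d) = ?G" by (simp add: sym_group_def)
  note same = same_module_cong[OF same_module_monoid_algebra[of K "sym_group d"]]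
  have y: "y \<in> carrier (free_module K ?G)" using bq(3) by (simp add: monoid_algebra_carrier G)
  have inner: "bilinear_map K KG KG W0 (bilin_ext K W0 (basis_mult a b'))"
    if "a \<in> carrier BB" "b' \<in> carrier BB" for a b'
  proof -
    have "bilinear_map K (free_module K ?G) (free_module K ?G) W0 (bilin_ext K W0 (basis_mult a b'))"
      using bilinear_map_closed[OF basis_mult_bilinear that] by (intro bilin_ext_bilinear[OF wreath_tensor_module]) simp
    then show ?thesis unfolding bilinear_map_def same G monoid_algebra_carrier .
  qed
  have outer1: "linear_map K BB W0 (\<lambda>a. bilin_ext K W0 (basis_mult a b') x z)"
    if "b' \<in> carrier BB" "x \<in> carrier KG" "z \<in> carrier KG" for b' x z
    using that
    by (intro bilin_ext_param_linear[OF tensor_power_module wreath_tensor_module, where X = ?G and Y = ?G]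
        bilinear_map_left[OF basis_mult_bilinear]) (simp_all add: monoid_algebra_carrier G)
  have outer2: "linear_map K BB W0 (\<lambda>b. bilin_ext K W0 (basis_mult a b) x z)"
    if "a \<in> carrier BB" "x \<in> carrier KG" "z \<in> carrier KG" for a x z
    using that
    by (intro bilin_ext_param_linear[OF tensor_power_module wreath_tensor_module, where X = ?G and Y = ?G]
        bilinear_map_right[OF basis_mult_bilinear]) (simp_all add: monoid_algebra_carrier G)
  show "bilinear_map K BB KG W0 (\<lambda>x y. pair_mult q (x, y))"
    unfolding bq(1) pair_mult_def bilinear_map_def prod.case
    by (intro conjI ballI bilinear_map_right[OF inner] outer2 bq)
  show "bilinear_map K BB KG W0 (\<lambda>x y. pair_mult (x, y) q)"
    unfolding bq(1) pair_mult_def bilinear_map_def prod.case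
    by (intro conjI ballI bilinear_map_left[OF inner] outer1 bq)
qed

lemma wreath_mult_bilinear: "bilinear_map K W W W (\<lambda>x y. x \<otimes>\<^bsub>W\<^esub> y)"
  and wreath_mult_pure: "a \<in> carrier BB \<Longrightarrow> x \<in> carrier KG \<Longrightarrow> b \<in> carrier BB \<Longrightarrow> y \<in> carrier KG \<Longrightarrow>
    pure_tensor K BB KG a x \<otimes>\<^bsub>W\<^esub> pure_tensor K BB KG b y = pair_mult (a, x) (b, y)"
proof -
  have mult: "(\<otimes>\<^bsub>W\<^esub>) = (\<lambda>U V. \<Union>f\<in>U. \<Union>g\<in>V. bilin_ext K W0 pair_mult f g)"
    by (simp add: wreath_algebra_alt)
  note prod = tensor_bilinear_product[OF tensor_power_module group_algebra_module wreath_tensor_module pair_mult_bilinear]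
  show "bilinear_map K W W W (\<lambda>x y. x \<otimes>\<^bsub>W\<^esub> y)"
    using prod(1) unfolding mult
    by (simp add: bilinear_map_def same_module_cong[OF same_module_wreath] wreath_carrier)
  show "a \<in> carrier BB \<Longrightarrow> x \<in> carrier KG \<Longrightarrow> b \<in> carrier BB \<Longrightarrow> y \<in> carrier KG \<Longrightarrow>
    pure_tensor K BB KG a x \<otimes>\<^bsub>W\<^esub> pure_tensor K BB KG b y = pair_mult (a, x) (b, y)"
    unfolding mult by (rule prod(2))
qed

private abbreviation (input) "we \<equiv> wreath_elem K A d"

text \<open>
  On pure tensors and group elements all bilinear extensions in the definition reduce to the
  prescribed values.
\<close>

lemma wreath_elem_mult:
  assumes "a \<in> carrier (tuples A d)" "b \<in> carrier (tuples A d)" "\<pi> permutes {1..d}" "\<sigma> permutes {1..d}"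
  shows "we a \<pi> \<otimes>\<^bsub>W\<^esub> we b \<sigma> = we (a \<otimes>\<^bsub>tuples A d\<^esub> (b \<circ> inv' \<pi>)) (\<pi> \<circ> \<sigma>)"
proof -
  note pc = pure_tensor_power_closed[OF K A]
  have "we a \<pi> \<otimes>\<^bsub>W\<^esub> we b \<sigma>
      = bilin_ext K W0 (basis_mult (pure_tensor_power K A d a) (pure_tensor_power K A d b))
          (basis_elem K \<pi>) (basis_elem K \<sigma>)"
    unfolding wreath_elem_def
    using assms by (simp add: wreath_mult_pure pc perm_basis_closed pair_mult_def)
  also have "\<dots> = basis_mult (pure_tensor_power K A d a) (pure_tensor_power K A d b) \<pi> \<sigma>"
    using assms bilinear_map_closed[OF basis_mult_bilinear pc pc]
    by (intro bilin_ext_basis[OF wreath_tensor_module, where X = "{\<pi>. \<pi> permutes {1..d}}" and Y = "{\<pi>. \<pi> permutes {1..d}}"])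
      auto
  also have "\<dots> = we (a \<otimes>\<^bsub>tuples A d\<^esub> (b \<circ> inv' \<pi>)) (\<pi> \<circ> \<sigma>)"
    using assms permutes_inv[OF assms(3)]
    by (simp add: basis_mult_def wreath_elem_def perm_action_linear(2)[OF K A]
        pure_tensor_power_mult[OF K A] tuples_permute)
  finally show ?thesis .
qed

lemma wreath_one: "\<one>\<^bsub>W\<^esub> = we \<one>\<^bsub>tuples A d\<^esub> id"
  by (simp add: wreath_algebra_alt wreath_elem_def tensor_power_one[OF K A] monoid_algebra_one
      sym_group_one)

lemma wreath_elem_spans:
  "spans K W {we a \<pi> | a \<pi>. a \<in> carrier (tuples A d) \<and> \<pi> permutes {1..d}}"
proof -
  have "spans K W0 {pure_tensor K BB KG s t | s t. s \<in> pure_tensor_power K A d ` carrier (tuples A d) \<and>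
      t \<in> basis_elem K ` {\<pi>. \<pi> permutes {1..d}}}"
    by (rule tensor_spans[OF tensor_power_module group_algebra_module pure_tensor_power_spans[OF K A] group_algebra_spans])
  moreover have "{pure_tensor K BB KG s t | s t. s \<in> pure_tensor_power K A d ` carrier (tuples A d) \<and>
      t \<in> basis_elem K ` {\<pi>. \<pi> permutes {1..d}}}
    = {we a \<pi> | a \<pi>. a \<in> carrier (tuples A d) \<and> \<pi> permutes {1..d}}"
    unfolding wreath_elem_def by blast
  ultimately show ?thesis
    by (simp add: same_module_cong[OF same_module_wreath])
qed

lemma wreath_elem_closed:
  "a \<in> carrier (tuples A d) \<Longrightarrow> \<pi> permutes {1..d} \<Longrightarrow> we a \<pi> \<in> carrier W"
  using wreath_elem_spans by (auto simp: spans_def)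

lemma wreath_module: "module K W"
  using wreath_tensor_module by (simp add: same_module_cong[OF same_module_wreath])

text \<open>
  On the spanning elements the associative law reduces to the one for tuples and permutations,
  because permuting positions respects products of tuples and inverting a composite reverses its
  order.
\<close>

lemma wreath_assoc_algebra: "assoc_algebra K W"
proof (rule assoc_algebraI_spans[OF wreath_module wreath_elem_spans _ wreath_mult_bilinear])
  show "\<one>\<^bsub>W\<^esub> \<in> carrier W"
    by (simp add: wreath_one wreath_elem_closed permutes_id)
next
  fix x y z
  assume "x \<in> {we a \<pi> | a \<pi>. a \<in> carrier (tuples A d) \<and> \<pi> permutes {1..d}}"
    "y \<in> {we a \<pi> | a \<pi>. a \<in> carrier (tuples A d) \<and> \<pi> permutes {1..d}}"
    "z \<in> {we a \<pi> | a \<pi>. a \<in> carrier (tuples A d) \<and> \<pi> permutes {1..d}}"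
  then obtain a \<pi> b \<sigma> c \<tau> where x: "x = we a \<pi>" "a \<in> carrier (tuples A d)" "\<pi> permutes {1..d}"
    and y: "y = we b \<sigma>" "b \<in> carrier (tuples A d)" "\<sigma> permutes {1..d}"
    and z: "z = we c \<tau>" "c \<in> carrier (tuples A d)" "\<tau> permutes {1..d}"
    by blast
  note [simp] = wreath_elem_mult tuples_permute permutes_inv permutes_compose tuples_mult_permute
  have "inv' (\<pi> \<circ> \<sigma>) = inv' \<sigma> \<circ> inv' \<pi>"
    using x y by (simp add: o_inv_distrib permutes_bij)
  then show "x \<otimes>\<^bsub>W\<^esub> y \<otimes>\<^bsub>W\<^esub> z = x \<otimes>\<^bsub>W\<^esub> (y \<otimes>\<^bsub>W\<^esub> z)"
    using x y z by (simp add: T.m_assoc o_assoc)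
next
  fix x
  assume "x \<in> {we a \<pi> | a \<pi>. a \<in> carrier (tuples A d) \<and> \<pi> permutes {1..d}}"
  then obtain a \<pi> where x: "x = we a \<pi>" "a \<in> carrier (tuples A d)" "\<pi> permutes {1..d}" by blast
  then show "\<one>\<^bsub>W\<^esub> \<otimes>\<^bsub>W\<^esub> x = x" "x \<otimes>\<^bsub>W\<^esub> \<one>\<^bsub>W\<^esub> = x"
    by (simp_all add: wreath_one wreath_elem_mult permutes_id tuples_one_permute permutes_inv)
qed

lemma wreath_elem_multilinear:
  assumes "\<pi> permutes {1..d}"
  shows "multilinear_map K A d W (\<lambda>a. we a \<pi>)"
proof -
  have "linear_map K BB W (\<lambda>b. pure_tensor K BB KG b (basis_elem K \<pi>))"
    using bilinear_map_left[OF pure_tensor_bilinear[OF tensor_power_module group_algebra_module] perm_basis_closed[OF assms]]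
    by (simp add: same_module_cong[OF same_module_wreath])
  then show ?thesis
    unfolding wreath_elem_def by (rule multilinear_map_comp[OF pure_tensor_power_multilinear[OF K A]])
qed

text \<open>
  Three universal properties in a row: the tensor power for each permutation separately, the
  group algebra, and the tensor product of the two.
\<close>

lemma wreath_lift:
  assumes P: "module K P" and \<psi>: "\<And>\<pi>. \<pi> permutes {1..d} \<Longrightarrow> multilinear_map K A d P (\<lambda>a. \<psi> a \<pi>)"
  obtains h where "linear_map K W P h"
    "\<And>a \<pi>. a \<in> carrier (tuples A d) \<Longrightarrow> \<pi> permutes {1..d} \<Longrightarrow> h (we a \<pi>) = \<psi> a \<pi>"
proof -
  let ?G = "{\<pi>. \<pi> permutes {1..d}}"
  have G: "carrier (sym_group d) = ?G" by (simp add: sym_group_def)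
  note same = same_module_cong[OF same_module_monoid_algebra[of K "sym_group d"]]
  have "\<exists>h. linear_map K BB P h \<and> (\<forall>a \<in> carrier (tuples A d). h (pure_tensor_power K A d a) = \<psi> a \<pi>)"
    if "\<pi> \<in> ?G" for \<pi>
  proof -
    have "multilinear_map K A d P (\<lambda>a. \<psi> a \<pi>)" using that by (intro \<psi>) simp
    from tensor_power_lift[OF K A P this] show ?thesis by metis
  qed
  then obtain h where h: "\<And>\<pi>. \<pi> \<in> ?G \<Longrightarrow> linear_map K BB P (h \<pi>)"
    "\<And>\<pi> a. \<pi> \<in> ?G \<Longrightarrow> a \<in> carrier (tuples A d) \<Longrightarrow> h \<pi> (pure_tensor_power K A d a) = \<psi> a \<pi>"
    by metis
  have "bilinear_map K BB KG P (\<lambda>b x. lin_ext K P (\<lambda>\<pi>. h \<pi> b) x)"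
    unfolding bilinear_map_def
  proof (intro conjI ballI)
    fix b assume "b \<in> carrier BB"
    then show "linear_map K KG P (lin_ext K P (\<lambda>\<pi>. h \<pi> b))"
      using linear_map_closed[OF h(1)] by (auto simp: same G intro!: lin_ext_linear[OF P])
  next
    fix x assume "x \<in> carrier KG"
    then show "linear_map K BB P (\<lambda>b. lin_ext K P (\<lambda>\<pi>. h \<pi> b) x)"
      using h(1) by (intro lin_ext_param_linear[OF tensor_power_module P, where X = ?G]) (simp_all add: monoid_algebra_carrier G)
  qed
  then obtain g where g: "linear_map K W0 P g"
    "\<And>b x. b \<in> carrier BB \<Longrightarrow> x \<in> carrier KG \<Longrightarrow> g (pure_tensor K BB KG b x) = lin_ext K P (\<lambda>\<pi>. h \<pi> b) x"
    using tensor_lift[OF tensor_power_module group_algebra_module P] by blast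
  show ?thesis
  proof (rule that)
    show "linear_map K W P g" using g(1) by (simp add: same_module_cong[OF same_module_wreath])
    fix a \<pi> assume a: "a \<in> carrier (tuples A d)" and \<pi>: "\<pi> permutes {1..d}"
    note pc = pure_tensor_power_closed[OF K A a]
    have "g (we a \<pi>) = lin_ext K P (\<lambda>\<pi>. h \<pi> (pure_tensor_power K A d a)) (basis_elem K \<pi>)"
      unfolding wreath_elem_def by (rule g(2)[OF pc perm_basis_closed[OF \<pi>]])
    also have "\<dots> = h \<pi> (pure_tensor_power K A d a)"
      using linear_map_closed[OF h(1) pc] \<pi> by (intro lin_ext_basis[OF P, where X = ?G]) auto
    finally show "g (we a \<pi>) = \<psi> a \<pi>" using h(2) a \<pi> by simp
  qed
qed

end

section \<open>The Coxeter presentation of the symmetric group\<close>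

definition adj :: "nat \<Rightarrow> nat \<Rightarrow> nat"
  where "adj i = transpose i (Suc i)"

definition word_prod :: "('m, 's) monoid_scheme \<Rightarrow> (nat \<Rightarrow> 'm) \<Rightarrow> nat list \<Rightarrow> 'm"
  where "word_prod M S w = foldr (\<lambda>i x. S i \<otimes>\<^bsub>M\<^esub> x) w \<one>\<^bsub>M\<^esub>"

definition word_perm :: "nat list \<Rightarrow> nat \<Rightarrow> nat"
  where "word_perm w = foldr (\<lambda>i p. adj i \<circ> p) w id"

text \<open>
  The letters \<open>k, \<dots>, n\<close>, where \<open>k = \<pi> (n + 1)\<close>, form a cycle that moves \<open>n + 1\<close> to \<open>k\<close>.
  Cancelling this cycle on the left of \<open>\<pi>\<close> leaves a permutation that fixes \<open>n + 1\<close>. A word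
  stands for the composite of its letters, so its last letter acts first.
\<close>

fun normal_word :: "nat \<Rightarrow> (nat \<Rightarrow> nat) \<Rightarrow> nat list"
  where
    "normal_word 0 \<pi> = []"
  | "normal_word (Suc n) \<pi> = [\<pi> (Suc n)..<Suc n] @
      normal_word n (word_perm (rev [\<pi> (Suc n)..<Suc n]) \<circ> \<pi>)"

declare normal_word.simps(2) [simp del]

lemma word_prod_simps [simp]:
  "word_prod M S [] = \<one>\<^bsub>M\<^esub>" "word_prod M S (i # w) = S i \<otimes>\<^bsub>M\<^esub> word_prod M S w"
  by (simp_all add: word_prod_def)

lemma word_perm_simps [simp]:
  "word_perm [] = id" "word_perm (i # w) = adj i \<circ> word_perm w"
  by (simp_all add: word_perm_def)

lemma word_perm_append: "word_perm (u @ v) = word_perm u \<circ> word_perm v"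
  by (induction u) (simp_all add: o_assoc)

lemma word_prod_sym_group: "word_prod (sym_group d) adj w = word_perm w"
  by (induction w) (simp_all add: sym_group_def)

lemma adj_involutive: "adj i \<circ> adj i = id"
  by (simp add: adj_def)

lemma adj_permutes: "1 \<le> i \<Longrightarrow> i < n \<Longrightarrow> adj i permutes {1..n}"
  unfolding adj_def by (intro permutes_swap_id) auto

lemma word_perm_rev: "word_perm (rev w) \<circ> word_perm w = id" "word_perm w \<circ> word_perm (rev w) = id"
proof -
  show "word_perm (rev w) \<circ> word_perm w = id" for w
  proof (induction w)
    case (Cons i w)
    have "word_perm (rev (i # w)) \<circ> word_perm (i # w)
        = word_perm (rev w) \<circ> (adj i \<circ> adj i) \<circ> word_perm w"
      by (simp add: word_perm_append o_assoc)
    also have "\<dots> = word_perm (rev w) \<circ> word_perm w" by (simp only: adj_involutive o_id)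
    also have "\<dots> = id" by (rule Cons)
    finally show ?case .
  qed simp
  from this[of "rev w"] show "word_perm w \<circ> word_perm (rev w) = id" by simp
qed

lemma word_perm_permutes: "set w \<subseteq> {1..<n} \<Longrightarrow> word_perm w permutes {1..n}"
proof (induction w)
  case (Cons i w)
  then have "adj i permutes {1..n}" "word_perm w permutes {1..n}"
    by (simp_all add: adj_permutes del: One_nat_def)
  then show ?case unfolding word_perm_simps by (intro permutes_compose)
qed (simp add: permutes_id)

text \<open>
  The letters act from the last to the first and move \<open>m\<close> down one step at a time until it
  reaches \<open>k\<close>.
\<close>

lemma word_perm_upt: "k \<le> m \<Longrightarrow> word_perm [k..<m] m = k"
proof (induction "m - k" arbitrary: k)
  case (Suc n)
  then have "[k..<m] = k # [Suc k..<m]" by (simp add: upt_conv_Cons)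
  moreover have "word_perm [Suc k..<m] m = Suc k" using Suc by (intro Suc(1)) auto
  ultimately show ?case by (simp add: adj_def)
qed simp

lemma permutes_shrink:
  assumes "p permutes {1..Suc n}" "p (Suc n) = Suc n"
  shows "p permutes {1..n}"
proof (rule permutes_superset[OF assms(1)])
  fix x assume "x \<in> {1..Suc n} - {1..n}"
  then have "x = Suc n" by auto
  then show "p x = x" using assms(2) by simp
qed

lemma normal_word_tail_permutes:
  assumes "\<pi> permutes {1..Suc n}"
  shows "\<pi> (Suc n) \<in> {1..Suc n}"
    and "word_perm (rev [\<pi> (Suc n)..<Suc n]) \<circ> \<pi> permutes {1..n}"
proof -
  show k: "\<pi> (Suc n) \<in> {1..Suc n}" using permutes_in_image[OF assms, of "Suc n"] by simp
  let ?c = "[\<pi> (Suc n)..<Suc n]"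
  have c: "set (rev ?c) \<subseteq> {1..<Suc n}" using k by auto
  have "word_perm ?c (Suc n) = \<pi> (Suc n)" using k by (intro word_perm_upt) auto
  then have fix_last: "(word_perm (rev ?c) \<circ> \<pi>) (Suc n) = Suc n"
    using word_perm_rev(1)[of ?c] by (metis comp_apply id_apply)
  show "word_perm (rev ?c) \<circ> \<pi> permutes {1..n}"
    by (rule permutes_shrink[OF permutes_compose[OF assms word_perm_permutes[OF c]] fix_last])
qed

lemma normal_word_correct:
  assumes "\<pi> permutes {1..n}"
  shows "set (normal_word n \<pi>) \<subseteq> {1..<n}" "word_perm (normal_word n \<pi>) = \<pi>"
proof -
  have "set (normal_word n \<pi>) \<subseteq> {1..<n} \<and> word_perm (normal_word n \<pi>) = \<pi>"
    using assms
  proof (induction n arbitrary: \<pi>)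
    case (Suc n)
    note t = normal_word_tail_permutes[OF Suc.prems]
    note IH = Suc.IH[OF t(2)]
    have "word_perm (normal_word (Suc n) \<pi>)
        = (word_perm [\<pi> (Suc n)..<Suc n] \<circ> word_perm (rev [\<pi> (Suc n)..<Suc n])) \<circ> \<pi>"
      using IH by (simp only: normal_word.simps word_perm_append o_assoc)
    also have "\<dots> = \<pi>" by (simp only: word_perm_rev id_o)
    finally have "word_perm (normal_word (Suc n) \<pi>) = \<pi>" .
    moreover have "set [\<pi> (Suc n)..<Suc n] \<subseteq> {1..<Suc n}" using t(1) by auto
    moreover have "set (normal_word n (word_perm (rev [\<pi> (Suc n)..<Suc n]) \<circ> \<pi>)) \<subseteq> {1..<Suc n}"
      using IH by fastforce
    ultimately show ?case
      by (simp only: normal_word.simps(2) set_append Un_subset_iff simp_thms)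
  qed simp
  then show "set (normal_word n \<pi>) \<subseteq> {1..<n}" "word_perm (normal_word n \<pi>) = \<pi>" by auto
qed

lemma normal_word_id: "normal_word n id = []"
proof (induction n)
  case (Suc n)
  have "normal_word (Suc n) id
      = [id (Suc n)..<Suc n] @ normal_word n (word_perm (rev [id (Suc n)..<Suc n]) \<circ> id)"
    by (rule normal_word.simps(2))
  also have "\<dots> = normal_word n id"
    by (simp only: id_apply upt_conv_Nil order_refl rev.simps word_perm_simps id_o append_Nil)
  finally show ?case using Suc by (simp only:)
qed simp

lemma (in Group.monoid) commute_mult:
  assumes "x \<otimes> a = a \<otimes> x" "x \<otimes> b = b \<otimes> x" "x \<in> carrier G" "a \<in> carrier G" "b \<in> carrier G"
  shows "x \<otimes> (a \<otimes> b) = (a \<otimes> b) \<otimes> x"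
  using assms by (metis m_assoc)

locale coxeter_system = Group.monoid M for M :: "('m, 's) monoid_scheme" (structure) +
  fixes d :: nat and S :: "nat \<Rightarrow> 'm"
  assumes S_closed: "1 \<le> i \<Longrightarrow> i < d \<Longrightarrow> S i \<in> carrier M"
    and S_square: "1 \<le> i \<Longrightarrow> i < d \<Longrightarrow> S i \<otimes> S i = \<one>"
    and S_braid: "1 \<le> i \<Longrightarrow> Suc i < d \<Longrightarrow> S i \<otimes> (S (Suc i) \<otimes> S i) = S (Suc i) \<otimes> (S i \<otimes> S (Suc i))"
    and S_far: "1 \<le> i \<Longrightarrow> Suc i < j \<Longrightarrow> j < d \<Longrightarrow> S i \<otimes> S j = S j \<otimes> S i"
begin

abbreviation "wp \<equiv> word_prod M S"

lemma wp_closed [simp]: "set w \<subseteq> {1..<d} \<Longrightarrow> wp w \<in> carrier M"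
  by (induction w) (auto intro!: S_closed)

lemma wp_append: "set u \<subseteq> {1..<d} \<Longrightarrow> set v \<subseteq> {1..<d} \<Longrightarrow> wp (u @ v) = wp u \<otimes> wp v"
  by (induction u) (auto simp: m_assoc S_closed)

lemma S_commute_word:
  assumes "1 \<le> i" "i < d" "set w \<subseteq> {1..<d}" "\<And>j. j \<in> set w \<Longrightarrow> Suc i < j \<or> Suc j < i"
  shows "S i \<otimes> wp w = wp w \<otimes> S i"
  using assms(3,4)
proof (induction w)
  case (Cons j w)
  then have j: "1 \<le> j" "j < d" "S j \<in> carrier M" by (auto intro: S_closed)
  have i: "S i \<in> carrier M" using assms by (intro S_closed)
  have w: "wp w \<in> carrier M" using Cons.prems by simp
  have "S i \<otimes> S j = S j \<otimes> S i"
    using Cons.prems(2)[of j] S_far[of i j] S_far[of j i] assms j by auto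
  then have "S i \<otimes> wp (j # w) = S j \<otimes> (S i \<otimes> wp w)"
    using i j w by (simp flip: m_assoc)
  also have "\<dots> = S j \<otimes> (wp w \<otimes> S i)" using Cons by simp
  also have "\<dots> = wp (j # w) \<otimes> S i" using i j w by (simp add: m_assoc)
  finally show ?case .
qed (use assms in \<open>simp add: S_closed\<close>)

text \<open>
  Write the word as \<open>u @ [i - 1, i] @ v\<close>. The letter \<open>i\<close> commutes with \<open>u\<close>, becomes the letter
  \<open>i - 1\<close> by the braid relation when it passes the two letters in the middle, and then commutes
  with \<open>v\<close>.
\<close>

lemma S_slide:
  assumes "1 \<le> k" "k < i" "i < m" "m \<le> d"
  shows "S i \<otimes> wp [k..<m] = wp [k..<m] \<otimes> S (i - 1)"
proof -
  obtain j where j: "i = Suc j" using assms by (cases i) auto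
  have split: "[k..<m] = [k..<j] @ j # i # [Suc i..<m]"
  proof -
    have "[k..<m] = [k..<j] @ [j..<m]" using assms j upt_add_eq_append[of k j "m - j"] by simp
    moreover have "[j..<m] = j # i # [Suc i..<m]" using assms j by (simp add: upt_conv_Cons)
    ultimately show ?thesis by simp
  qed
  let ?u = "[k..<j]" and ?v = "[Suc i..<m]"
  have u: "set ?u \<subseteq> {1..<d}" "wp ?u \<in> carrier M" and v: "set ?v \<subseteq> {1..<d}" "wp ?v \<in> carrier M"
    using assms j by auto
  have ij: "S i \<in> carrier M" "S j \<in> carrier M" using assms j by (auto intro!: S_closed)
  have w: "wp [k..<m] = wp ?u \<otimes> (S j \<otimes> (S i \<otimes> wp ?v))"
    unfolding split using u v ij assms j by (subst wp_append) auto
  have "S i \<otimes> wp [k..<m] = (S i \<otimes> wp ?u) \<otimes> (S j \<otimes> (S i \<otimes> wp ?v))"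
    unfolding w using u v ij by (simp add: m_assoc)
  also have "S i \<otimes> wp ?u = wp ?u \<otimes> S i"
    using assms j u by (intro S_commute_word) auto
  also have "wp ?u \<otimes> S i \<otimes> (S j \<otimes> (S i \<otimes> wp ?v)) = wp ?u \<otimes> ((S i \<otimes> (S j \<otimes> S i)) \<otimes> wp ?v)"
    using u v ij by (simp add: m_assoc)
  also have "S i \<otimes> (S j \<otimes> S i) = S j \<otimes> (S i \<otimes> S j)"
    using S_braid[of j] assms j by simp
  also have "wp ?u \<otimes> (S j \<otimes> (S i \<otimes> S j) \<otimes> wp ?v) = wp ?u \<otimes> (S j \<otimes> (S i \<otimes> (S j \<otimes> wp ?v)))"
    using u v ij by (simp add: m_assoc)
  also have "S j \<otimes> wp ?v = wp ?v \<otimes> S j"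
    using assms j v by (intro S_commute_word) auto
  also have "wp ?u \<otimes> (S j \<otimes> (S i \<otimes> (wp ?v \<otimes> S j))) = wp [k..<m] \<otimes> S j"
    unfolding w using u v ij by (simp add: m_assoc)
  finally show ?thesis using j by simp
qed

end

text \<open>
  Since the symmetric group is itself a Coxeter system, facts about words also yield the
  corresponding identities between permutations.
\<close>

lemma sym_group_coxeter_system: "coxeter_system (sym_group d) d adj"
proof -
  interpret G: group "sym_group d" by (rule sym_group_is_group)
  show ?thesis
  proof
    fix i assume "1 \<le> i" "i < d"
    then show "adj i \<in> carrier (sym_group d)" using adj_permutes[of i d] by (simp add: sym_group_def)
  qed (auto simp: sym_group_def adj_involutive, auto simp: adj_def fun_eq_iff transpose_def)
qed

context coxeter_system
begin

text \<open>
  By induction on \<open>n\<close>: the letter is either absorbed by the cycle in front or passes it,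
  possibly shifted by one, and then acts on a normal word for fewer points. This is what makes
  the symmetric group presented by the Coxeter relations: a word in the generators is determined
  by its permutation.
\<close>

lemma S_normal_word:
  assumes "n \<le> d" "\<pi> permutes {1..n}" "1 \<le> i" "i < n"
  shows "S i \<otimes> wp (normal_word n \<pi>) = wp (normal_word n (adj i \<circ> \<pi>))"
  using assms
proof (induction n arbitrary: \<pi> i)
  case (Suc n)
  (* the same commutation rules, read in the symmetric group, identify the remaining permutation *)
  interpret P: coxeter_system "sym_group (Suc n)" "Suc n" adj by (rule sym_group_coxeter_system)
  define k where "k = \<pi> (Suc n)"
  define \<pi>' where "\<pi>' = word_perm (rev [k..<Suc n]) \<circ> \<pi>"
  have k: "1 \<le> k" "k \<le> Suc n" and \<pi>': "\<pi>' permutes {1..n}"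
    using normal_word_tail_permutes[OF Suc.prems(2)] by (auto simp: k_def \<pi>'_def)
  have nw: "normal_word (Suc n) \<pi> = [k..<Suc n] @ normal_word n \<pi>'"
    by (simp only: normal_word.simps k_def \<pi>'_def)
  have inw: "set (normal_word n \<rho>) \<subseteq> {1..<d}" if "\<rho> permutes {1..n}" for \<rho>
    using normal_word_correct(1)[OF that] Suc.prems(1) by fastforce
  have ik: "S i \<in> carrier M" and kd: "set [k..<Suc n] \<subseteq> {1..<d}"
    using Suc.prems k by (auto intro: S_closed)
  have split: "wp ([l..<Suc n] @ normal_word n \<rho>) = wp [l..<Suc n] \<otimes> wp (normal_word n \<rho>)"
    if "1 \<le> l" "\<rho> permutes {1..n}" for l \<rho>
    using inw[OF that(2)] that(1) Suc.prems(1) by (intro wp_append) auto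
  have inv_eq: "word_perm (rev w) \<circ> (adj i \<circ> \<pi>) = adj j \<circ> (word_perm (rev w) \<circ> \<pi>)"
    if "adj i \<circ> word_perm w = word_perm w \<circ> adj j" for w j
  proof -
    have "word_perm (rev w) \<circ> (adj i \<circ> \<pi>)
        = word_perm (rev w) \<circ> (adj i \<circ> (word_perm w \<circ> word_perm (rev w))) \<circ> \<pi>"
      by (simp only: word_perm_rev o_id) (simp only: o_assoc)
    also have "\<dots> = word_perm (rev w) \<circ> ((adj i \<circ> word_perm w) \<circ> word_perm (rev w)) \<circ> \<pi>"
      by (simp only: o_assoc)
    also have "\<dots> = word_perm (rev w) \<circ> ((word_perm w \<circ> adj j) \<circ> word_perm (rev w)) \<circ> \<pi>"
      by (simp only: that)
    also have "\<dots> = (word_perm (rev w) \<circ> word_perm w) \<circ> adj j \<circ> word_perm (rev w) \<circ> \<pi>"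
      by (simp only: o_assoc)
    also have "\<dots> = adj j \<circ> (word_perm (rev w) \<circ> \<pi>)"
      by (simp only: word_perm_rev id_o o_assoc)
    finally show ?thesis .
  qed
  (* The word for \<pi> starts with [k..<n+1]. The letter i removes its first letter, extends it
     on the left, passes it unchanged, or passes it and becomes i - 1. *)
  consider "i = k" | "Suc i = k" | "Suc i < k" | "k < i" by linarith
  then show ?case
  proof cases
    case 1
    have kn: "[k..<Suc n] = k # [Suc k..<Suc n]" using 1 Suc.prems by (simp add: upt_conv_Cons)
    have v: "(adj i \<circ> \<pi>) (Suc n) = Suc k" by (simp add: 1 k_def[symmetric] adj_def)
    have "word_perm (rev [Suc k..<Suc n]) \<circ> (adj i \<circ> \<pi>) = \<pi>'"
      unfolding \<pi>'_def kn by (simp add: word_perm_append 1 o_assoc)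
    then have "normal_word (Suc n) (adj i \<circ> \<pi>) = [Suc k..<Suc n] @ normal_word n \<pi>'"
      by (simp only: normal_word.simps v)
    moreover have "S i \<otimes> wp (normal_word (Suc n) \<pi>) = wp ([Suc k..<Suc n] @ normal_word n \<pi>')"
    proof -
      have c: "wp ([Suc k..<Suc n] @ normal_word n \<pi>') \<in> carrier M"
        using inw[OF \<pi>'] kd by (intro wp_closed) (auto simp: kn)
      have "S i \<otimes> wp (normal_word (Suc n) \<pi>) = S k \<otimes> (S k \<otimes> wp ([Suc k..<Suc n] @ normal_word n \<pi>'))"
        unfolding nw kn by (simp add: 1)
      also have "\<dots> = wp ([Suc k..<Suc n] @ normal_word n \<pi>')"
        using S_square[of k] ik c 1 Suc.prems by (simp flip: m_assoc)
      finally show ?thesis .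
    qed
    ultimately show ?thesis by (simp only:)
  next
    case 2
    have kn: "[i..<Suc n] = i # [k..<Suc n]" using 2 Suc.prems by (simp add: upt_conv_Cons)
    have v: "(adj i \<circ> \<pi>) (Suc n) = i" by (simp add: 2[symmetric] k_def[symmetric] adj_def)
    have "word_perm (rev [i..<Suc n]) \<circ> (adj i \<circ> \<pi>)
        = word_perm (rev [k..<Suc n]) \<circ> (adj i \<circ> adj i) \<circ> \<pi>"
      unfolding kn by (simp add: word_perm_append o_assoc)
    then have "word_perm (rev [i..<Suc n]) \<circ> (adj i \<circ> \<pi>) = \<pi>'"
      by (simp only: adj_involutive o_id \<pi>'_def)
    then have "normal_word (Suc n) (adj i \<circ> \<pi>) = i # normal_word (Suc n) \<pi>"
      unfolding nw by (simp only: normal_word.simps v kn append_Cons)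
    then show ?thesis by (simp only: word_prod_simps)
  next
    case 3
    have v: "(adj i \<circ> \<pi>) (Suc n) = k" using 3 by (simp add: k_def[symmetric] adj_def)
    have "adj i \<otimes>\<^bsub>sym_group (Suc n)\<^esub> P.wp [k..<Suc n] = P.wp [k..<Suc n] \<otimes>\<^bsub>sym_group (Suc n)\<^esub> adj i"
      by (rule P.S_commute_word) (use 3 Suc.prems k in auto)
    then have "adj i \<circ> word_perm [k..<Suc n] = word_perm [k..<Suc n] \<circ> adj i"
      by (simp only: word_prod_sym_group sym_group_mult)
    then have nw': "normal_word (Suc n) (adj i \<circ> \<pi>) = [k..<Suc n] @ normal_word n (adj i \<circ> \<pi>')"
      by (simp only: normal_word.simps v inv_eq \<pi>'_def)
    have i: "1 \<le> i" "i < n" using 3 k Suc.prems by auto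
    have "S i \<otimes> wp (normal_word (Suc n) \<pi>) = (S i \<otimes> wp [k..<Suc n]) \<otimes> wp (normal_word n \<pi>')"
      unfolding nw using split[OF k(1) \<pi>'] ik kd inw[OF \<pi>'] by (simp add: m_assoc)
    also have "S i \<otimes> wp [k..<Suc n] = wp [k..<Suc n] \<otimes> S i"
      using 3 Suc.prems kd by (intro S_commute_word) auto
    also have "\<dots> \<otimes> wp (normal_word n \<pi>') = wp [k..<Suc n] \<otimes> (S i \<otimes> wp (normal_word n \<pi>'))"
      using ik kd inw[OF \<pi>'] by (simp add: m_assoc)
    also have "S i \<otimes> wp (normal_word n \<pi>') = wp (normal_word n (adj i \<circ> \<pi>'))"
      using Suc.prems(1) by (intro Suc.IH \<pi>' i) simp
    also have "wp [k..<Suc n] \<otimes> \<dots> = wp (normal_word (Suc n) (adj i \<circ> \<pi>))"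
      unfolding nw' by (intro split[symmetric] k permutes_compose[OF \<pi>'] adj_permutes i)
    finally show ?thesis .
  next
    case 4
    have v: "(adj i \<circ> \<pi>) (Suc n) = k" using 4 by (simp add: k_def[symmetric] adj_def)
    have "adj i \<otimes>\<^bsub>sym_group (Suc n)\<^esub> P.wp [k..<Suc n] = P.wp [k..<Suc n] \<otimes>\<^bsub>sym_group (Suc n)\<^esub> adj (i - 1)"
      by (rule P.S_slide) (use 4 Suc.prems k in auto)
    then have "adj i \<circ> word_perm [k..<Suc n] = word_perm [k..<Suc n] \<circ> adj (i - 1)"
      by (simp only: word_prod_sym_group sym_group_mult)
    then have nw': "normal_word (Suc n) (adj i \<circ> \<pi>) = [k..<Suc n] @ normal_word n (adj (i - 1) \<circ> \<pi>')"
      by (simp only: normal_word.simps v inv_eq \<pi>'_def)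
    have i: "1 \<le> i - 1" "i - 1 < n" using 4 k Suc.prems by auto
    have ik': "S (i - 1) \<in> carrier M" using i Suc.prems by (intro S_closed) auto
    have "S i \<otimes> wp (normal_word (Suc n) \<pi>) = (S i \<otimes> wp [k..<Suc n]) \<otimes> wp (normal_word n \<pi>')"
      unfolding nw using split[OF k(1) \<pi>'] ik kd inw[OF \<pi>'] by (simp add: m_assoc)
    also have "S i \<otimes> wp [k..<Suc n] = wp [k..<Suc n] \<otimes> S (i - 1)"
      using 4 Suc.prems k by (intro S_slide) auto
    also have "\<dots> \<otimes> wp (normal_word n \<pi>') = wp [k..<Suc n] \<otimes> (S (i - 1) \<otimes> wp (normal_word n \<pi>'))"
      using ik' kd inw[OF \<pi>'] by (simp add: m_assoc)
    also have "S (i - 1) \<otimes> wp (normal_word n \<pi>') = wp (normal_word n (adj (i - 1) \<circ> \<pi>'))"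
      using Suc.prems(1) by (intro Suc.IH \<pi>' i) simp
    also have "wp [k..<Suc n] \<otimes> \<dots> = wp (normal_word (Suc n) (adj i \<circ> \<pi>))"
      unfolding nw' by (intro split[symmetric] k permutes_compose[OF \<pi>'] adj_permutes i)
    finally show ?thesis .
  qed
qed simp

end

section \<open>Systems of crossings and tokens in an algebra\<close>

text \<open>
  The relations between crossings and tokens on \<open>d\<close> strands. Here \<open>S i\<close> is the crossing of the
  strands \<open>i\<close> and \<open>i + 1\<close>, and \<open>\<beta> i a\<close> is the token \<open>a\<close> on strand \<open>i\<close>.
\<close>

locale wreath_system =
  fixes K :: "('k, 'r) ring_scheme" and A :: "('k, 'a, 's) module_scheme" and d :: nat
    and M :: "('k, 'm, 't) module_scheme" (structure) and S :: "nat \<Rightarrow> 'm" and \<beta> :: "nat \<Rightarrow> 'a \<Rightarrow> 'm"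
  assumes K: "cring K" and A: "assoc_algebra K A" and M: "assoc_algebra K M"
    and coxeter: "coxeter_system M d S"
    and \<beta>_linear: "i \<in> {1..d} \<Longrightarrow> linear_map K A M (\<beta> i)"
    and \<beta>_mult: "i \<in> {1..d} \<Longrightarrow> a \<in> carrier A \<Longrightarrow> b \<in> carrier A \<Longrightarrow> \<beta> i a \<otimes> \<beta> i b = \<beta> i (a \<otimes>\<^bsub>A\<^esub> b)"
    and \<beta>_one: "i \<in> {1..d} \<Longrightarrow> \<beta> i \<one>\<^bsub>A\<^esub> = \<one>"
    and \<beta>_commute: "i \<in> {1..d} \<Longrightarrow> j \<in> {1..d} \<Longrightarrow> i < j \<Longrightarrow> a \<in> carrier A \<Longrightarrow> b \<in> carrier A \<Longrightarrow>
      \<beta> i a \<otimes> \<beta> j b = \<beta> j b \<otimes> \<beta> i a"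
    and S_\<beta>: "1 \<le> i \<Longrightarrow> i < d \<Longrightarrow> a \<in> carrier A \<Longrightarrow> S i \<otimes> \<beta> i a = \<beta> (Suc i) a \<otimes> S i"
    and S_\<beta>_far: "1 \<le> i \<Longrightarrow> i < d \<Longrightarrow> j \<in> {1..d} \<Longrightarrow> j \<noteq> i \<Longrightarrow> j \<noteq> Suc i \<Longrightarrow> a \<in> carrier A \<Longrightarrow>
      S i \<otimes> \<beta> j a = \<beta> j a \<otimes> S i"
begin

sublocale M: ring M by (rule assoc_algebra_ring[OF M])
sublocale C: coxeter_system M d S by (rule coxeter)

lemma \<beta>_closed: "i \<in> {1..d} \<Longrightarrow> a \<in> carrier A \<Longrightarrow> \<beta> i a \<in> carrier M"
  using linear_map_closed[OF \<beta>_linear] .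

text \<open>
  Conjugation with the involution \<open>S i\<close> turns the relation that moves tokens to the right into
  the one that moves them to the left.
\<close>

lemma \<beta>_S:
  assumes "1 \<le> i" "i < d" "a \<in> carrier A"
  shows "S i \<otimes> \<beta> (Suc i) a = \<beta> i a \<otimes> S i"
proof -
  have c: "S i \<in> carrier M" "\<beta> i a \<in> carrier M" "\<beta> (Suc i) a \<in> carrier M"
    using assms by (auto intro!: C.S_closed \<beta>_closed)
  have "S i \<otimes> \<beta> (Suc i) a = S i \<otimes> (\<beta> (Suc i) a \<otimes> S i) \<otimes> S i"
    using c C.S_square[OF assms(1,2)] by (simp add: M.m_assoc)
  also have "\<dots> = (S i \<otimes> S i) \<otimes> \<beta> i a \<otimes> S i"
    using c by (simp add: M.m_assoc flip: S_\<beta>[OF assms])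
  finally show ?thesis using c C.S_square[OF assms(1,2)] by simp
qed

primrec token_prod :: "nat \<Rightarrow> (nat \<Rightarrow> 'a) \<Rightarrow> 'm"
  where
    "token_prod 0 a = \<one>"
  | "token_prod (Suc n) a = token_prod n a \<otimes> \<beta> (Suc n) (a (Suc n))"

text \<open>
  These products play the role of the tensors \<open>a \<otimes> \<pi>\<close> in an arbitrary system.
\<close>

definition elem :: "(nat \<Rightarrow> 'a) \<Rightarrow> (nat \<Rightarrow> nat) \<Rightarrow> 'm"
  where "elem a \<pi> = token_prod d a \<otimes> word_prod M S (normal_word d \<pi>)"

lemma token_prod_closed: "n \<le> d \<Longrightarrow> a \<in> carrier (tuples A d) \<Longrightarrow> token_prod n a \<in> carrier M"
proof (induction n)
  case (Suc n)
  then have "\<beta> (Suc n) (a (Suc n)) \<in> carrier M" by (intro \<beta>_closed tuples_nth) auto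
  then show ?case using Suc by simp
qed simp

lemma token_prod_cong: "(\<And>i. 1 \<le> i \<Longrightarrow> i \<le> n \<Longrightarrow> a i = b i) \<Longrightarrow> token_prod n a = token_prod n b"
  by (induction n) auto

lemma token_prod_one: "n \<le> d \<Longrightarrow> token_prod n \<one>\<^bsub>tuples A d\<^esub> = \<one>"
  by (induction n) (auto simp: tuples_one \<beta>_one)

lemma \<beta>_commute': "i \<in> {1..d} \<Longrightarrow> j \<in> {1..d} \<Longrightarrow> i \<noteq> j \<Longrightarrow> a \<in> carrier A \<Longrightarrow> b \<in> carrier A \<Longrightarrow>
    \<beta> i a \<otimes> \<beta> j b = \<beta> j b \<otimes> \<beta> i a"
  using \<beta>_commute[of i j a b] \<beta>_commute[of j i b a] by (cases "i < j") auto

lemma \<beta>_token_prod_far: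
  assumes "n \<le> d" "i \<in> {1..d}" "n < i" "x \<in> carrier A" "a \<in> carrier (tuples A d)"
  shows "\<beta> i x \<otimes> token_prod n a = token_prod n a \<otimes> \<beta> i x"
  using assms(1,3)
proof (induction n)
  case (Suc n)
  have c: "\<beta> i x \<in> carrier M" "token_prod n a \<in> carrier M"
    using assms Suc.prems by (auto intro!: \<beta>_closed token_prod_closed)
  have an: "a (Suc n) \<in> carrier A" using tuples_nth[OF assms(5)] Suc.prems by simp
  then have c': "\<beta> (Suc n) (a (Suc n)) \<in> carrier M" using Suc.prems by (intro \<beta>_closed) auto
  have "\<beta> i x \<otimes> \<beta> (Suc n) (a (Suc n)) = \<beta> (Suc n) (a (Suc n)) \<otimes> \<beta> i x"
    using assms Suc.prems an by (intro \<beta>_commute') auto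
  then show ?case using Suc c c' by (simp add: M.commute_mult)
qed (use assms in \<open>simp add: \<beta>_closed\<close>)

lemma \<beta>_token_prod:
  assumes "n \<le> d" "1 \<le> i" "i \<le> n" "x \<in> carrier A" "a \<in> carrier (tuples A d)"
  shows "\<beta> i x \<otimes> token_prod n a = token_prod n (a(i := x \<otimes>\<^bsub>A\<^esub> a i))"
proof -
  define a' where "a' = a(i := x \<otimes>\<^bsub>A\<^esub> a i)"
  have "\<beta> i x \<otimes> token_prod n a = token_prod n a'"
    using assms(1,3)
  proof (induction n)
    case (Suc n)
    have i: "i \<in> {1..d}" using assms Suc.prems by auto
    have c: "\<beta> i x \<in> carrier M" "token_prod n a \<in> carrier M"
      using assms Suc.prems by (auto intro!: \<beta>_closed token_prod_closed)
    have an: "a (Suc n) \<in> carrier A" using tuples_nth[OF assms(5)] Suc.prems by simp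
    then have c': "\<beta> (Suc n) (a (Suc n)) \<in> carrier M" using Suc.prems by (intro \<beta>_closed) auto
    show ?case
    proof (cases "i = Suc n")
      case True
      have 1: "\<beta> i x \<otimes> token_prod n a = token_prod n a \<otimes> \<beta> i x"
        using assms Suc.prems True by (intro \<beta>_token_prod_far) auto
      have 2: "token_prod n a' = token_prod n a"
        by (rule token_prod_cong) (simp add: True a'_def)
      have "\<beta> i x \<otimes> token_prod (Suc n) a = (\<beta> i x \<otimes> token_prod n a) \<otimes> \<beta> (Suc n) (a (Suc n))"
        using c c' by (simp add: M.m_assoc)
      also have "\<dots> = token_prod n a \<otimes> (\<beta> i x \<otimes> \<beta> i (a i))"
        unfolding 1 using c c' True by (simp add: M.m_assoc)
      also have "\<dots> = token_prod (Suc n) a'"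
        using \<beta>_mult[OF i assms(4), of "a i"] an True by (simp add: 2) (simp add: a'_def)
      finally show ?thesis .
    next
      case False
      then have "\<beta> i x \<otimes> token_prod n a = token_prod n a'" using Suc by simp
      moreover have "a' (Suc n) = a (Suc n)" using False by (simp add: a'_def)
      ultimately show ?thesis using c c' by (simp flip: M.m_assoc)
    qed
  qed (use assms in simp)
  then show ?thesis by (simp only: a'_def)
qed

lemma token_prod_linear:
  assumes "n \<le> d" "1 \<le> i" "i \<le> n" "a \<in> carrier (tuples A d)"
  shows "linear_map K A M (\<lambda>x. token_prod n (a(i := x)))"
  using assms(1,3)
proof (induction n)
  case (Suc n)
  note bil = assoc_algebra_mult_bilinear[OF M]
  show ?case
  proof (cases "i = Suc n")
    case True
    have "token_prod n (a(i := x)) = token_prod n a" for x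
      by (rule token_prod_cong) (simp add: True)
    then show ?thesis
      using linear_map_comp[OF \<beta>_linear bilinear_map_right[OF bil], of "Suc n" "token_prod n a"]
        token_prod_closed[of n a] Suc.prems assms(4) True by (simp del: fun_upd_apply add: fun_upd_same)
  next
    case False
    have "a (Suc n) \<in> carrier A" using tuples_nth[OF assms(4)] Suc.prems by simp
    then have "\<beta> (Suc n) (a (Suc n)) \<in> carrier M" using Suc.prems by (intro \<beta>_closed) auto
    then show ?thesis
      using linear_map_comp[OF Suc.IH bilinear_map_left[OF bil]] Suc.prems False by simp
  qed
qed (use assms in simp)

lemma S_token_prod_far:
  assumes "n < i" "i < d" "a \<in> carrier (tuples A d)"
  shows "S i \<otimes> token_prod n a = token_prod n a \<otimes> S i"
  using assms(1)
proof (induction n)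
  case (Suc n)
  have c: "S i \<in> carrier M" "token_prod n a \<in> carrier M"
    using assms Suc.prems by (auto intro!: C.S_closed token_prod_closed)
  have an: "a (Suc n) \<in> carrier A" using tuples_nth[OF assms(3)] Suc.prems assms by simp
  then have c': "\<beta> (Suc n) (a (Suc n)) \<in> carrier M" using Suc.prems assms by (intro \<beta>_closed) auto
  have "S i \<otimes> \<beta> (Suc n) (a (Suc n)) = \<beta> (Suc n) (a (Suc n)) \<otimes> S i"
    using assms Suc.prems an by (intro S_\<beta>_far) auto
  then show ?case using Suc c c' by (simp add: M.commute_mult)
qed (use assms in \<open>simp add: C.S_closed\<close>)

text \<open>
  Only the tokens on the strands \<open>i\<close> and \<open>i + 1\<close> are affected. The crossing exchanges them, and
  they commute afterwards.
\<close>

lemma S_token_prod: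
  assumes "n \<le> d" "1 \<le> i" "i < n" "a \<in> carrier (tuples A d)"
  shows "S i \<otimes> token_prod n a = token_prod n (a \<circ> adj i) \<otimes> S i"
proof -
  define a' where "a' = a \<circ> adj i"
  have "S i \<otimes> token_prod n a = token_prod n a' \<otimes> S i"
  using assms(1,3)
proof (induction n)
  case (Suc n)
  have c: "S i \<in> carrier M" "token_prod n a \<in> carrier M"
    using assms Suc.prems by (auto intro!: C.S_closed token_prod_closed)
  have a: "a j \<in> carrier A" "\<beta> l (a j) \<in> carrier M" if "1 \<le> j" "j \<le> d" "1 \<le> l" "l \<le> d" for j l
    using tuples_nth[OF assms(4), of j] that by (auto intro!: \<beta>_closed)
  show ?case
  proof (cases "i = n")
    case True
    then obtain m where m: "n = Suc m" using assms by (cases n) auto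
    have cm: "token_prod m a \<in> carrier M" using assms Suc.prems m by (intro token_prod_closed) auto
    have t: "token_prod m a' = token_prod m a"
      by (rule token_prod_cong) (simp add: a'_def adj_def True m transpose_def)
    have ad: "a' i = a (Suc i)" "a' (Suc i) = a i" by (simp_all add: a'_def adj_def)
    have i: "1 \<le> i" "i < d" using assms Suc.prems by auto
    have an: "a i \<in> carrier A" "a (Suc i) \<in> carrier A" using a[of i i] a[of "Suc i" i] i by auto
    have bc: "\<beta> i (a i) \<in> carrier M" "\<beta> i (a (Suc i)) \<in> carrier M" "\<beta> (Suc i) (a i) \<in> carrier M"
      "\<beta> (Suc i) (a (Suc i)) \<in> carrier M"
      using a i by auto
    have expand: "token_prod (Suc n) b = token_prod m b \<otimes> \<beta> i (b i) \<otimes> \<beta> (Suc i) (b (Suc i))" for b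
      using m True by simp
    have "S i \<otimes> token_prod (Suc n) a = (S i \<otimes> token_prod m a) \<otimes> (\<beta> i (a i) \<otimes> \<beta> (Suc i) (a (Suc i)))"
      unfolding expand using c cm bc by (simp add: M.m_assoc)
    also have "S i \<otimes> token_prod m a = token_prod m a \<otimes> S i"
      using i m True assms by (intro S_token_prod_far) auto
    also have "token_prod m a \<otimes> S i \<otimes> (\<beta> i (a i) \<otimes> \<beta> (Suc i) (a (Suc i)))
        = token_prod m a \<otimes> ((S i \<otimes> \<beta> i (a i)) \<otimes> \<beta> (Suc i) (a (Suc i)))"
      using c cm bc by (simp add: M.m_assoc)
    also have "S i \<otimes> \<beta> i (a i) = \<beta> (Suc i) (a i) \<otimes> S i" by (rule S_\<beta>[OF i an(1)])
    also have "\<beta> (Suc i) (a i) \<otimes> S i \<otimes> \<beta> (Suc i) (a (Suc i))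
        = \<beta> (Suc i) (a i) \<otimes> (S i \<otimes> \<beta> (Suc i) (a (Suc i)))"
      using c cm bc by (simp add: M.m_assoc)
    also have "S i \<otimes> \<beta> (Suc i) (a (Suc i)) = \<beta> i (a (Suc i)) \<otimes> S i" by (rule \<beta>_S[OF i an(2)])
    also have "\<beta> (Suc i) (a i) \<otimes> (\<beta> i (a (Suc i)) \<otimes> S i)
        = (\<beta> (Suc i) (a i) \<otimes> \<beta> i (a (Suc i))) \<otimes> S i"
      using c cm bc by (simp add: M.m_assoc)
    also have "\<beta> (Suc i) (a i) \<otimes> \<beta> i (a (Suc i)) = \<beta> i (a (Suc i)) \<otimes> \<beta> (Suc i) (a i)"
      using i an by (intro \<beta>_commute') auto
    also have "token_prod m a \<otimes> (\<beta> i (a (Suc i)) \<otimes> \<beta> (Suc i) (a i) \<otimes> S i)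
        = token_prod (Suc n) a' \<otimes> S i"
      unfolding expand t using c cm bc by (simp add: ad M.m_assoc)
    finally show ?thesis .
  next
    case False
    then have i: "i < n" using Suc.prems by simp
    have aj: "a' (Suc n) = a (Suc n)" using i by (simp add: a'_def adj_def)
    have c2: "token_prod n a' \<in> carrier M"
      unfolding a'_def using assms Suc.prems by (intro token_prod_closed tuples_permute adj_permutes) auto
    have b: "\<beta> (Suc n) (a (Suc n)) \<in> carrier M" using a Suc.prems by simp
    have "S i \<otimes> \<beta> (Suc n) (a (Suc n)) = \<beta> (Suc n) (a (Suc n)) \<otimes> S i"
      using assms Suc.prems i a[of "Suc n" "Suc n"] by (intro S_\<beta>_far) auto
    then have "token_prod n a' \<otimes> (S i \<otimes> \<beta> (Suc n) (a (Suc n)))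
        = token_prod (Suc n) a' \<otimes> S i"
      using c c2 b aj by (simp add: M.m_assoc)
    moreover have "S i \<otimes> token_prod (Suc n) a = token_prod n a' \<otimes> (S i \<otimes> \<beta> (Suc n) (a (Suc n)))"
      using Suc.IH i Suc.prems c c2 b by (simp flip: M.m_assoc)
    ultimately show ?thesis by (simp only:)
  qed
qed (use assms in simp)
  then show ?thesis by (simp only: a'_def)
qed

lemma elem_word_closed: "\<pi> permutes {1..d} \<Longrightarrow> word_prod M S (normal_word d \<pi>) \<in> carrier M"
  using normal_word_correct(1) by (intro C.wp_closed)

lemma elem_closed: "a \<in> carrier (tuples A d) \<Longrightarrow> \<pi> permutes {1..d} \<Longrightarrow> elem a \<pi> \<in> carrier M"
  by (simp add: elem_def token_prod_closed elem_word_closed)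

lemma elem_one: "elem \<one>\<^bsub>tuples A d\<^esub> id = \<one>"
  by (simp add: elem_def token_prod_one normal_word_id)

lemma \<beta>_elem:
  assumes "i \<in> {1..d}" "x \<in> carrier A" "a \<in> carrier (tuples A d)" "\<pi> permutes {1..d}"
  shows "\<beta> i x \<otimes> elem a \<pi> = elem (a(i := x \<otimes>\<^bsub>A\<^esub> a i)) \<pi>"
  using assms \<beta>_token_prod[of d i x a]
  by (simp add: elem_def \<beta>_closed token_prod_closed elem_word_closed flip: M.m_assoc)

text \<open>
  The crossing passes the tokens, permuting them, and is then absorbed by the normal word.
\<close>

lemma S_elem:
  assumes "1 \<le> i" "i < d" "a \<in> carrier (tuples A d)" "\<pi> permutes {1..d}"
  shows "S i \<otimes> elem a \<pi> = elem (a \<circ> adj i) (adj i \<circ> \<pi>)"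
proof -
  have c: "S i \<in> carrier M" "token_prod d a \<in> carrier M" "token_prod d (a \<circ> adj i) \<in> carrier M"
    "word_prod M S (normal_word d \<pi>) \<in> carrier M"
    using assms by (auto intro!: C.S_closed token_prod_closed elem_word_closed tuples_permute adj_permutes)
  have "S i \<otimes> elem a \<pi> = (S i \<otimes> token_prod d a) \<otimes> word_prod M S (normal_word d \<pi>)"
    using c by (simp add: elem_def M.m_assoc)
  also have "\<dots> = token_prod d (a \<circ> adj i) \<otimes> (S i \<otimes> word_prod M S (normal_word d \<pi>))"
    using c assms S_token_prod[of d i a] by (simp add: M.m_assoc)
  also have "\<dots> = elem (a \<circ> adj i) (adj i \<circ> \<pi>)"
    using assms C.S_normal_word[of d \<pi> i] by (simp add: elem_def)
  finally show ?thesis .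
qed

lemma elem_multilinear:
  assumes "\<pi> permutes {1..d}"
  shows "multilinear_map K A d M (\<lambda>a. elem a \<pi>)"
  unfolding multilinear_map_def
proof (intro ballI conjI)
  fix a i assume a: "a \<in> carrier (tuples A d)" and i: "i \<in> {1..d}"
  show "linear_map K A M (\<lambda>x. elem (a(i := x)) \<pi>)"
    unfolding elem_def using a i
    by (intro linear_map_comp[OF token_prod_linear
          bilinear_map_left[OF assoc_algebra_mult_bilinear[OF M] elem_word_closed[OF assms]]]) auto
qed (intro elem_closed assms)

end

text \<open>
  Normal forms are products of tokens and crossings, so homomorphisms that match the generators
  match the normal forms.
\<close>

lemma elem_hom:
  assumes M: "wreath_system K A d M S \<beta>" and N: "wreath_system K A d N S' \<beta>'"
    and h: "h \<in> carrier M \<rightarrow> carrier N" "h \<one>\<^bsub>M\<^esub> = \<one>\<^bsub>N\<^esub>"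
      "\<And>x y. x \<in> carrier M \<Longrightarrow> y \<in> carrier M \<Longrightarrow> h (x \<otimes>\<^bsub>M\<^esub> y) = h x \<otimes>\<^bsub>N\<^esub> h y"
    and S: "\<And>i. 1 \<le> i \<Longrightarrow> i < d \<Longrightarrow> h (S i) = S' i"
    and \<beta>: "\<And>i a. i \<in> {1..d} \<Longrightarrow> a \<in> carrier A \<Longrightarrow> h (\<beta> i a) = \<beta>' i a"
    and a: "a \<in> carrier (tuples A d)" and \<pi>: "\<pi> permutes {1..d}"
  shows "h (wreath_system.elem d M S \<beta> a \<pi>) = wreath_system.elem d N S' \<beta>' a \<pi>"
proof -
  interpret M: wreath_system K A d M S \<beta> by fact
  interpret N: wreath_system K A d N S' \<beta>' by fact
  have w: "h (word_prod M S w) = word_prod N S' w" if "set w \<subseteq> {1..<d}" for w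
    using that
  proof (induction w)
    case (Cons i w)
    then show ?case using h(3)[of "S i" "word_prod M S w"] by (simp add: M.C.S_closed S)
  qed (simp add: h)
  have t: "h (M.token_prod n a) = N.token_prod n a" if "n \<le> d" for n
    using that
  proof (induction n)
    case (Suc n)
    have "a (Suc n) \<in> carrier A" using tuples_nth[OF a] Suc.prems by simp
    then show ?case
      using Suc h(3)[of "M.token_prod n a" "\<beta> (Suc n) (a (Suc n))"]
      by (simp add: M.token_prod_closed[OF _ a] M.\<beta>_closed \<beta>)
  qed (simp add: h)
  show ?thesis
    unfolding M.elem_def N.elem_def
    using h(3)[OF M.token_prod_closed[OF _ a] M.elem_word_closed[OF \<pi>]]
    by (simp add: t w[OF normal_word_correct(1)[OF \<pi>]])
qed

section \<open>Crossings and tokens in the wreath product algebra\<close>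

definition wreath_cross where
  "wreath_cross K A d i = wreath_elem K A d \<one>\<^bsub>tuples A d\<^esub> (adj i)"

definition wreath_token where
  "wreath_token K A d i a = wreath_elem K A d (\<one>\<^bsub>tuples A d\<^esub>(i := a)) id"

text \<open>
  Apart from the linearity of tokens, all relations are instances of the multiplication formula
  for \<open>a \<otimes> \<pi>\<close>, with \<open>\<pi>\<close> a composite of adjacent transpositions and tuples \<open>a\<close> that are trivial
  at all positions but at most two.
\<close>

lemma wreath_algebra_system:
  assumes K: "cring K" and A: "assoc_algebra K A"
  shows "wreath_system K A d (wreath_algebra K A d) (wreath_cross K A d) (wreath_token K A d)"
proof -
  interpret A: ring A by (rule assoc_algebra_ring[OF A])
  interpret T: Group.monoid "tuples A d" by (rule tuples_monoid[OF A.monoid_axioms])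
  interpret W: ring "wreath_algebra K A d" by (rule assoc_algebra_ring[OF wreath_assoc_algebra[OF K A]])
  note mult = wreath_elem_mult[OF K A]
  have inv: "inv' (adj i) = adj i" for i by (simp add: adj_def)
  have one_upd: "\<one>\<^bsub>tuples A d\<^esub>(i := x) \<in> carrier (tuples A d)" if "i \<in> {1..d}" "x \<in> carrier A" for i x
    using that by (intro tuples_upd T.one_closed)
  have upd_adj: "\<one>\<^bsub>tuples A d\<^esub>(j := x) \<circ> adj i = \<one>\<^bsub>tuples A d\<^esub>(adj i j := x)" if "1 \<le> i" "i < d" for i j x
    using that by (auto simp: adj_def tuples_one fun_eq_iff transpose_def)
  have cross_cross: "wreath_elem K A d \<one>\<^bsub>tuples A d\<^esub> \<pi> \<otimes>\<^bsub>wreath_algebra K A d\<^esub> wreath_elem K A d \<one>\<^bsub>tuples A d\<^esub> \<sigma>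
      = wreath_elem K A d \<one>\<^bsub>tuples A d\<^esub> (\<pi> \<circ> \<sigma>)" if "\<pi> permutes {1..d}" "\<sigma> permutes {1..d}" for \<pi> \<sigma>
    using that by (simp add: mult tuples_one_permute permutes_inv)
  have S: "coxeter_system (wreath_algebra K A d) d (wreath_cross K A d)"
  proof
    note [simp] = adj_permutes cross_cross permutes_compose
    show "wreath_cross K A d i \<in> carrier (wreath_algebra K A d)" if "1 \<le> i" "i < d" for i
      unfolding wreath_cross_def by (intro wreath_elem_closed[OF K A] T.one_closed adj_permutes that)
    show "wreath_cross K A d i \<otimes>\<^bsub>wreath_algebra K A d\<^esub> wreath_cross K A d i = \<one>\<^bsub>wreath_algebra K A d\<^esub>"
      if "1 \<le> i" "i < d" for i
      using that by (simp add: wreath_cross_def adj_involutive wreath_one[OF K A] del: One_nat_def)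
    show "wreath_cross K A d i \<otimes>\<^bsub>wreath_algebra K A d\<^esub> (wreath_cross K A d (Suc i) \<otimes>\<^bsub>wreath_algebra K A d\<^esub> wreath_cross K A d i)
      = wreath_cross K A d (Suc i) \<otimes>\<^bsub>wreath_algebra K A d\<^esub> (wreath_cross K A d i \<otimes>\<^bsub>wreath_algebra K A d\<^esub> wreath_cross K A d (Suc i))"
      if "1 \<le> i" "Suc i < d" for i
    proof -
      have "adj i \<circ> (adj (Suc i) \<circ> adj i) = adj (Suc i) \<circ> (adj i \<circ> adj (Suc i))"
        by (auto simp: adj_def fun_eq_iff transpose_def)
      then show ?thesis using that by (simp add: wreath_cross_def del: One_nat_def)
    qed
    show "wreath_cross K A d i \<otimes>\<^bsub>wreath_algebra K A d\<^esub> wreath_cross K A d j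
      = wreath_cross K A d j \<otimes>\<^bsub>wreath_algebra K A d\<^esub> wreath_cross K A d i"
      if "1 \<le> i" "Suc i < j" "j < d" for i j
    proof -
      have "adj i \<circ> adj j = adj j \<circ> adj i" using that by (auto simp: adj_def fun_eq_iff transpose_def)
      then show ?thesis using that by (simp add: wreath_cross_def del: One_nat_def)
    qed
  qed
  have token_token: "wreath_token K A d i a \<otimes>\<^bsub>wreath_algebra K A d\<^esub> wreath_token K A d j b
      = wreath_elem K A d (\<one>\<^bsub>tuples A d\<^esub>(i := a) \<otimes>\<^bsub>tuples A d\<^esub> \<one>\<^bsub>tuples A d\<^esub>(j := b)) id"
    if "i \<in> {1..d}" "j \<in> {1..d}" "a \<in> carrier A" "b \<in> carrier A" for i j a b
    unfolding wreath_token_def using that by (simp add: mult one_upd permutes_id del: One_nat_def)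
  have cross_token: "wreath_cross K A d i \<otimes>\<^bsub>wreath_algebra K A d\<^esub> wreath_token K A d j a
      = wreath_elem K A d (\<one>\<^bsub>tuples A d\<^esub>(adj i j := a)) (adj i)"
    and token_cross: "wreath_token K A d j a \<otimes>\<^bsub>wreath_algebra K A d\<^esub> wreath_cross K A d i
      = wreath_elem K A d (\<one>\<^bsub>tuples A d\<^esub>(j := a)) (adj i)"
    if i: "1 \<le> i" "i < d" and j: "j \<in> {1..d}" "a \<in> carrier A" for i j a
  proof -
    have "adj i j \<in> {1..d}" using permutes_in_image[OF adj_permutes[OF i]] j by blast
    then show "wreath_cross K A d i \<otimes>\<^bsub>wreath_algebra K A d\<^esub> wreath_token K A d j a
      = wreath_elem K A d (\<one>\<^bsub>tuples A d\<^esub>(adj i j := a)) (adj i)"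
      unfolding wreath_cross_def wreath_token_def
      using that by (simp add: mult one_upd permutes_id adj_permutes inv upd_adj del: One_nat_def)
    show "wreath_token K A d j a \<otimes>\<^bsub>wreath_algebra K A d\<^esub> wreath_cross K A d i
      = wreath_elem K A d (\<one>\<^bsub>tuples A d\<^esub>(j := a)) (adj i)"
      unfolding wreath_cross_def wreath_token_def
      using that by (simp add: mult one_upd permutes_id adj_permutes del: One_nat_def)
  qed
  show ?thesis
  proof (rule wreath_system.intro)
    fix i assume i: "i \<in> {1..d}"
    show "linear_map K A (wreath_algebra K A d) (wreath_token K A d i)"
      unfolding wreath_token_def
      using wreath_elem_multilinear[OF K A permutes_id] i T.one_closed unfolding multilinear_map_def by blast
    show "wreath_token K A d i \<one>\<^bsub>A\<^esub> = \<one>\<^bsub>wreath_algebra K A d\<^esub>"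
      using i by (simp add: wreath_token_def wreath_one[OF K A] tuples_one fun_upd_idem)
    fix a b assume ab: "a \<in> carrier A" "b \<in> carrier A"
    have "\<one>\<^bsub>tuples A d\<^esub>(i := a) \<otimes>\<^bsub>tuples A d\<^esub> \<one>\<^bsub>tuples A d\<^esub>(i := b) = \<one>\<^bsub>tuples A d\<^esub>(i := a \<otimes>\<^bsub>A\<^esub> b)"
      using i ab by (auto simp: tuples_mult tuples_one fun_eq_iff)
    then show "wreath_token K A d i a \<otimes>\<^bsub>wreath_algebra K A d\<^esub> wreath_token K A d i b
        = wreath_token K A d i (a \<otimes>\<^bsub>A\<^esub> b)"
      using token_token[OF i i ab] by (simp add: wreath_token_def)
    fix j assume j: "j \<in> {1..d}" "i < j"
    have "\<one>\<^bsub>tuples A d\<^esub>(i := a) \<otimes>\<^bsub>tuples A d\<^esub> \<one>\<^bsub>tuples A d\<^esub>(j := b)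
        = \<one>\<^bsub>tuples A d\<^esub>(j := b) \<otimes>\<^bsub>tuples A d\<^esub> \<one>\<^bsub>tuples A d\<^esub>(i := a)"
      using i j ab by (auto simp: tuples_mult tuples_one fun_eq_iff)
    then show "wreath_token K A d i a \<otimes>\<^bsub>wreath_algebra K A d\<^esub> wreath_token K A d j b
        = wreath_token K A d j b \<otimes>\<^bsub>wreath_algebra K A d\<^esub> wreath_token K A d i a"
      using i j ab by (simp add: token_token del: One_nat_def)
  next
    fix i a assume i: "1 \<le> i" "i < d" and a: "a \<in> carrier A"
    have adi: "adj i i = Suc i" by (simp add: adj_def)
    show "wreath_cross K A d i \<otimes>\<^bsub>wreath_algebra K A d\<^esub> wreath_token K A d i a
        = wreath_token K A d (Suc i) a \<otimes>\<^bsub>wreath_algebra K A d\<^esub> wreath_cross K A d i"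
      using cross_token[OF i, of i a] token_cross[OF i, of "Suc i" a] i a by (simp add: adi)
    fix j assume j: "j \<in> {1..d}" "j \<noteq> i" "j \<noteq> Suc i"
    then have "adj i j = j" by (simp add: adj_def)
    then show "wreath_cross K A d i \<otimes>\<^bsub>wreath_algebra K A d\<^esub> wreath_token K A d j a
        = wreath_token K A d j a \<otimes>\<^bsub>wreath_algebra K A d\<^esub> wreath_cross K A d i"
      using i a j by (simp add: cross_token token_cross del: One_nat_def)
  qed (rule K A wreath_assoc_algebra[OF K A] S)+
qed

text \<open>
  A product of tokens fills the unit tuple from the left; \<open>tr n\<close> below is the tuple filled up to
  position \<open>n\<close>.
\<close>

lemma wreath_system_elem_eq:
  assumes K: "cring K" and A: "assoc_algebra K A"
    and a: "a \<in> carrier (tuples A d)" and \<pi>: "\<pi> permutes {1..d}"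
  shows "wreath_system.elem d (wreath_algebra K A d) (wreath_cross K A d) (wreath_token K A d) a \<pi>
    = wreath_elem K A d a \<pi>"
proof -
  interpret W: wreath_system K A d "wreath_algebra K A d" "wreath_cross K A d" "wreath_token K A d"
    by (rule wreath_algebra_system[OF K A])
  interpret A: ring A by (rule assoc_algebra_ring[OF A])
  interpret T: Group.monoid "tuples A d" by (rule tuples_monoid[OF A.monoid_axioms])
  note mult = wreath_elem_mult[OF K A]
  have w: "word_prod (wreath_algebra K A d) (wreath_cross K A d) w
      = wreath_elem K A d \<one>\<^bsub>tuples A d\<^esub> (word_perm w)" if "set w \<subseteq> {1..<d}" for w
    using that
  proof (induction w)
    case (Cons i w)
    then have i: "adj i permutes {1..d}" and v: "word_perm w permutes {1..d}"
      by (simp_all add: adj_permutes word_perm_permutes del: One_nat_def)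
    have "word_prod (wreath_algebra K A d) (wreath_cross K A d) (i # w)
        = wreath_cross K A d i \<otimes>\<^bsub>wreath_algebra K A d\<^esub> wreath_elem K A d \<one>\<^bsub>tuples A d\<^esub> (word_perm w)"
      using Cons by simp
    also have "\<dots> = wreath_elem K A d (\<one>\<^bsub>tuples A d\<^esub> \<otimes>\<^bsub>tuples A d\<^esub> (\<one>\<^bsub>tuples A d\<^esub> \<circ> inv' (adj i)))
        (adj i \<circ> word_perm w)"
      unfolding wreath_cross_def by (rule mult[OF T.one_closed T.one_closed i v])
    finally show ?case
      by (simp only: tuples_one_permute[OF permutes_inv[OF i]] T.l_one[OF T.one_closed] word_perm_simps)
  qed (simp add: wreath_one[OF K A])
  define tr where "tr n = (\<lambda>i\<in>{1..d}. if i \<le> n then a i else \<one>\<^bsub>A\<^esub>)" for n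
  have t: "W.token_prod n a = wreath_elem K A d (tr n) id" if "n \<le> d" for n
    using that
  proof (induction n)
    case 0
    have "tr 0 = \<one>\<^bsub>tuples A d\<^esub>" by (auto simp: tr_def tuples_one fun_eq_iff)
    then show ?case by (simp only: W.token_prod.simps wreath_one[OF K A])
  next
    case (Suc n)
    have an: "a i \<in> carrier A" if "1 \<le> i" "i \<le> d" for i using tuples_nth[OF a] that by simp
    have trc: "tr n \<in> carrier (tuples A d)" using an by (auto simp: tr_def tuples_carrier)
    have oc: "\<one>\<^bsub>tuples A d\<^esub>(Suc n := a (Suc n)) \<in> carrier (tuples A d)"
      using an Suc.prems by (intro tuples_upd T.one_closed) auto
    have "tr n \<otimes>\<^bsub>tuples A d\<^esub> \<one>\<^bsub>tuples A d\<^esub>(Suc n := a (Suc n)) = tr (Suc n)"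
      using an Suc.prems by (auto simp: tr_def tuples_mult tuples_one fun_eq_iff not_le less_Suc_eq_le)
    moreover have "W.token_prod (Suc n) a
        = wreath_elem K A d (tr n) id \<otimes>\<^bsub>wreath_algebra K A d\<^esub>
          wreath_elem K A d (\<one>\<^bsub>tuples A d\<^esub>(Suc n := a (Suc n))) id"
      unfolding W.token_prod.simps Suc.IH[OF Suc_leD[OF Suc.prems]] wreath_token_def ..
    moreover have "\<dots> = wreath_elem K A d (tr n \<otimes>\<^bsub>tuples A d\<^esub> \<one>\<^bsub>tuples A d\<^esub>(Suc n := a (Suc n))) id"
      using mult[OF trc oc permutes_id permutes_id] by simp
    ultimately show ?case by (simp only:)
  qed
  have "tr d = a"
    using a by (auto simp: tr_def tuples_carrier fun_eq_iff PiE_iff extensional_def)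
  then show ?thesis
    unfolding W.elem_def
    using a \<pi> normal_word_correct[OF \<pi>] T.one_closed by (simp add: t w mult permutes_id del: One_nat_def)
qed

section \<open>Strict linear monoidal categories\<close>

text \<open>
  Equality of morphisms as a relation. Taken as the congruence in the locale below, it turns the
  axioms modulo a congruence into equations.
\<close>

definition mor_eq :: "('k, 'o, 'm, 's) lin_mon_cat_scheme \<Rightarrow> ('m \<times> 'm) set"
  where "mor_eq C = {(f, f) | f. \<exists>X Y. f \<in> Mor C X Y}"

text \<open>
  The axioms of a strict linear monoidal category up to a relation \<open>E\<close> that is compatible with
  all operations. The quotient by \<open>E\<close> is then a strict linear monoidal category. This is applied
  twice, to expressions modulo the axioms and to the free category modulo a tensor ideal.
\<close>

locale monoidal_congruence =
  fixes K :: "('k, 'r) ring_scheme" and C :: "('k, 'o, 'm, 's) lin_mon_cat_scheme" (structure)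
    and E :: "('m \<times> 'm) set"
  assumes K: "cring K"
    and Mor_unique: "f \<in> Mor C X Y \<Longrightarrow> f \<in> Mor C X' Y' \<Longrightarrow> X = X' \<and> Y = Y'"
    and ident: "ident C X \<in> Mor C X X"
    and comp: "g \<in> Mor C Y Z \<Longrightarrow> f \<in> Mor C X Y \<Longrightarrow> g \<cdot> f \<in> Mor C X Z"
    and tens: "f \<in> Mor C X Y \<Longrightarrow> g \<in> Mor C X' Y' \<Longrightarrow> f \<boxtimes> g \<in> Mor C (tens_obj C X X') (tens_obj C Y Y')"
    and zero: "mzero C X Y \<in> Mor C X Y"
    and add: "f \<in> Mor C X Y \<Longrightarrow> g \<in> Mor C X Y \<Longrightarrow> f \<boxplus> g \<in> Mor C X Y"
    and scale: "r \<in> carrier K \<Longrightarrow> f \<in> Mor C X Y \<Longrightarrow> r \<star> f \<in> Mor C X Y"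
    and obj_assoc: "tens_obj C (tens_obj C X Y) Z = tens_obj C X (tens_obj C Y Z)"
    and obj_unit_left: "tens_obj C (unit_obj C) X = X"
    and obj_unit_right: "tens_obj C X (unit_obj C) = X"
    and E_parallel: "(f, g) \<in> E \<Longrightarrow> \<exists>X Y. f \<in> Mor C X Y \<and> g \<in> Mor C X Y"
    and E_refl: "f \<in> Mor C X Y \<Longrightarrow> (f, f) \<in> E"
    and E_sym: "(f, g) \<in> E \<Longrightarrow> (g, f) \<in> E"
    and E_trans: "(f, g) \<in> E \<Longrightarrow> (g, h) \<in> E \<Longrightarrow> (f, h) \<in> E"
    and cong_comp: "g \<in> Mor C Y Z \<Longrightarrow> f \<in> Mor C X Y \<Longrightarrow> (g, g') \<in> E \<Longrightarrow> (f, f') \<in> E \<Longrightarrow> (g \<cdot> f, g' \<cdot> f') \<in> E"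
    and cong_tens: "(f, f') \<in> E \<Longrightarrow> (g, g') \<in> E \<Longrightarrow> (f \<boxtimes> g, f' \<boxtimes> g') \<in> E"
    and cong_add: "f \<in> Mor C X Y \<Longrightarrow> g \<in> Mor C X Y \<Longrightarrow> (f, f') \<in> E \<Longrightarrow> (g, g') \<in> E \<Longrightarrow> (f \<boxplus> g, f' \<boxplus> g') \<in> E"
    and cong_scale: "r \<in> carrier K \<Longrightarrow> (f, f') \<in> E \<Longrightarrow> (r \<star> f, r \<star> f') \<in> E"
    and add_assoc: "f \<in> Mor C X Y \<Longrightarrow> g \<in> Mor C X Y \<Longrightarrow> h \<in> Mor C X Y \<Longrightarrow> ((f \<boxplus> g) \<boxplus> h, f \<boxplus> (g \<boxplus> h)) \<in> E"
    and add_comm: "f \<in> Mor C X Y \<Longrightarrow> g \<in> Mor C X Y \<Longrightarrow> (f \<boxplus> g, g \<boxplus> f) \<in> E"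
    and add_zero: "f \<in> Mor C X Y \<Longrightarrow> (f \<boxplus> mzero C X Y, f) \<in> E"
    and add_minus: "f \<in> Mor C X Y \<Longrightarrow> (f \<boxplus> (\<ominus>\<^bsub>K\<^esub> \<one>\<^bsub>K\<^esub>) \<star> f, mzero C X Y) \<in> E"
    and scale_one: "f \<in> Mor C X Y \<Longrightarrow> (\<one>\<^bsub>K\<^esub> \<star> f, f) \<in> E"
    and scale_mult: "r \<in> carrier K \<Longrightarrow> q \<in> carrier K \<Longrightarrow> f \<in> Mor C X Y \<Longrightarrow> ((r \<otimes>\<^bsub>K\<^esub> q) \<star> f, r \<star> q \<star> f) \<in> E"
    and scale_add_left: "r \<in> carrier K \<Longrightarrow> q \<in> carrier K \<Longrightarrow> f \<in> Mor C X Y \<Longrightarrow>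
      ((r \<oplus>\<^bsub>K\<^esub> q) \<star> f, r \<star> f \<boxplus> q \<star> f) \<in> E"
    and scale_add_right: "r \<in> carrier K \<Longrightarrow> f \<in> Mor C X Y \<Longrightarrow> g \<in> Mor C X Y \<Longrightarrow>
      (r \<star> (f \<boxplus> g), r \<star> f \<boxplus> r \<star> g) \<in> E"
    and comp_assoc: "h \<in> Mor C Y Z \<Longrightarrow> g \<in> Mor C X Y \<Longrightarrow> f \<in> Mor C W X \<Longrightarrow> ((h \<cdot> g) \<cdot> f, h \<cdot> (g \<cdot> f)) \<in> E"
    and comp_ident_left: "f \<in> Mor C X Y \<Longrightarrow> (ident C Y \<cdot> f, f) \<in> E"
    and comp_ident_right: "f \<in> Mor C X Y \<Longrightarrow> (f \<cdot> ident C X, f) \<in> E"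
    and comp_add_left: "g \<in> Mor C Y Z \<Longrightarrow> h \<in> Mor C Y Z \<Longrightarrow> f \<in> Mor C X Y \<Longrightarrow>
      ((g \<boxplus> h) \<cdot> f, g \<cdot> f \<boxplus> h \<cdot> f) \<in> E"
    and comp_add_right: "h \<in> Mor C Y Z \<Longrightarrow> f \<in> Mor C X Y \<Longrightarrow> g \<in> Mor C X Y \<Longrightarrow>
      (h \<cdot> (f \<boxplus> g), h \<cdot> f \<boxplus> h \<cdot> g) \<in> E"
    and comp_scale_left: "r \<in> carrier K \<Longrightarrow> g \<in> Mor C Y Z \<Longrightarrow> f \<in> Mor C X Y \<Longrightarrow> ((r \<star> g) \<cdot> f, r \<star> (g \<cdot> f)) \<in> E"
    and comp_scale_right: "r \<in> carrier K \<Longrightarrow> g \<in> Mor C Y Z \<Longrightarrow> f \<in> Mor C X Y \<Longrightarrow> (g \<cdot> (r \<star> f), r \<star> (g \<cdot> f)) \<in> E"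
    and tens_ident: "(ident C X \<boxtimes> ident C Y, ident C (tens_obj C X Y)) \<in> E"
    and interchange: "g \<in> Mor C Y Z \<Longrightarrow> f \<in> Mor C X Y \<Longrightarrow> g' \<in> Mor C Y' Z' \<Longrightarrow> f' \<in> Mor C X' Y' \<Longrightarrow>
      ((g \<cdot> f) \<boxtimes> (g' \<cdot> f'), (g \<boxtimes> g') \<cdot> (f \<boxtimes> f')) \<in> E"
    and tens_assoc: "f \<in> Mor C X Y \<Longrightarrow> g \<in> Mor C X' Y' \<Longrightarrow> h \<in> Mor C X'' Y'' \<Longrightarrow>
      ((f \<boxtimes> g) \<boxtimes> h, f \<boxtimes> (g \<boxtimes> h)) \<in> E"
    and tens_unit_left: "f \<in> Mor C X Y \<Longrightarrow> (ident C (unit_obj C) \<boxtimes> f, f) \<in> E"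
    and tens_unit_right: "f \<in> Mor C X Y \<Longrightarrow> (f \<boxtimes> ident C (unit_obj C), f) \<in> E"
    and tens_add_left: "f \<in> Mor C X Y \<Longrightarrow> g \<in> Mor C X Y \<Longrightarrow> h \<in> Mor C X' Y' \<Longrightarrow>
      ((f \<boxplus> g) \<boxtimes> h, f \<boxtimes> h \<boxplus> g \<boxtimes> h) \<in> E"
    and tens_add_right: "f \<in> Mor C X Y \<Longrightarrow> g \<in> Mor C X' Y' \<Longrightarrow> h \<in> Mor C X' Y' \<Longrightarrow>
      (f \<boxtimes> (g \<boxplus> h), f \<boxtimes> g \<boxplus> f \<boxtimes> h) \<in> E"
    and tens_scale_left: "r \<in> carrier K \<Longrightarrow> f \<in> Mor C X Y \<Longrightarrow> g \<in> Mor C X' Y' \<Longrightarrow>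
      ((r \<star> f) \<boxtimes> g, r \<star> (f \<boxtimes> g)) \<in> E"
    and tens_scale_right: "r \<in> carrier K \<Longrightarrow> f \<in> Mor C X Y \<Longrightarrow> g \<in> Mor C X' Y' \<Longrightarrow>
      (f \<boxtimes> (r \<star> g), r \<star> (f \<boxtimes> g)) \<in> E"
begin

abbreviation "Q \<equiv> quot_category C E"
abbreviation cls :: "'m \<Rightarrow> 'm set" where "cls f \<equiv> E `` {f}"

lemma K_minus_one: "\<ominus>\<^bsub>K\<^esub> \<one>\<^bsub>K\<^esub> \<in> carrier K"
proof -
  interpret K: cring K by (rule K)
  show ?thesis by simp
qed

lemma E_mor: "(f, g) \<in> E \<Longrightarrow> f \<in> Mor C X Y \<Longrightarrow> g \<in> Mor C X Y"
  using E_parallel Mor_unique by blast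

lemma cls_eqI: "(f, g) \<in> E \<Longrightarrow> cls f = cls g"
  using E_sym E_trans by blast

lemma cls_eq_iff: "g \<in> Mor C X Y \<Longrightarrow> cls f = cls g \<longleftrightarrow> (f, g) \<in> E"
  using cls_eqI E_refl by blast

lemma cls_self: "f \<in> Mor C X Y \<Longrightarrow> f \<in> cls f"
  using E_refl by blast

lemma Mor_quot: "Mor Q X Y = cls ` Mor C X Y"
  by (auto simp: quot_category_def quotient_def)

lemma cls_closed: "f \<in> Mor C X Y \<Longrightarrow> cls f \<in> Mor Q X Y"
  by (auto simp: Mor_quot)

lemma quot_simps:
  "ident Q X = cls (ident C X)" "tens_obj Q = tens_obj C" "unit_obj Q = unit_obj C"
  "mzero Q X Y = cls (mzero C X Y)"
  by (simp_all add: quot_category_def)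

lemma image_class:
  assumes "\<And>x. x \<in> S \<Longrightarrow> (f, x) \<in> E" "f \<in> S"
  shows "E `` S = cls f"
proof
  show "E `` S \<subseteq> cls f" using assms(1) E_trans by blast
  show "cls f \<subseteq> E `` S" using assms(2) by blast
qed

lemma quot_comp:
  assumes "g \<in> Mor C Y Z" "f \<in> Mor C X Y"
  shows "cls g \<cdot>\<^bsub>Q\<^esub> cls f = cls (g \<cdot> f)"
proof -
  have "E `` {g' \<cdot> f' | g' f'. g' \<in> cls g \<and> f' \<in> cls f} = cls (g \<cdot> f)"
    using cong_comp[OF assms] cls_self[OF assms(1)] cls_self[OF assms(2)]
    by (intro image_class) auto
  then show ?thesis by (simp add: quot_category_def)
qed

lemma quot_tens:
  assumes "f \<in> Mor C X Y" "g \<in> Mor C X' Y'"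
  shows "cls f \<boxtimes>\<^bsub>Q\<^esub> cls g = cls (f \<boxtimes> g)"
proof -
  have "E `` {f' \<boxtimes> g' | f' g'. f' \<in> cls f \<and> g' \<in> cls g} = cls (f \<boxtimes> g)"
    using cong_tens cls_self[OF assms(1)] cls_self[OF assms(2)]
    by (intro image_class) auto
  then show ?thesis by (simp add: quot_category_def)
qed

lemma quot_add:
  assumes "f \<in> Mor C X Y" "g \<in> Mor C X Y"
  shows "cls f \<boxplus>\<^bsub>Q\<^esub> cls g = cls (f \<boxplus> g)"
proof -
  have "E `` {f' \<boxplus> g' | f' g'. f' \<in> cls f \<and> g' \<in> cls g} = cls (f \<boxplus> g)"
    using cong_add[OF assms] cls_self[OF assms(1)] cls_self[OF assms(2)]
    by (intro image_class) auto
  then show ?thesis by (simp add: quot_category_def)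
qed

lemma quot_scale:
  assumes "r \<in> carrier K" "f \<in> Mor C X Y"
  shows "r \<star>\<^bsub>Q\<^esub> cls f = cls (r \<star> f)"
proof -
  have "E `` {r \<star> f' | f'. f' \<in> cls f} = cls (r \<star> f)"
    using cong_scale[OF assms(1)] cls_self[OF assms(2)]
    by (intro image_class) auto
  then show ?thesis by (simp add: quot_category_def)
qed

lemma Mor_quotE:
  assumes "U \<in> Mor Q X Y"
  obtains f where "f \<in> Mor C X Y" "U = cls f"
  using assms by (auto simp: Mor_quot)

text \<open>
  A representative of a composite class is the composite of representatives. Keeping track of it
  reduces each axiom for classes to the axiom modulo \<open>E\<close> for representatives.
\<close>

definition represents :: "'o \<Rightarrow> 'o \<Rightarrow> 'm \<Rightarrow> 'm set \<Rightarrow> bool"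
  where "represents X Y f U \<longleftrightarrow> f \<in> Mor C X Y \<and> U = cls f"

lemma represents_intros:
  "f \<in> Mor C X Y \<Longrightarrow> represents X Y f (cls f)"
  "represents X X (ident C X) (ident Q X)"
  "represents X Y (mzero C X Y) (mzero Q X Y)"
  "represents Y Z g V \<Longrightarrow> represents X Y f U \<Longrightarrow> represents X Z (g \<cdot> f) (V \<cdot>\<^bsub>Q\<^esub> U)"
  "represents X Y f U \<Longrightarrow> represents X' Y' g V \<Longrightarrow>
    represents (tens_obj C X X') (tens_obj C Y Y') (f \<boxtimes> g) (U \<boxtimes>\<^bsub>Q\<^esub> V)"
  "represents X Y f U \<Longrightarrow> represents X Y g V \<Longrightarrow> represents X Y (f \<boxplus> g) (U \<boxplus>\<^bsub>Q\<^esub> V)"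
  "r \<in> carrier K \<Longrightarrow> represents X Y f U \<Longrightarrow> represents X Y (r \<star> f) (r \<star>\<^bsub>Q\<^esub> U)"
  by (auto simp: represents_def quot_simps quot_comp quot_tens quot_add quot_scale
      intro: ident zero comp tens add scale)

lemma represents_mor_eqI:
  assumes "represents X Y f U" "represents X' Y' g V" "(f, g) \<in> E"
  shows "(U, V) \<in> mor_eq Q"
  using assms cls_eqI[of f g] by (auto simp: mor_eq_def Mor_quot represents_def)

lemma K_closed:
  "\<one>\<^bsub>K\<^esub> \<in> carrier K" "\<ominus>\<^bsub>K\<^esub> \<one>\<^bsub>K\<^esub> \<in> carrier K"
  "r \<in> carrier K \<Longrightarrow> q \<in> carrier K \<Longrightarrow> r \<otimes>\<^bsub>K\<^esub> q \<in> carrier K"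
  "r \<in> carrier K \<Longrightarrow> q \<in> carrier K \<Longrightarrow> r \<oplus>\<^bsub>K\<^esub> q \<in> carrier K"
proof -
  interpret K: cring K by (rule K)
  show "\<one>\<^bsub>K\<^esub> \<in> carrier K" "\<ominus>\<^bsub>K\<^esub> \<one>\<^bsub>K\<^esub> \<in> carrier K"
    "r \<in> carrier K \<Longrightarrow> q \<in> carrier K \<Longrightarrow> r \<otimes>\<^bsub>K\<^esub> q \<in> carrier K"
    "r \<in> carrier K \<Longrightarrow> q \<in> carrier K \<Longrightarrow> r \<oplus>\<^bsub>K\<^esub> q \<in> carrier K" by simp_all
qed

lemma quot_monoidal_congruence: "monoidal_congruence K Q (mor_eq Q)"
proof (rule monoidal_congruence.intro)
  show "cring K" by (rule K)
  show "X = X' \<and> Y = Y'" if f1: "f \<in> Mor Q X Y" and f2: "f \<in> Mor Q X' Y'" for f X Y X' Y'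
  proof -
    obtain g where g: "g \<in> Mor C X Y" "f = cls g" by (rule Mor_quotE[OF f1])
    obtain g' where g': "g' \<in> Mor C X' Y'" "f = cls g'" by (rule Mor_quotE[OF f2])
    have "(g, g') \<in> E" using g g' by (simp flip: cls_eq_iff)
    then show ?thesis using Mor_unique[OF E_mor g'(1)] g(1) by blast
  qed
  show "ident Q X \<in> Mor Q X X" for X
    unfolding quot_simps by (rule cls_closed[OF ident])
  show "mzero Q X Y \<in> Mor Q X Y" for X Y
    unfolding quot_simps by (rule cls_closed[OF zero])
  show "tens_obj Q (tens_obj Q X Y) Z = tens_obj Q X (tens_obj Q Y Z)" "tens_obj Q (unit_obj Q) X = X"
    "tens_obj Q X (unit_obj Q) = X" for X Y Z
    unfolding quot_simps by (fact obj_assoc obj_unit_left obj_unit_right)+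
  show "\<exists>X Y. f \<in> Mor Q X Y \<and> g \<in> Mor Q X Y" if "(f, g) \<in> mor_eq Q" for f g
    using that by (auto simp: mor_eq_def)
  show "(f, f) \<in> mor_eq Q" if "f \<in> Mor Q X Y" for f X Y
    using that by (auto simp: mor_eq_def)
  show "(g, f) \<in> mor_eq Q" if "(f, g) \<in> mor_eq Q" for f g
    using that by (auto simp: mor_eq_def)
  show "(f, h) \<in> mor_eq Q" if "(f, g) \<in> mor_eq Q" "(g, h) \<in> mor_eq Q" for f g h
    using that by (auto simp: mor_eq_def)
  show comp': "g \<cdot>\<^bsub>Q\<^esub> f \<in> Mor Q X Z" if "g \<in> Mor Q Y Z" "f \<in> Mor Q X Y" for f g X Y Z
    using that by (elim Mor_quotE) (simp add: quot_comp cls_closed comp)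
  show tens': "f \<boxtimes>\<^bsub>Q\<^esub> g \<in> Mor Q (tens_obj Q X X') (tens_obj Q Y Y')"
    if "f \<in> Mor Q X Y" "g \<in> Mor Q X' Y'" for f g X Y X' Y'
    using that by (elim Mor_quotE) (simp add: quot_simps quot_tens cls_closed tens)
  show add': "f \<boxplus>\<^bsub>Q\<^esub> g \<in> Mor Q X Y" if "f \<in> Mor Q X Y" "g \<in> Mor Q X Y" for f g X Y
    using that by (elim Mor_quotE) (simp add: quot_add cls_closed add)
  show scale': "r \<star>\<^bsub>Q\<^esub> f \<in> Mor Q X Y" if "r \<in> carrier K" "f \<in> Mor Q X Y" for r f X Y
    using that by (elim Mor_quotE) (simp add: quot_scale cls_closed scale)
  show "(g \<cdot>\<^bsub>Q\<^esub> f, g' \<cdot>\<^bsub>Q\<^esub> f') \<in> mor_eq Q"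
    if "g \<in> Mor Q Y Z" "f \<in> Mor Q X Y" "(g, g') \<in> mor_eq Q" "(f, f') \<in> mor_eq Q" for f f' g g' X Y Z
    using that comp'[OF that(1,2)] by (auto simp: mor_eq_def)
  show "(f \<boxtimes>\<^bsub>Q\<^esub> g, f' \<boxtimes>\<^bsub>Q\<^esub> g') \<in> mor_eq Q" if "(f, f') \<in> mor_eq Q" "(g, g') \<in> mor_eq Q" for f f' g g'
    using that tens' by (fastforce simp: mor_eq_def)
  show "(f \<boxplus>\<^bsub>Q\<^esub> g, f' \<boxplus>\<^bsub>Q\<^esub> g') \<in> mor_eq Q"
    if "f \<in> Mor Q X Y" "g \<in> Mor Q X Y" "(f, f') \<in> mor_eq Q" "(g, g') \<in> mor_eq Q" for f f' g g' X Y
    using that add'[OF that(1,2)] by (auto simp: mor_eq_def)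
  show "(r \<star>\<^bsub>Q\<^esub> f, r \<star>\<^bsub>Q\<^esub> f') \<in> mor_eq Q" if "r \<in> carrier K" "(f, f') \<in> mor_eq Q" for r f f'
    using that scale' by (fastforce simp: mor_eq_def)
  (* For each axiom choose representatives of the classes that occur, find representatives of both
     sides, and apply the axiom modulo E. *)
qed ((elim Mor_quotE)?, hypsubst?, (unfold quot_simps(2,3))?, rule represents_mor_eqI,
    (assumption | rule represents_intros K_closed add_assoc add_comm add_zero add_minus scale_one
      scale_mult scale_add_left scale_add_right comp_assoc comp_ident_left comp_ident_right
      comp_add_left comp_add_right comp_scale_left comp_scale_right tens_ident interchange tens_assoc
      tens_unit_left tens_unit_right tens_add_left tens_add_right tens_scale_left tens_scale_right)+)+

end

locale strict_category = monoidal_congruence K C "mor_eq C"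
  for K :: "('k, 'r) ring_scheme" and C :: "('k, 'o, 'm, 's) lin_mon_cat_scheme" (structure)
begin

lemma eqD: "(f, g) \<in> mor_eq C \<Longrightarrow> f = g"
  by (auto simp: mor_eq_def)

lemmas add_assoc' = add_assoc[THEN eqD] and add_comm' = add_comm[THEN eqD]
  and add_zero' = add_zero[THEN eqD] and add_minus' = add_minus[THEN eqD]
  and scale_one' = scale_one[THEN eqD] and scale_mult' = scale_mult[THEN eqD]
  and scale_add_left' = scale_add_left[THEN eqD] and scale_add_right' = scale_add_right[THEN eqD]
  and comp_assoc' = comp_assoc[THEN eqD] and comp_ident_left' = comp_ident_left[THEN eqD]
  and comp_ident_right' = comp_ident_right[THEN eqD] and comp_add_left' = comp_add_left[THEN eqD]
  and comp_add_right' = comp_add_right[THEN eqD] and comp_scale_left' = comp_scale_left[THEN eqD]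
  and comp_scale_right' = comp_scale_right[THEN eqD] and tens_ident' = tens_ident[THEN eqD]
  and interchange' = interchange[THEN eqD] and tens_assoc' = tens_assoc[THEN eqD]
  and tens_unit_left' = tens_unit_left[THEN eqD] and tens_unit_right' = tens_unit_right[THEN eqD]
  and tens_add_left' = tens_add_left[THEN eqD] and tens_add_right' = tens_add_right[THEN eqD]
  and tens_scale_left' = tens_scale_left[THEN eqD] and tens_scale_right' = tens_scale_right[THEN eqD]

text \<open>
  Equipping each hom-set with the record fields of a module makes the facts about linear maps
  available for composition and tensor product.
\<close>

definition hom_module :: "'o \<Rightarrow> 'o \<Rightarrow> ('k, 'm) module"
  where "hom_module X Y = \<lparr>carrier = Mor C X Y, monoid.mult = mcomp C, one = ident C X,
    zero = mzero C X Y, add = madd C, smult = mscale C\<rparr>"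

lemma hom_module_simps [simp]:
  "carrier (hom_module X Y) = Mor C X Y" "\<zero>\<^bsub>hom_module X Y\<^esub> = mzero C X Y"
  "f \<oplus>\<^bsub>hom_module X Y\<^esub> g = f \<boxplus> g" "r \<odot>\<^bsub>hom_module X Y\<^esub> f = r \<star> f"
  "f \<otimes>\<^bsub>hom_module X Y\<^esub> g = f \<cdot> g" "\<one>\<^bsub>hom_module X Y\<^esub> = ident C X"
  by (simp_all add: hom_module_def)

lemma End_algebra_eq: "End_algebra C X = hom_module X X"
  by (simp add: End_algebra_def hom_module_def)

lemma hom_module: "module K (hom_module X Y)"
proof (rule moduleI)
  show "abelian_group (hom_module X Y)"
  proof (rule abelian_groupI)
    fix f assume f: "f \<in> carrier (hom_module X Y)"
    then have f': "(\<ominus>\<^bsub>K\<^esub> \<one>\<^bsub>K\<^esub>) \<star> f \<in> Mor C X Y" by (simp add: scale[OF K_minus_one])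
    show "\<zero>\<^bsub>hom_module X Y\<^esub> \<oplus>\<^bsub>hom_module X Y\<^esub> f = f"
      using f add_comm'[OF zero, of f X Y] add_zero'[of f X Y] by simp
    show "\<exists>g \<in> carrier (hom_module X Y). g \<oplus>\<^bsub>hom_module X Y\<^esub> f = \<zero>\<^bsub>hom_module X Y\<^esub>"
      using f f' add_comm'[of f X Y "(\<ominus>\<^bsub>K\<^esub> \<one>\<^bsub>K\<^esub>) \<star> f"] add_minus'[of f X Y]
      by (intro bexI[of _ "(\<ominus>\<^bsub>K\<^esub> \<one>\<^bsub>K\<^esub>) \<star> f"]) auto
  qed (auto simp: add zero add_assoc' intro: add_comm')
qed (auto simp: K scale scale_add_left' scale_add_right' scale_mult' scale_one')

lemma hom_minus: "f \<in> Mor C X Y \<Longrightarrow> g \<in> Mor C X Y \<Longrightarrow> f \<ominus>\<^bsub>hom_module X Y\<^esub> g = f \<boxplus> (\<ominus>\<^bsub>K\<^esub> \<one>\<^bsub>K\<^esub>) \<star> g"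
proof -
  interpret H: module K "hom_module X Y" by (rule hom_module)
  show "f \<in> Mor C X Y \<Longrightarrow> g \<in> Mor C X Y \<Longrightarrow> f \<ominus>\<^bsub>hom_module X Y\<^esub> g = f \<boxplus> (\<ominus>\<^bsub>K\<^esub> \<one>\<^bsub>K\<^esub>) \<star> g"
    using H.smult_l_minus[of "\<one>\<^bsub>K\<^esub>" g] by (simp add: a_minus_def scale_one')
qed

lemma comp_linear_left: "f \<in> Mor C X Y \<Longrightarrow> linear_map K (hom_module Y Z) (hom_module X Z) (\<lambda>g. g \<cdot> f)"
  by (rule linear_mapI) (auto simp: comp comp_add_left' comp_scale_left')

lemma comp_linear_right: "g \<in> Mor C Y Z \<Longrightarrow> linear_map K (hom_module X Y) (hom_module X Z) (\<lambda>f. g \<cdot> f)"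
  by (rule linear_mapI) (auto simp: comp comp_add_right' comp_scale_right')

lemma scale_linear:
  assumes r: "r \<in> carrier K"
  shows "linear_map K (hom_module X Y) (hom_module X Y) (\<lambda>f. r \<star> f)"
proof -
  interpret K: cring K by (rule K)
  have "r \<star> q \<star> f = q \<star> r \<star> f" if "q \<in> carrier K" "f \<in> Mor C X Y" for q f
    using that r by (simp add: K.m_comm flip: scale_mult')
  then show ?thesis by (intro linear_mapI) (auto simp: r scale scale_add_right')
qed

lemma tens_linear_left: "g \<in> Mor C X' Y' \<Longrightarrow>
    linear_map K (hom_module X Y) (hom_module (tens_obj C X X') (tens_obj C Y Y')) (\<lambda>f. f \<boxtimes> g)"
  by (rule linear_mapI) (auto simp: tens tens_add_left' tens_scale_left')

lemma tens_linear_right: "g \<in> Mor C X' Y' \<Longrightarrow>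
    linear_map K (hom_module X Y) (hom_module (tens_obj C X' X) (tens_obj C Y' Y)) (\<lambda>f. g \<boxtimes> f)"
  by (rule linear_mapI) (auto simp: tens tens_add_right' tens_scale_right')

lemma End_assoc_algebra: "assoc_algebra K (End_algebra C X)"
proof -
  interpret H: module K "hom_module X X" by (rule hom_module)
  have "ring (hom_module X X)"
    by (rule ringI[OF H.abelian_group_axioms])
      (auto intro!: monoidI simp: comp ident comp_assoc' comp_ident_left' comp_ident_right'
        comp_add_left' comp_add_right')
  then show ?thesis
    unfolding End_algebra_eq
    by (intro assoc_algebra.intro hom_module assoc_algebra_axioms.intro)
      (auto simp: comp_scale_left' comp_scale_right')
qed

lemma tensor_ideal_mor: "tensor_ideal K C R X Y f \<Longrightarrow> f \<in> Mor C X Y"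
  by (induction rule: tensor_ideal.induct)
    (auto intro: add scale comp tens zero K_minus_one)

lemma ideal_congruence_iff:
  assumes "f \<in> Mor C X Y" "g \<in> Mor C X Y"
  shows "(f, g) \<in> ideal_congruence K C R \<longleftrightarrow> tensor_ideal K C R X Y (f \<ominus>\<^bsub>hom_module X Y\<^esub> g)"
  unfolding ideal_congruence_def hom_minus[OF assms] using assms Mor_unique[OF assms(1)] by blast

lemma ideal_congruenceE:
  assumes "(f, g) \<in> ideal_congruence K C R"
  obtains X Y where "f \<in> Mor C X Y" "g \<in> Mor C X Y" "tensor_ideal K C R X Y (f \<ominus>\<^bsub>hom_module X Y\<^esub> g)"
  using assms by (auto simp: ideal_congruence_def hom_minus)

lemma relation_congruent:
  "(f, g) \<in> R \<Longrightarrow> f \<in> Mor C X Y \<Longrightarrow> g \<in> Mor C X Y \<Longrightarrow> (f, g) \<in> ideal_congruence K C R"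
  by (auto simp: ideal_congruence_def intro: tensor_ideal.relation)

text \<open>
  Each operation is linear in each argument and preserves the tensor ideal in that argument, so
  congruence in one argument at a time is immediate and transitivity combines the arguments. The
  axioms hold because equal morphisms are congruent.
\<close>

lemma ideal_monoidal_congruence: "monoidal_congruence K C (ideal_congruence K C R)"
proof -
  let ?E = "ideal_congruence K C R" and ?I = "tensor_ideal K C R"
  have refl: "(f, f) \<in> ?E" if f: "f \<in> Mor C X Y" for f X Y
    using f tensor_ideal.zero[of K C R X Y] by (auto simp: ideal_congruence_def add_minus')
  have sub: "(f, g) \<in> ?E" if "(f, g) \<in> mor_eq C" for f g
    using that refl by (auto simp: mor_eq_def)
  have sym: "(g, f) \<in> ?E" if "(f, g) \<in> ?E" for f g
    using that
  proof (cases rule: ideal_congruenceE)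
    case (1 X Y)
    interpret H: module K "hom_module X Y" by (rule hom_module)
    have c: "f \<in> carrier (hom_module X Y)" "g \<in> carrier (hom_module X Y)" using 1(1,2) by auto
    have "(\<ominus>\<^bsub>K\<^esub> \<one>\<^bsub>K\<^esub>) \<odot>\<^bsub>hom_module X Y\<^esub> (f \<ominus>\<^bsub>hom_module X Y\<^esub> g) = \<ominus>\<^bsub>hom_module X Y\<^esub> (f \<ominus>\<^bsub>hom_module X Y\<^esub> g)"
      using c by (simp add: H.smult_l_minus del: hom_module_simps)
    also have "\<dots> = g \<ominus>\<^bsub>hom_module X Y\<^esub> f"
      using c by (simp add: a_minus_def H.minus_add H.a_comm del: hom_module_simps)
    finally have "(\<ominus>\<^bsub>K\<^esub> \<one>\<^bsub>K\<^esub>) \<star> (f \<ominus>\<^bsub>hom_module X Y\<^esub> g) = g \<ominus>\<^bsub>hom_module X Y\<^esub> f" by simp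
    then show ?thesis
      using tensor_ideal.scale[OF K_minus_one 1(3)] 1(1,2) by (simp add: ideal_congruence_iff)
  qed
  have trans: "(f, h) \<in> ?E" if fg: "(f, g) \<in> ?E" and gh: "(g, h) \<in> ?E" for f g h
    using fg
  proof (cases rule: ideal_congruenceE)
    case (1 X Y)
    interpret H: module K "hom_module X Y" by (rule hom_module)
    obtain X' Y' where gh': "g \<in> Mor C X' Y'" "h \<in> Mor C X' Y'" "?I X' Y' (g \<ominus>\<^bsub>hom_module X' Y'\<^esub> h)"
      using gh by (rule ideal_congruenceE)
    then have h: "h \<in> Mor C X Y" "?I X Y (g \<ominus>\<^bsub>hom_module X Y\<^esub> h)" using Mor_unique[OF 1(2) gh'(1)] by auto
    have c: "f \<in> carrier (hom_module X Y)" "g \<in> carrier (hom_module X Y)" "h \<in> carrier (hom_module X Y)"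
      using 1(1,2) h by auto
    have "(f \<ominus>\<^bsub>hom_module X Y\<^esub> g) \<oplus>\<^bsub>hom_module X Y\<^esub> (g \<ominus>\<^bsub>hom_module X Y\<^esub> h) = f \<ominus>\<^bsub>hom_module X Y\<^esub> h"
      using c by (simp add: a_minus_def H.a_assoc H.r_neg1 del: hom_module_simps)
    then have "(f \<ominus>\<^bsub>hom_module X Y\<^esub> g) \<boxplus> (g \<ominus>\<^bsub>hom_module X Y\<^esub> h) = f \<ominus>\<^bsub>hom_module X Y\<^esub> h" by simp
    then show ?thesis
      using tensor_ideal.add[OF 1(3) h(2)] 1(1) h(1) by (simp add: ideal_congruence_iff)
  qed
  have E_mor: "g \<in> Mor C X Y \<and> ?I X Y (f \<ominus>\<^bsub>hom_module X Y\<^esub> g)" if "(f, g) \<in> ?E" "f \<in> Mor C X Y" for f g X Y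
    using that Mor_unique by (elim ideal_congruenceE) blast
  have linear: "(h f, h f') \<in> ?E"
    if f: "(f, f') \<in> ?E" "f \<in> Mor C X Y" and h: "linear_map K (hom_module X Y) (hom_module X' Y') h"
      and I: "\<And>f. ?I X Y f \<Longrightarrow> ?I X' Y' (h f)" for f f' h X Y X' Y'
  proof -
    have f': "f' \<in> Mor C X Y" "?I X Y (f \<ominus>\<^bsub>hom_module X Y\<^esub> f')" using E_mor[OF f] by auto
    have "h (f \<ominus>\<^bsub>hom_module X Y\<^esub> f') = h f \<ominus>\<^bsub>hom_module X' Y'\<^esub> h f'"
      using linear_map_minus[OF hom_module hom_module h] f(2) f'(1) by simp
    then show ?thesis
      using I[OF f'(2)] linear_map_closed[OF h] f(2) f'(1)
      by (simp add: ideal_congruence_iff[of "h f" X' Y' "h f'"])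
  qed
  have comp_l: "(g \<cdot> f, g' \<cdot> f) \<in> ?E" if g: "(g, g') \<in> ?E" "g \<in> Mor C Y Z" and f: "f \<in> Mor C X Y"
    for g g' f X Y Z
    by (rule linear[OF g comp_linear_left[OF f]]) (rule tensor_ideal.comp_right[OF _ f])
  have comp_r: "(g \<cdot> f, g \<cdot> f') \<in> ?E" if f: "(f, f') \<in> ?E" "f \<in> Mor C X Y" and g: "g \<in> Mor C Y Z"
    for g f f' X Y Z
    by (rule linear[OF f comp_linear_right[OF g]]) (rule tensor_ideal.comp_left[OF g])
  have tens_l: "(f \<boxtimes> g, f' \<boxtimes> g) \<in> ?E" if f: "(f, f') \<in> ?E" "f \<in> Mor C X Y" and g: "g \<in> Mor C X' Y'"
    for f f' g X Y X' Y'
    by (rule linear[OF f tens_linear_left[OF g]]) (rule tensor_ideal.tens_right[OF _ g])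
  have tens_r: "(g \<boxtimes> f, g \<boxtimes> f') \<in> ?E" if f: "(f, f') \<in> ?E" "f \<in> Mor C X Y" and g: "g \<in> Mor C X' Y'"
    for f f' g X Y X' Y'
    by (rule linear[OF f tens_linear_right[OF g]]) (rule tensor_ideal.tens_left[OF g])
  have add_l: "(f \<boxplus> g, f' \<boxplus> g) \<in> ?E" if f: "(f, f') \<in> ?E" "f \<in> Mor C X Y" and g: "g \<in> Mor C X Y"
    for f f' g X Y
  proof -
    interpret H: module K "hom_module X Y" by (rule hom_module)
    have f': "f' \<in> Mor C X Y" "?I X Y (f \<ominus>\<^bsub>hom_module X Y\<^esub> f')" using E_mor[OF f] by auto
    have "(f \<oplus>\<^bsub>hom_module X Y\<^esub> g) \<ominus>\<^bsub>hom_module X Y\<^esub> (f' \<oplus>\<^bsub>hom_module X Y\<^esub> g) = f \<ominus>\<^bsub>hom_module X Y\<^esub> f'"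
    proof -
      have c: "f \<in> carrier (hom_module X Y)" "f' \<in> carrier (hom_module X Y)" "g \<in> carrier (hom_module X Y)"
        using f f' g by auto
      have "(f \<oplus>\<^bsub>hom_module X Y\<^esub> g) \<ominus>\<^bsub>hom_module X Y\<^esub> (f' \<oplus>\<^bsub>hom_module X Y\<^esub> g)
        = f \<oplus>\<^bsub>hom_module X Y\<^esub> (g \<oplus>\<^bsub>hom_module X Y\<^esub> (\<ominus>\<^bsub>hom_module X Y\<^esub> g \<oplus>\<^bsub>hom_module X Y\<^esub> \<ominus>\<^bsub>hom_module X Y\<^esub> f'))"
        using c by (simp add: a_minus_def H.minus_add H.a_assoc H.a_comm del: hom_module_simps)
      also have "\<dots> = f \<ominus>\<^bsub>hom_module X Y\<^esub> f'"
        using c by (simp add: a_minus_def H.r_neg2 del: hom_module_simps)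
      finally show ?thesis .
    qed
    then show ?thesis
      using f'(2) add[OF f(2) g] add[OF f'(1) g] by (simp add: ideal_congruence_iff)
  qed
  show ?thesis
  proof (rule monoidal_congruence.intro)
    show "(g \<cdot> f, g' \<cdot> f') \<in> ?E"
      if "g \<in> Mor C Y Z" "f \<in> Mor C X Y" "(g, g') \<in> ?E" "(f, f') \<in> ?E" for f f' g g' X Y Z
      using trans[OF comp_l[OF that(3,1,2)] comp_r[OF that(4,2)]] E_mor[OF that(3,1)] by blast
    show "(f \<boxtimes> g, f' \<boxtimes> g') \<in> ?E" if ff: "(f, f') \<in> ?E" and gg: "(g, g') \<in> ?E" for f f' g g'
    proof -
      obtain X Y where f: "f \<in> Mor C X Y" "f' \<in> Mor C X Y" using ff by (rule ideal_congruenceE)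
      obtain X' Y' where g: "g \<in> Mor C X' Y'" using gg by (rule ideal_congruenceE)
      show ?thesis by (rule trans[OF tens_l[OF ff f(1) g] tens_r[OF gg g f(2)]])
    qed
    show "(f \<boxplus> g, f' \<boxplus> g') \<in> ?E"
      if "f \<in> Mor C X Y" "g \<in> Mor C X Y" "(f, f') \<in> ?E" "(g, g') \<in> ?E" for f f' g g' X Y
    proof -
      have c: "f' \<in> Mor C X Y" "g' \<in> Mor C X Y" using E_mor that by blast+
      show ?thesis
        using trans[OF add_l[OF that(3,1,2)]] add_l[OF that(4,2) c(1)]
          add_comm'[OF c(1) that(2)] add_comm'[OF c] by simp
    qed
    show "(r \<star> f, r \<star> f') \<in> ?E" if r: "r \<in> carrier K" and f: "(f, f') \<in> ?E" for r f f'
    proof -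
      obtain X Y where "f \<in> Mor C X Y" by (rule ideal_congruenceE[OF f])
      then show ?thesis
        by (rule linear[OF f _ scale_linear[OF r]]) (rule tensor_ideal.scale[OF r])
    qed
    show "\<exists>X Y. f \<in> Mor C X Y \<and> g \<in> Mor C X Y" if "(f, g) \<in> ?E" for f g
      using that by (elim ideal_congruenceE) blast
    show "(f, f) \<in> ?E" if "f \<in> Mor C X Y" for f X Y by (rule refl[OF that])
    show "(g, f) \<in> ?E" if "(f, g) \<in> ?E" for f g by (rule sym[OF that])
    show "(f, h) \<in> ?E" if "(f, g) \<in> ?E" "(g, h) \<in> ?E" for f g h by (rule trans[OF that])
  qed (fact K Mor_unique ident comp tens zero add scale obj_assoc obj_unit_left obj_unit_right |
      (rule sub, fact add_assoc add_comm add_zero add_minus scale_one scale_mult scale_add_left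
        scale_add_right comp_assoc comp_ident_left comp_ident_right comp_add_left comp_add_right
        comp_scale_left comp_scale_right tens_ident interchange tens_assoc tens_unit_left
        tens_unit_right tens_add_left tens_add_right tens_scale_left tens_scale_right))+
qed

end

lemma (in monoidal_congruence) quot_strict_category: "strict_category K Q"
  unfolding strict_category_def by (rule quot_monoidal_congruence)

section \<open>Free and presented categories\<close>

inductive_cases typedE:
  "typed K \<Sigma> X Y (Gen g)" "typed K \<Sigma> X Y (Ident Z)" "typed K \<Sigma> X Y (Comp t u)"
  "typed K \<Sigma> X Y (Tens t u)" "typed K \<Sigma> X Y (Zero Z W)" "typed K \<Sigma> X Y (Add t u)"
  "typed K \<Sigma> X Y (Scale r t)"

lemma typed_unique: "typed K \<Sigma> X Y t \<Longrightarrow> typed K \<Sigma> X' Y' t \<Longrightarrow> X = X' \<and> Y = Y'"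
proof (induction arbitrary: X' Y' rule: typed.induct)
  case (typed_Comp Y Z t X u)
  from typed_Comp.prems show ?case
    by (rule typedE(3)) (use typed_Comp.IH in blast)
next
  case (typed_Tens X1 Y1 t X2 Y2 u)
  from typed_Tens.prems show ?case
    by (rule typedE(4)) (use typed_Tens.IH in blast)
next
  case (typed_Add X Y t u)
  from typed_Add.prems show ?case
    by (rule typedE(6)) (use typed_Add.IH in blast)
next
  case (typed_Scale r X Y t)
  from typed_Scale.prems show ?case
    by (rule typedE(7)) (use typed_Scale.IH in blast)
qed (blast elim: typedE)+

lemma free_eq_typed:
  assumes "cring K" "free_eq K \<Sigma> t u"
  shows "\<exists>X Y. typed K \<Sigma> X Y t \<and> typed K \<Sigma> X Y u"
proof -
  interpret K: cring K by fact
  note [intro] = typed.intros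
  show ?thesis
    using assms(2)
  proof (induction rule: free_eq.induct)
    case (trans t u v)
    then show ?case using typed_unique by blast
  next
    case (cong_Comp Y Z t X u t' u')
    then show ?case using typed_unique by blast
  next
    case (cong_Add X Y t u t' u')
    then show ?case using typed_unique by blast
  next
    case (tens_assoc X Y t X' Y' u X'' Y'' v)
    then have "typed K \<Sigma> ((X @ X') @ X'') ((Y @ Y') @ Y'') (Tens (Tens t u) v)"
      "typed K \<Sigma> (X @ X' @ X'') (Y @ Y' @ Y'') (Tens t (Tens u v))" by blast+
    then show ?case by auto
  next
    case (tens_unit_left X Y t)
    then show ?case using typed_Tens[OF typed_Ident[of K \<Sigma> "[]"] tens_unit_left] by auto
  next
    case (tens_unit_right X Y t)
    then show ?case using typed_Tens[OF tens_unit_right typed_Ident[of K \<Sigma> "[]"]] by auto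
  next
    case (add_minus X Y t)
    then show ?case using typed_Scale[of "\<ominus>\<^bsub>K\<^esub> \<one>\<^bsub>K\<^esub>"] by blast
  next
    case (scale_one X Y t)
    then show ?case using typed_Scale[of "\<one>\<^bsub>K\<^esub>"] by blast
  next
    case (scale_mult r q X Y t)
    then show ?case using typed_Scale[of "r \<otimes>\<^bsub>K\<^esub> q"] by blast
  next
    case (scale_add_left r q X Y t)
    then show ?case using typed_Scale[of "r \<oplus>\<^bsub>K\<^esub> q"] by blast
  qed (blast+)
qed

abbreviation free_rel :: "('k, 'r) ring_scheme \<Rightarrow> ('o, 'g) signature \<Rightarrow>
    (('k, 'o, 'g) mexpr \<times> ('k, 'o, 'g) mexpr) set"
  where "free_rel K \<Sigma> \<equiv> {(t, u). free_eq K \<Sigma> t u}"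

definition free_class :: "('k, 'r) ring_scheme \<Rightarrow> ('o, 'g) signature \<Rightarrow>
    ('k, 'o, 'g) mexpr \<Rightarrow> ('k, 'o, 'g) mexpr set"
  where "free_class K \<Sigma> t = free_rel K \<Sigma> `` {t}"

lemma expr_simps: "Mor (expr_category K \<Sigma>) X Y = {t. typed K \<Sigma> X Y t}"
    "ident (expr_category K \<Sigma>) = Ident" "mcomp (expr_category K \<Sigma>) = Comp"
    "tens_obj (expr_category K \<Sigma>) = (@)" "unit_obj (expr_category K \<Sigma>) = []"
    "tens (expr_category K \<Sigma>) = Tens" "mzero (expr_category K \<Sigma>) = Zero"
    "madd (expr_category K \<Sigma>) = Add" "mscale (expr_category K \<Sigma>) = Scale"
  by (simp_all add: expr_category_def)

text \<open>
  The conditions are exactly the rules that generate \<open>typed\<close> and \<open>free_eq\<close>, apart from the fact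
  that an expression determines its source and target.
\<close>

lemma expr_monoidal_congruence:
  assumes "cring K"
  shows "monoidal_congruence K (expr_category K \<Sigma>) (free_rel K \<Sigma>)"
  by (rule monoidal_congruence.intro; (unfold expr_simps mem_Collect_eq case_prod_conv)?)
    (fact assms typed_unique append_assoc append_Nil append_Nil2 free_eq_typed[OF assms] |
     fact typed.intros | fact free_eq.intros)+

lemma free_strict_category: "cring K \<Longrightarrow> strict_category K (free_category K \<Sigma>)"
  unfolding free_category_def
  by (rule monoidal_congruence.quot_strict_category[OF expr_monoidal_congruence])

lemma presented_strict_category: "cring K \<Longrightarrow> strict_category K (presented_category K \<Sigma> R)"
  unfolding presented_category_def
  by (rule monoidal_congruence.quot_strict_category[OF
        strict_category.ideal_monoidal_congruence[OF free_strict_category]])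

definition presented_mor where
  "presented_mor K \<Sigma> R t = ideal_congruence K (free_category K \<Sigma>) R `` {free_class K \<Sigma> t}"

context
  fixes K :: "('k, 'r) ring_scheme" and \<Sigma> :: "('o, 'g) signature"
    and R :: "(('k, 'o, 'g) mexpr set \<times> ('k, 'o, 'g) mexpr set) set"
  assumes K: "cring K"
begin

interpretation X: monoidal_congruence K "expr_category K \<Sigma>" "free_rel K \<Sigma>"
  by (rule expr_monoidal_congruence[OF K])

interpretation F: strict_category K "free_category K \<Sigma>"
  by (rule free_strict_category[OF K])

interpretation FI: monoidal_congruence K "free_category K \<Sigma>" "ideal_congruence K (free_category K \<Sigma>) R"
  by (rule F.ideal_monoidal_congruence)

private abbreviation (input) "pm \<equiv> presented_mor K \<Sigma> R"
private abbreviation (input) "P \<equiv> presented_category K \<Sigma> R"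
private abbreviation (input) "fc \<equiv> free_class K \<Sigma>"

lemma free_class_mor: "typed K \<Sigma> X Y t \<Longrightarrow> fc t \<in> Mor (free_category K \<Sigma>) X Y"
  using X.cls_closed[of t X Y] by (simp add: free_category_def free_class_def expr_simps)

lemma Mor_free: "Mor (free_category K \<Sigma>) X Y = fc ` {t. typed K \<Sigma> X Y t}"
  unfolding free_category_def free_class_def X.Mor_quot expr_simps ..

lemma free_class_simps:
  shows free_class_comp: "typed K \<Sigma> Y Z t \<Longrightarrow> typed K \<Sigma> X Y u \<Longrightarrow>
      fc t \<cdot>\<^bsub>free_category K \<Sigma>\<^esub> fc u = fc (Comp t u)"
    and free_class_tens: "typed K \<Sigma> X Y t \<Longrightarrow> typed K \<Sigma> X' Y' v \<Longrightarrow>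
      fc t \<boxtimes>\<^bsub>free_category K \<Sigma>\<^esub> fc v = fc (Tens t v)"
    and free_class_add: "typed K \<Sigma> X Y t \<Longrightarrow> typed K \<Sigma> X Y w \<Longrightarrow>
      fc t \<boxplus>\<^bsub>free_category K \<Sigma>\<^esub> fc w = fc (Add t w)"
    and free_class_scale: "r \<in> carrier K \<Longrightarrow> typed K \<Sigma> X Y t \<Longrightarrow>
      r \<star>\<^bsub>free_category K \<Sigma>\<^esub> fc t = fc (Scale r t)"
    and free_class_ident: "ident (free_category K \<Sigma>) W = fc (Ident W)"
    and free_class_zero: "mzero (free_category K \<Sigma>) W W' = fc (Zero W W')"
    and free_obj: "tens_obj (free_category K \<Sigma>) = (@)" "unit_obj (free_category K \<Sigma>) = []"
  unfolding free_category_def free_class_def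
  by (rule X.quot_comp[unfolded expr_simps mem_Collect_eq] X.quot_tens[unfolded expr_simps mem_Collect_eq]
      X.quot_add[unfolded expr_simps mem_Collect_eq] X.quot_scale[unfolded expr_simps mem_Collect_eq]
      X.quot_simps[unfolded expr_simps]; assumption?)+

lemma free_class_self: "typed K \<Sigma> X Y t \<Longrightarrow> t \<in> fc t"
  by (auto simp: free_class_def intro: free_eq.refl)

lemma presented_mor_simps:
  shows presented_mor_comp: "typed K \<Sigma> Y Z t \<Longrightarrow> typed K \<Sigma> X Y u \<Longrightarrow> pm t \<cdot>\<^bsub>P\<^esub> pm u = pm (Comp t u)"
    and presented_mor_tens: "typed K \<Sigma> X Y t \<Longrightarrow> typed K \<Sigma> X' Y' v \<Longrightarrow> pm t \<boxtimes>\<^bsub>P\<^esub> pm v = pm (Tens t v)"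
    and presented_mor_add: "typed K \<Sigma> X Y t \<Longrightarrow> typed K \<Sigma> X Y w \<Longrightarrow> pm t \<boxplus>\<^bsub>P\<^esub> pm w = pm (Add t w)"
    and presented_mor_scale: "r \<in> carrier K \<Longrightarrow> typed K \<Sigma> X Y t \<Longrightarrow> r \<star>\<^bsub>P\<^esub> pm t = pm (Scale r t)"
    and presented_mor_ident: "ident P W = pm (Ident W)"
    and presented_mor_zero: "mzero P W W' = pm (Zero W W')"
    and presented_obj: "tens_obj P = (@)" "unit_obj P = []"
  unfolding presented_mor_def presented_category_def
  by (simp_all only: FI.quot_comp[OF free_class_mor free_class_mor]
      FI.quot_tens[OF free_class_mor free_class_mor] FI.quot_add[OF free_class_mor free_class_mor]
      FI.quot_scale[OF _ free_class_mor] FI.quot_simps free_class_simps)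

lemma Mor_presented: "Mor P X Y = pm ` {t. typed K \<Sigma> X Y t}"
  unfolding presented_category_def FI.Mor_quot Mor_free presented_mor_def image_image ..

lemma presented_mor_closed: "typed K \<Sigma> X Y t \<Longrightarrow> pm t \<in> Mor P X Y"
  by (simp add: Mor_presented)

lemma presented_mor_eq_iff:
  assumes "typed K \<Sigma> X Y t" "typed K \<Sigma> X Y u"
  shows "pm t = pm u \<longleftrightarrow>
    tensor_ideal K (free_category K \<Sigma>) R X Y (fc (Add t (Scale (\<ominus>\<^bsub>K\<^esub> \<one>\<^bsub>K\<^esub>) u)))"
proof -
  note m = free_class_mor[OF assms(1)] free_class_mor[OF assms(2)]
  have "pm t = pm u \<longleftrightarrow> tensor_ideal K (free_category K \<Sigma>) R X Y (fc t \<ominus>\<^bsub>F.hom_module X Y\<^esub> fc u)"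
    unfolding presented_mor_def FI.cls_eq_iff[OF m(2)] F.ideal_congruence_iff[OF m] ..
  also have "fc t \<ominus>\<^bsub>F.hom_module X Y\<^esub> fc u = fc (Add t (Scale (\<ominus>\<^bsub>K\<^esub> \<one>\<^bsub>K\<^esub>) u))"
    unfolding F.hom_minus[OF m] free_class_scale[OF F.K_minus_one assms(2)]
      free_class_add[OF assms(1) typed_Scale[OF F.K_minus_one assms(2)]] ..
  finally show ?thesis .
qed

lemma presented_mor_relation:
  assumes "(fc t, fc u) \<in> R" "typed K \<Sigma> X Y t" "typed K \<Sigma> X Y u"
  shows "pm t = pm u"
  unfolding presented_mor_def
  by (rule FI.cls_eqI[OF F.relation_congruent[OF assms(1) free_class_mor free_class_mor]]) fact+

text \<open>
  Morphisms are classes of expressions, so an induction on typed expressions becomes an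
  induction on morphisms.
\<close>

lemma presented_induct [consumes 1, case_names Gen Ident Comp Tens Zero Add Scale]:
  assumes "f \<in> Mor P X Y"
    and gen: "\<And>g. g \<in> gens \<Sigma> \<Longrightarrow> Q (source \<Sigma> g) (target \<Sigma> g) (pm (Gen g))"
    and ident: "\<And>X. Q X X (ident P X)"
    and comp: "\<And>X Y Z f g. g \<in> Mor P Y Z \<Longrightarrow> f \<in> Mor P X Y \<Longrightarrow> Q Y Z g \<Longrightarrow> Q X Y f \<Longrightarrow> Q X Z (g \<cdot>\<^bsub>P\<^esub> f)"
    and tens: "\<And>X Y X' Y' f g. f \<in> Mor P X Y \<Longrightarrow> g \<in> Mor P X' Y' \<Longrightarrow> Q X Y f \<Longrightarrow> Q X' Y' g \<Longrightarrow>
      Q (X @ X') (Y @ Y') (f \<boxtimes>\<^bsub>P\<^esub> g)"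
    and zero: "\<And>X Y. Q X Y (mzero P X Y)"
    and add: "\<And>X Y f g. f \<in> Mor P X Y \<Longrightarrow> g \<in> Mor P X Y \<Longrightarrow> Q X Y f \<Longrightarrow> Q X Y g \<Longrightarrow> Q X Y (f \<boxplus>\<^bsub>P\<^esub> g)"
    and scale: "\<And>X Y r f. r \<in> carrier K \<Longrightarrow> f \<in> Mor P X Y \<Longrightarrow> Q X Y f \<Longrightarrow> Q X Y (r \<star>\<^bsub>P\<^esub> f)"
  shows "Q X Y f"
proof -
  note pc = presented_mor_closed
  have "Q X Y (pm t)" if "typed K \<Sigma> X Y t" for X Y t
    using that
  proof induction
    case (typed_Gen g)
    then show ?case by (rule gen)
  next
    case (typed_Ident X)
    show ?case using ident by (simp only: presented_mor_ident)
  next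
    case (typed_Comp Y Z t X u)
    then show ?case
      using comp[OF pc[OF typed_Comp.hyps(1)] pc[OF typed_Comp.hyps(2)] typed_Comp.IH]
      by (simp only: presented_mor_comp[OF typed_Comp.hyps])
  next
    case (typed_Tens X Y t X' Y' u)
    then show ?case
      using tens[OF pc[OF typed_Tens.hyps(1)] pc[OF typed_Tens.hyps(2)] typed_Tens.IH]
      by (simp only: presented_mor_tens[OF typed_Tens.hyps])
  next
    case (typed_Zero X Y)
    show ?case using zero by (simp only: presented_mor_zero)
  next
    case (typed_Add X Y t u)
    then show ?case
      using add[OF pc[OF typed_Add.hyps(1)] pc[OF typed_Add.hyps(2)] typed_Add.IH]
      by (simp only: presented_mor_add[OF typed_Add.hyps])
  next
    case (typed_Scale r X Y t)
    then show ?case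
      using scale[OF typed_Scale.hyps(1) pc[OF typed_Scale.hyps(2)] typed_Scale.IH]
      by (simp only: presented_mor_scale[OF typed_Scale.hyps])
  qed
  then show ?thesis using assms(1) by (auto simp: Mor_presented)
qed

end

section \<open>The relations of the wreath product category as expressions\<close>

abbreviation cross_expr :: "('k, unit, 'a wreath_gen) mexpr" where "cross_expr \<equiv> Gen Crossing"
abbreviation token_expr :: "'a \<Rightarrow> ('k, unit, 'a wreath_gen) mexpr" where "token_expr a \<equiv> Gen (Token a)"
abbreviation up_expr :: "('k, unit, 'a wreath_gen) mexpr" where "up_expr \<equiv> Ident up"

text \<open>
  The defining relations lifted from the free category to expressions, where evaluation is
  defined.
\<close>

definition relation_exprs ::
  "('k, 'r) ring_scheme \<Rightarrow> ('k, 'a, 's) module_scheme \<Rightarrow>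
    (('k, unit, 'a wreath_gen) mexpr \<times> ('k, unit, 'a wreath_gen) mexpr) set"
  where "relation_exprs K A =
    {(Comp cross_expr cross_expr, Ident (up @ up))} \<union>
    {(Comp (Comp (Tens cross_expr up_expr) (Tens up_expr cross_expr)) (Tens cross_expr up_expr),
      Comp (Comp (Tens up_expr cross_expr) (Tens cross_expr up_expr)) (Tens up_expr cross_expr))} \<union>
    {(token_expr (l \<odot>\<^bsub>A\<^esub> a \<oplus>\<^bsub>A\<^esub> m \<odot>\<^bsub>A\<^esub> b), Add (Scale l (token_expr a)) (Scale m (token_expr b))) | l m a b.
        l \<in> carrier K \<and> m \<in> carrier K \<and> a \<in> carrier A \<and> b \<in> carrier A} \<union>
    {(Comp (token_expr a) (token_expr b), token_expr (a \<otimes>\<^bsub>A\<^esub> b)) | a b. a \<in> carrier A \<and> b \<in> carrier A} \<union>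
    {(token_expr \<one>\<^bsub>A\<^esub>, up_expr)} \<union>
    {(Comp cross_expr (Tens (token_expr a) up_expr), Comp (Tens up_expr (token_expr a)) cross_expr) | a.
        a \<in> carrier A}"

lemma typed_generators:
  "typed K (wreath_signature A) [(), ()] [(), ()] cross_expr"
  "a \<in> carrier A \<Longrightarrow> typed K (wreath_signature A) up up (token_expr a)"
  using typed_Gen[of Crossing "wreath_signature A" K] typed_Gen[of "Token a" "wreath_signature A" K]
  by (auto simp: wreath_signature_def)

lemma typed_layers:
  "typed K (wreath_signature A) [(), (), ()] [(), (), ()] (Tens cross_expr up_expr)"
  "typed K (wreath_signature A) [(), (), ()] [(), (), ()] (Tens up_expr cross_expr)"
  "a \<in> carrier A \<Longrightarrow> typed K (wreath_signature A) [(), ()] [(), ()] (Tens (token_expr a) up_expr)"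
  "a \<in> carrier A \<Longrightarrow> typed K (wreath_signature A) [(), ()] [(), ()] (Tens up_expr (token_expr a))"
  using typed_Tens[OF typed_generators(1) typed_Ident[of K "wreath_signature A" up]]
    typed_Tens[OF typed_Ident[of K "wreath_signature A" up] typed_generators(1)]
    typed_Tens[OF typed_generators(2) typed_Ident[of K "wreath_signature A" up]]
    typed_Tens[OF typed_Ident[of K "wreath_signature A" up] typed_generators(2)]
  by simp_all

lemma image_pairs:
  "(\<lambda>(t, u). (g t, g u)) ` {(p x, q x) | x. P x} = {(g (p x), g (q x)) | x. P x}"
  "(\<lambda>(t, u). (g t, g u)) ` {(p' x y, q' x y) | x y. P' x y} = {(g (p' x y), g (q' x y)) | x y. P' x y}"
  "(\<lambda>(t, u). (g t, g u)) ` {(p'' w x y z, q'' w x y z) | w x y z. P'' w x y z}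
    = {(g (p'' w x y z), g (q'' w x y z)) | w x y z. P'' w x y z}"
  unfolding image_Collect by (auto simp: split_beta) blast

lemma wreath_relations_exprs:
  assumes K: "cring K" and A: "assoc_algebra K A"
  shows "wreath_relations K A =
    (\<lambda>(t, u). (free_class K (wreath_signature A) t, free_class K (wreath_signature A) u)) ` relation_exprs K A"
proof -
  let ?S = "wreath_signature A"
  let ?F = "free_category K ?S" and ?fc = "free_class K ?S"
  interpret A: ring A by (rule assoc_algebra_ring[OF A])
  have gen: "free_gen K ?S g = ?fc (Gen g)" for g by (simp add: free_gen_def free_class_def)
  note ident = free_class_ident[OF K]
  note tg = typed_generators and tl = typed_layers and ti = typed_Ident[of K ?S]
  have up2: "up @ up = [(), ()]" by simp
  have 1: "?fc cross_expr \<cdot>\<^bsub>?F\<^esub> ?fc cross_expr = ?fc (Comp cross_expr cross_expr)"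
    by (rule free_class_comp[OF K tg(1) tg(1)])
  have 2: "?fc cross_expr \<boxtimes>\<^bsub>?F\<^esub> ?fc up_expr = ?fc (Tens cross_expr up_expr)"
    "?fc up_expr \<boxtimes>\<^bsub>?F\<^esub> ?fc cross_expr = ?fc (Tens up_expr cross_expr)"
    by (rule free_class_tens[OF K tg(1) ti] free_class_tens[OF K ti tg(1)])+
  have 3: "?fc (Tens cross_expr up_expr) \<cdot>\<^bsub>?F\<^esub> ?fc (Tens up_expr cross_expr) \<cdot>\<^bsub>?F\<^esub> ?fc (Tens cross_expr up_expr)
      = ?fc (Comp (Comp (Tens cross_expr up_expr) (Tens up_expr cross_expr)) (Tens cross_expr up_expr))"
    "?fc (Tens up_expr cross_expr) \<cdot>\<^bsub>?F\<^esub> ?fc (Tens cross_expr up_expr) \<cdot>\<^bsub>?F\<^esub> ?fc (Tens up_expr cross_expr)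
      = ?fc (Comp (Comp (Tens up_expr cross_expr) (Tens cross_expr up_expr)) (Tens up_expr cross_expr))"
    unfolding free_class_comp[OF K tl(1) tl(2)] free_class_comp[OF K tl(2) tl(1)]
    by (rule free_class_comp[OF K typed_Comp[OF tl(1) tl(2)] tl(1)]
        free_class_comp[OF K typed_Comp[OF tl(2) tl(1)] tl(2)])+
  have 4: "l \<star>\<^bsub>?F\<^esub> ?fc (token_expr a) \<boxplus>\<^bsub>?F\<^esub> m \<star>\<^bsub>?F\<^esub> ?fc (token_expr b)
      = ?fc (Add (Scale l (token_expr a)) (Scale m (token_expr b)))"
    if "l \<in> carrier K" "m \<in> carrier K" "a \<in> carrier A" "b \<in> carrier A" for l m a b
    unfolding free_class_scale[OF K that(1) tg(2)[OF that(3)]] free_class_scale[OF K that(2) tg(2)[OF that(4)]]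
    by (rule free_class_add[OF K typed_Scale[OF that(1) tg(2)[OF that(3)]] typed_Scale[OF that(2) tg(2)[OF that(4)]]])
  have 5: "?fc (token_expr a) \<cdot>\<^bsub>?F\<^esub> ?fc (token_expr b) = ?fc (Comp (token_expr a) (token_expr b))"
    if "a \<in> carrier A" "b \<in> carrier A" for a b
    by (rule free_class_comp[OF K tg(2)[OF that(1)] tg(2)[OF that(2)]])
  have 6: "?fc cross_expr \<cdot>\<^bsub>?F\<^esub> (?fc (token_expr a) \<boxtimes>\<^bsub>?F\<^esub> ?fc up_expr)
      = ?fc (Comp cross_expr (Tens (token_expr a) up_expr))"
    "(?fc up_expr \<boxtimes>\<^bsub>?F\<^esub> ?fc (token_expr a)) \<cdot>\<^bsub>?F\<^esub> ?fc cross_expr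
      = ?fc (Comp (Tens up_expr (token_expr a)) cross_expr)" if "a \<in> carrier A" for a
    unfolding free_class_tens[OF K tg(2)[OF that] ti] free_class_tens[OF K ti tg(2)[OF that]]
    by (rule free_class_comp[OF K tg(1) tl(3)[OF that]] free_class_comp[OF K tl(4)[OF that] tg(1)])+
  show ?thesis
    unfolding wreath_relations_def relation_exprs_def Let_def gen ident image_Un image_pairs
    by (intro arg_cong2[where f = "(\<union>)"] Collect_cong ex_cong1 rev_conj_cong HOL.refl)
      (simp_all only: 1 2 3 4 5 6 image_insert image_empty prod.case)
qed

lemma relation_exprs_cases [consumes 1, case_names square braid linear mult one slide]:
  assumes "(t, u) \<in> relation_exprs K A"
  obtains
    "t = Comp cross_expr cross_expr" "u = Ident [(), ()]"
  | "t = Comp (Comp (Tens cross_expr up_expr) (Tens up_expr cross_expr)) (Tens cross_expr up_expr)"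
    "u = Comp (Comp (Tens up_expr cross_expr) (Tens cross_expr up_expr)) (Tens up_expr cross_expr)"
  | l m a b where "l \<in> carrier K" "m \<in> carrier K" "a \<in> carrier A" "b \<in> carrier A"
    "t = token_expr (l \<odot>\<^bsub>A\<^esub> a \<oplus>\<^bsub>A\<^esub> m \<odot>\<^bsub>A\<^esub> b)" "u = Add (Scale l (token_expr a)) (Scale m (token_expr b))"
  | a b where "a \<in> carrier A" "b \<in> carrier A" "t = Comp (token_expr a) (token_expr b)"
    "u = token_expr (a \<otimes>\<^bsub>A\<^esub> b)"
  | "t = token_expr \<one>\<^bsub>A\<^esub>" "u = up_expr"
  | a where "a \<in> carrier A" "t = Comp cross_expr (Tens (token_expr a) up_expr)"
    "u = Comp (Tens up_expr (token_expr a)) cross_expr"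
  using assms unfolding relation_exprs_def by auto

lemma relation_exprs_typed:
  assumes A: "assoc_algebra K A" and r: "(t, u) \<in> relation_exprs K A"
  obtains X where "typed K (wreath_signature A) X X t" "typed K (wreath_signature A) X X u"
proof -
  interpret A: ring A by (rule assoc_algebra_ring[OF A])
  interpret AM: module K A by (rule assoc_algebra_module[OF A])
  note tg = typed_generators and tl = typed_layers and ti = typed_Ident[of K "wreath_signature A"]
  show ?thesis
    using r
  proof (cases rule: relation_exprs_cases)
    case square
    show ?thesis by (rule that; unfold square) (rule typed_Comp[OF tg(1) tg(1)] ti)+
  next
    case braid
    show ?thesis by (rule that; unfold braid) (rule typed_Comp[OF typed_Comp[OF tl(1,2)] tl(1)] typed_Comp[OF typed_Comp[OF tl(2,1)] tl(2)])+
  next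
    case (linear l m a b)
    show ?thesis by (rule that; unfold linear) 
        (rule tg(2)[OF A.a_closed[OF AM.smult_closed[OF linear(1,3)] AM.smult_closed[OF linear(2,4)]]]
          typed_Add[OF typed_Scale[OF linear(1) tg(2)[OF linear(3)]] typed_Scale[OF linear(2) tg(2)[OF linear(4)]]])+
  next
    case (mult a b)
    show ?thesis by (rule that; unfold mult) 
        (rule typed_Comp[OF tg(2)[OF mult(1)] tg(2)[OF mult(2)]] tg(2)[OF A.m_closed[OF mult(1,2)]])+
  next
    case one
    show ?thesis by (rule that; unfold one) (rule tg(2)[OF A.one_closed] ti)+
  next
    case (slide a)
    show ?thesis by (rule that; unfold slide) (rule typed_Comp[OF tg(1) tl(3)[OF slide(1)]] typed_Comp[OF tl(4)[OF slide(1)] tg(1)])+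
  qed
qed

section \<open>Evaluation of expressions\<close>

text \<open>
  In a tensor product the second factor is placed to the right of as many strands as the first
  factor has; this is the number.
\<close>

primrec source_length :: "('k, unit, 'a wreath_gen) mexpr \<Rightarrow> nat"
  where
    "source_length (Gen g) = (case g of Crossing \<Rightarrow> 2 | Token _ \<Rightarrow> 1)"
  | "source_length (Ident X) = length X"
  | "source_length (Comp t u) = source_length u"
  | "source_length (Tens t u) = source_length t + source_length u"
  | "source_length (Zero X Y) = length X"
  | "source_length (Add t u) = source_length t"
  | "source_length (Scale r t) = source_length t"

lemma source_length_typed: "typed K (wreath_signature A) X Y t \<Longrightarrow> source_length t = length X"
  by (induction rule: typed.induct) (auto simp: wreath_signature_def split: wreath_gen.split)

context wreath_system
begin

text \<open>
  The value of an expression placed to the right of \<open>p\<close> strands. A generator that does not fit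
  on the \<open>d\<close> strands gets the value zero. In this way the axioms of a strict linear monoidal
  category hold at every position; only the defining relations need enough room.
\<close>

primrec eval :: "('k, unit, 'a wreath_gen) mexpr \<Rightarrow> nat \<Rightarrow> 'm"
  where
    "eval (Gen g) = (\<lambda>p. case g of
        Crossing \<Rightarrow> if Suc (Suc p) \<le> d then S (Suc p) else \<zero>
      | Token a \<Rightarrow> if Suc p \<le> d then \<beta> (Suc p) a else \<zero>)"
  | "eval (Ident X) = (\<lambda>p. \<one>)"
  | "eval (Comp t u) = (\<lambda>p. eval t p \<otimes> eval u p)"
  | "eval (Tens t u) = (\<lambda>p. eval t p \<otimes> eval u (p + source_length t))"
  | "eval (Zero X Y) = (\<lambda>p. \<zero>)"
  | "eval (Add t u) = (\<lambda>p. eval t p \<oplus> eval u p)"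
  | "eval (Scale r t) = (\<lambda>p. r \<odot> eval t p)"

sublocale MM: module K M by (rule assoc_algebra_module[OF M])

abbreviation "tp \<equiv> typed K (wreath_signature A)"

lemma eval_closed: "tp X Y t \<Longrightarrow> eval t p \<in> carrier M"
  by (induction arbitrary: p rule: typed.induct)
    (auto simp: wreath_signature_def intro!: C.S_closed \<beta>_closed)

text \<open>
  Generators preserve the number of strands. Hence an expression between different objects
  involves a zero morphism: if the composite has different ends, so has one of its factors, and
  similarly for tensor products.
\<close>

lemma eval_off_diagonal: "tp X Y t \<Longrightarrow> length X \<noteq> length Y \<Longrightarrow> eval t p = \<zero>"
proof (induction arbitrary: p rule: typed.induct)
  case (typed_Comp Y Z t X u)
  then show ?case
    using eval_closed[OF typed_Comp.hyps(1)] eval_closed[OF typed_Comp.hyps(2)]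
    by (cases "length X = length Y") auto
next
  case (typed_Tens X Y t X' Y' u)
  then show ?case
    using eval_closed[OF typed_Tens.hyps(1)] eval_closed[OF typed_Tens.hyps(2)]
    by (cases "length X = length Y") auto
qed (auto simp: wreath_signature_def split: wreath_gen.splits)

lemma smult_mult: "r \<in> carrier K \<Longrightarrow> x \<in> carrier M \<Longrightarrow> y \<in> carrier M \<Longrightarrow> (r \<odot> x) \<otimes> y = r \<odot> (x \<otimes> y)"
  "r \<in> carrier K \<Longrightarrow> x \<in> carrier M \<Longrightarrow> y \<in> carrier M \<Longrightarrow> x \<otimes> (r \<odot> y) = r \<odot> (x \<otimes> y)"
  using assoc_algebra.smult_mult_left[OF M] assoc_algebra.smult_mult_right[OF M] by auto

text \<open>
  The value of an expression with equally many strands at both ends is a combination of products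
  of crossings and tokens on the strands occupied; otherwise it is zero.
\<close>

lemma eval_commute:
  assumes "tp X Y t" "x \<in> carrier M"
    and "\<And>i a. p < i \<Longrightarrow> i \<le> p + length X \<Longrightarrow> i \<le> d \<Longrightarrow> a \<in> carrier A \<Longrightarrow> x \<otimes> \<beta> i a = \<beta> i a \<otimes> x"
    and "\<And>i. p < i \<Longrightarrow> Suc i \<le> p + length X \<Longrightarrow> Suc i \<le> d \<Longrightarrow> x \<otimes> S i = S i \<otimes> x"
  shows "x \<otimes> eval t p = eval t p \<otimes> x"
  using assms
proof (induction arbitrary: p rule: typed.induct)
  case (typed_Gen g)
  then show ?case by (cases g) (auto simp: wreath_signature_def)
next
  case (typed_Comp Y Z t X u)
  note c = eval_closed[OF typed_Comp.hyps(1), of p] eval_closed[OF typed_Comp.hyps(2), of p]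
  show ?case
  proof (cases "length X = length Y")
    case True
    have "x \<otimes> eval t p = eval t p \<otimes> x" by (rule typed_Comp.IH(1)) (use typed_Comp.prems True in auto)
    moreover have "x \<otimes> eval u p = eval u p \<otimes> x" by (rule typed_Comp.IH(2)) (use typed_Comp.prems in auto)
    ultimately show ?thesis using c typed_Comp.prems(1) by (simp add: M.commute_mult)
  next
    case False
    then show ?thesis
      using c typed_Comp.prems(1) eval_off_diagonal[OF typed_Comp.hyps(2)] by simp
  qed
next
  case (typed_Tens X Y t X' Y' u)
  note c = eval_closed[OF typed_Tens.hyps(1), of p] eval_closed[OF typed_Tens.hyps(2), of "p + length X"]
  have "x \<otimes> eval t p = eval t p \<otimes> x" by (rule typed_Tens.IH(1)) (use typed_Tens.prems in auto)
  moreover have "x \<otimes> eval u (p + length X) = eval u (p + length X) \<otimes> x"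
    by (rule typed_Tens.IH(2)) (use typed_Tens.prems in auto)
  ultimately show ?case
    using c typed_Tens.prems(1) by (simp add: M.commute_mult source_length_typed[OF typed_Tens.hyps(1)])
next
  case (typed_Add X Y t u)
  then show ?case
    using eval_closed[OF typed_Add.hyps(1), of p] eval_closed[OF typed_Add.hyps(2), of p]
    by (simp add: M.l_distr M.r_distr)
next
  case (typed_Scale r X Y t)
  then show ?case using eval_closed[OF typed_Scale.hyps(2), of p] by (simp add: smult_mult)
qed auto

text \<open>
  Generators on disjoint groups of strands commute; \<open>eval_commute\<close> extends this first to one
  expression and then to the other.
\<close>

lemma eval_disjoint_commute:
  assumes t: "tp X Y t" and u: "tp X' Y' u" and pq: "p + length X \<le> q"
  shows "eval t p \<otimes> eval u q = eval u q \<otimes> eval t p"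
proof (rule eval_commute[OF u eval_closed[OF t]])
  fix i a assume i: "q < i" "i \<le> d" and a: "a \<in> carrier A"
  have "\<beta> i a \<otimes> eval t p = eval t p \<otimes> \<beta> i a"
  proof (rule eval_commute[OF t \<beta>_closed])
    fix j b assume "p < j" "j \<le> p + length X" "j \<le> d" "b \<in> carrier A"
    then show "\<beta> i a \<otimes> \<beta> j b = \<beta> j b \<otimes> \<beta> i a" using i a pq by (intro \<beta>_commute') auto
  next
    fix j assume "p < j" "Suc j \<le> p + length X" "Suc j \<le> d"
    then show "\<beta> i a \<otimes> S j = S j \<otimes> \<beta> i a" using i a pq S_\<beta>_far[of j i a] by auto
  qed (use i a in auto)
  then show "eval t p \<otimes> \<beta> i a = \<beta> i a \<otimes> eval t p" by simp
next
  fix i assume i: "q < i" "Suc i \<le> d"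
  have "S i \<otimes> eval t p = eval t p \<otimes> S i"
  proof (rule eval_commute[OF t C.S_closed])
    fix j b assume "p < j" "j \<le> p + length X" "j \<le> d" "b \<in> carrier A"
    then show "S i \<otimes> \<beta> j b = \<beta> j b \<otimes> S i" using i pq by (intro S_\<beta>_far) auto
  next
    fix j assume "p < j" "Suc j \<le> p + length X" "Suc j \<le> d"
    then show "S i \<otimes> S j = S j \<otimes> S i" using i pq C.S_far[of j i] by auto
  qed (use i in auto)
  then show "eval t p \<otimes> S i = S i \<otimes> eval t p" by simp
qed

text \<open>
  All axioms but the interchange law are laws of an algebra. The interchange law is
  \<open>eval_disjoint_commute\<close> if the inner factor has equally many strands at both ends; otherwise
  this factor evaluates to zero.
\<close>

lemma free_eq_eval:
  assumes "free_eq K (wreath_signature A) t u"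
  shows "eval t p = eval u p \<and> source_length t = source_length u"
  using assms
proof (induction arbitrary: p rule: free_eq.induct)
  case (add_assoc X Y t u v)
  then show ?case by (simp add: eval_closed M.a_assoc)
next
  case (add_comm X Y t u)
  then show ?case by (simp add: eval_closed M.a_comm source_length_typed)
next
  case (add_zero X Y t)
  then show ?case by (simp add: eval_closed)
next
  case (add_minus X Y t)
  then show ?case
    using MM.smult_l_minus[of "\<one>\<^bsub>K\<^esub>" "eval t p"]
    by (simp add: eval_closed M.r_neg source_length_typed)
next
  case (comp_assoc Y Z t X u W v)
  then show ?case by (simp add: eval_closed M.m_assoc)
next
  case (interchange Y Z t X u Y' Z' t' X' u')
  note c = eval_closed[OF interchange(1)] eval_closed[OF interchange(2)]
    eval_closed[OF interchange(3)] eval_closed[OF interchange(4)]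
  note l = source_length_typed[OF interchange(1)] source_length_typed[OF interchange(2)]
  show ?case
  proof (cases "length X = length Y")
    case True
    let ?q = "p + length Y"
    have "eval t p \<otimes> eval u p \<otimes> (eval t' ?q \<otimes> eval u' ?q) = eval t p \<otimes> (eval u p \<otimes> eval t' ?q) \<otimes> eval u' ?q"
      using c by (simp add: M.m_assoc)
    also have "eval u p \<otimes> eval t' ?q = eval t' ?q \<otimes> eval u p"
      by (rule eval_disjoint_commute[OF interchange(2,3)]) (simp add: True)
    also have "eval t p \<otimes> (eval t' ?q \<otimes> eval u p) \<otimes> eval u' ?q = eval t p \<otimes> eval t' ?q \<otimes> (eval u p \<otimes> eval u' ?q)"
      using c by (simp add: M.m_assoc)
    finally show ?thesis using True by (simp add: l)
  next
    case False
    then show ?thesis using c eval_off_diagonal[OF interchange(2)] by (simp add: l)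
  qed
next
  case (tens_assoc X Y t X' Y' u X'' Y'' v)
  then show ?case by (simp add: eval_closed M.m_assoc add.assoc)
next
  case (cong_Comp Y Z t X u t' u')
  then show ?case by simp
next
  case (cong_Tens t t' u u')
  then show ?case by simp
next
  case (cong_Add X Y t u t' u')
  then show ?case by simp
next
  case (cong_Scale r t t')
  then show ?case by simp
next
  case (trans t u v)
  then show ?case by metis
next
  case (sym t u)
  then show ?case by metis
qed (simp_all add: eval_closed MM.smult_assoc1 MM.smult_l_distr MM.smult_r_distr M.l_distr M.r_distr
      smult_mult source_length_typed)

lemma relation_eval:
  assumes "(t, u) \<in> relation_exprs K A" "p + source_length t \<le> d"
  shows "eval t p = eval u p"
  using assms(1)
proof (cases rule: relation_exprs_cases)
  case square
  then show ?thesis using assms(2) C.S_square[of "Suc p"] by simp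
next
  case braid
  let ?i = "Suc p"
  have b: "?i < d" "Suc ?i < d" using assms(2) by (simp_all add: braid)
  then have c: "S ?i \<in> carrier M" "S (Suc ?i) \<in> carrier M" by (auto intro!: C.S_closed)
  show ?thesis
    using b c C.S_braid[of ?i] by (simp add: braid M.m_assoc)
next
  case (linear l m a b)
  then show ?thesis
    using assms(2) linear_mapD[OF \<beta>_linear[of "Suc p"]] assoc_algebra_module[OF A]
    by (simp add: module.smult_closed)
next
  case (mult a b)
  then show ?thesis using assms(2) \<beta>_mult[of "Suc p" a b] by simp
next
  case one
  then show ?thesis using assms(2) \<beta>_one[of "Suc p"] by simp
next
  case (slide a)
  have p: "1 \<le> Suc p" "Suc p < d" using assms(2) by (simp_all add: slide)
  then have c: "S (Suc p) \<in> carrier M" "\<beta> (Suc p) a \<in> carrier M" "\<beta> (Suc (Suc p)) a \<in> carrier M"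
    using slide by (auto intro!: C.S_closed \<beta>_closed)
  show ?thesis using p c S_\<beta>[OF p slide(1)] by (simp add: slide)
qed

definition eval_class :: "('k, unit, 'a wreath_gen) mexpr set \<Rightarrow> nat \<Rightarrow> 'm"
  where "eval_class f p = eval (SOME t. t \<in> f) p"

lemma eval_class_eq:
  assumes "tp X Y t"
  shows "eval_class (free_class K (wreath_signature A) t) p = eval t p"
proof -
  have "t \<in> free_class K (wreath_signature A) t" by (rule free_class_self[OF K assms])
  then have "(SOME u. u \<in> free_class K (wreath_signature A) t) \<in> free_class K (wreath_signature A) t"
    by (rule someI)
  then show ?thesis unfolding eval_class_def using free_eq_eval by (auto simp: free_class_def)
qed

text \<open>
  The bound on the position is necessary: near the right end the crossing evaluates to zero
  while the identity evaluates to one, although the crossing squares to the identity. A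
  composite through an object of another length inherits the property because one of its factors
  evaluates to zero.
\<close>

lemma tensor_ideal_eval:
  assumes "tensor_ideal K (free_category K (wreath_signature A)) (wreath_relations K A) X Y f"
    and "p + length X \<le> d"
  shows "eval_class f p = \<zero>"
proof -
  interpret F: strict_category K "free_category K (wreath_signature A)"
    by (rule free_strict_category[OF K])
  let ?F = "free_category K (wreath_signature A)" and ?fc = "free_class K (wreath_signature A)"
  have MorE: thesis if "f \<in> Mor ?F X Y" "\<And>t. tp X Y t \<Longrightarrow> f = ?fc t \<Longrightarrow> thesis" for f X Y thesis
    using that by (auto simp: Mor_free[OF K])
  note I_mor = F.tensor_ideal_mor
  show ?thesis
    using assms
  proof (induction arbitrary: p rule: tensor_ideal.induct)
    case (relation f g X Y)
    then obtain t u where tu: "(t, u) \<in> relation_exprs K A" "f = ?fc t" "g = ?fc u"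
      by (auto simp: wreath_relations_exprs[OF K A])
    obtain Z where Z: "tp Z Z t" "tp Z Z u" by (rule relation_exprs_typed[OF A tu(1)])
    then have XY: "X = Z" "Y = Z"
      using F.Mor_unique[OF relation(2)] free_class_mor[OF K Z(1)] tu(2) by blast+
    have ts: "tp Z Z (Scale (\<ominus>\<^bsub>K\<^esub> \<one>\<^bsub>K\<^esub>) u)" by (rule typed_Scale[OF F.K_minus_one Z(2)])
    have "eval_class (f \<boxplus>\<^bsub>?F\<^esub> (\<ominus>\<^bsub>K\<^esub> \<one>\<^bsub>K\<^esub>) \<star>\<^bsub>?F\<^esub> g) p = eval t p \<oplus> (\<ominus>\<^bsub>K\<^esub> \<one>\<^bsub>K\<^esub>) \<odot> eval u p"
      unfolding tu free_class_scale[OF K F.K_minus_one Z(2)] free_class_add[OF K Z(1) ts]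
        eval_class_eq[OF typed_Add[OF Z(1) ts]] by simp
    also have "eval t p = eval u p"
      using relation.prems by (intro relation_eval[OF tu(1)]) (simp add: XY source_length_typed[OF Z(1)])
    also have "eval u p \<oplus> (\<ominus>\<^bsub>K\<^esub> \<one>\<^bsub>K\<^esub>) \<odot> eval u p = \<zero>"
      using MM.smult_l_minus[of "\<one>\<^bsub>K\<^esub>" "eval u p"] by (simp add: eval_closed[OF Z(2)] M.r_neg)
    finally show ?case .
  next
    case (zero X Y)
    show ?case by (simp add: free_class_zero[OF K] eval_class_eq[OF typed_Zero])
  next
    case (add X Y f g)
    obtain t where t: "tp X Y t" "f = ?fc t" by (rule MorE[OF I_mor[OF add.hyps(1)]])
    obtain u where u: "tp X Y u" "g = ?fc u" by (rule MorE[OF I_mor[OF add.hyps(2)]])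
    have "eval t p = \<zero>" "eval u p = \<zero>"
      using add.IH(1)[OF add.prems] add.IH(2)[OF add.prems]
      by (simp_all add: t u eval_class_eq[OF t(1)] eval_class_eq[OF u(1)])
    then show ?case by (simp add: t(2) u(2) free_class_add[OF K t(1) u(1)] eval_class_eq[OF typed_Add[OF t(1) u(1)]])
  next
    case (scale r X Y f)
    obtain t where t: "tp X Y t" "f = ?fc t" by (rule MorE[OF I_mor[OF scale.hyps(2)]])
    have "eval t p = \<zero>" using scale.IH[OF scale.prems] by (simp add: t eval_class_eq[OF t(1)])
    then show ?case
      using scale.hyps(1)
      by (simp add: t(2) free_class_scale[OF K scale.hyps(1) t(1)]
          eval_class_eq[OF typed_Scale[OF scale.hyps(1) t(1)]])
  next
    case (comp_left g Y Z X f)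
    obtain t where t: "tp Y Z t" "g = ?fc t" by (rule MorE[OF comp_left.hyps(1)])
    obtain u where u: "tp X Y u" "f = ?fc u" by (rule MorE[OF I_mor[OF comp_left.hyps(2)]])
    have "eval u p = \<zero>" using comp_left.IH[OF comp_left.prems] by (simp add: u eval_class_eq[OF u(1)])
    then show ?case
      by (simp add: t(2) u(2) free_class_comp[OF K t(1) u(1)] eval_class_eq[OF typed_Comp[OF t(1) u(1)]]
          eval_closed[OF t(1)])
  next
    case (comp_right Y Z f g X)
    obtain t where t: "tp Y Z t" "f = ?fc t" by (rule MorE[OF I_mor[OF comp_right.hyps(1)]])
    obtain u where u: "tp X Y u" "g = ?fc u" by (rule MorE[OF comp_right.hyps(2)])
    have "eval t p \<otimes> eval u p = \<zero>"
    proof (cases "length X = length Y")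
      case True
      then have "eval t p = \<zero>"
        using comp_right.IH comp_right.prems by (simp add: t eval_class_eq[OF t(1)])
      then show ?thesis using eval_closed[OF u(1)] by simp
    next
      case False
      then show ?thesis using eval_off_diagonal[OF u(1)] eval_closed[OF t(1)] by simp
    qed
    then show ?case
      by (simp add: t(2) u(2) free_class_comp[OF K t(1) u(1)] eval_class_eq[OF typed_Comp[OF t(1) u(1)]])
  next
    case (tens_left g X' Y' X Y f)
    obtain t where t: "tp X' Y' t" "g = ?fc t" by (rule MorE[OF tens_left.hyps(1)])
    obtain u where u: "tp X Y u" "f = ?fc u" by (rule MorE[OF I_mor[OF tens_left.hyps(2)]])
    have "p + length X' + length X \<le> d" using tens_left.prems by (simp add: free_obj[OF K])
    then have "eval u (p + length X') = \<zero>" using tens_left.IH by (simp add: u eval_class_eq[OF u(1)])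
    then show ?case
      by (simp add: t(2) u(2) free_class_tens[OF K t(1) u(1)] eval_class_eq[OF typed_Tens[OF t(1) u(1)]]
          eval_closed[OF t(1)] source_length_typed[OF t(1)])
  next
    case (tens_right X Y f g X' Y')
    obtain t where t: "tp X Y t" "f = ?fc t" by (rule MorE[OF I_mor[OF tens_right.hyps(1)]])
    obtain u where u: "tp X' Y' u" "g = ?fc u" by (rule MorE[OF tens_right.hyps(2)])
    have "p + length X \<le> d" using tens_right.prems by (simp add: free_obj[OF K])
    then have "eval t p = \<zero>" using tens_right.IH by (simp add: t eval_class_eq[OF t(1)])
    then show ?case
      by (simp add: t(2) u(2) free_class_tens[OF K t(1) u(1)] eval_class_eq[OF typed_Tens[OF t(1) u(1)]]
          eval_closed[OF u(1)])
  qed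
qed

abbreviation (input) "wm \<equiv> presented_mor K (wreath_signature A) (wreath_relations K A)"

lemma presented_eval:
  assumes t: "tp X Y t" and u: "tp X Y u" and eq: "wm t = wm u" and p: "p + length X \<le> d"
  shows "eval t p = eval u p"
proof -
  interpret F: strict_category K "free_category K (wreath_signature A)"
    by (rule free_strict_category[OF K])
  have "tp X Y (Add t (Scale (\<ominus>\<^bsub>K\<^esub> \<one>\<^bsub>K\<^esub>) u))"
    by (rule typed_Add[OF t typed_Scale[OF F.K_minus_one u]])
  then have "eval (Add t (Scale (\<ominus>\<^bsub>K\<^esub> \<one>\<^bsub>K\<^esub>) u)) p = \<zero>"
    using tensor_ideal_eval[OF _ p] eq presented_mor_eq_iff[OF K t u] eval_class_eq by metis
  then have "eval t p \<oplus> \<ominus> eval u p = \<zero>"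
    using MM.smult_l_minus[of "\<one>\<^bsub>K\<^esub>" "eval u p"] by (simp add: eval_closed[OF u])
  then show ?thesis
    using eval_closed[OF t] eval_closed[OF u] by (metis M.minus_equality M.minus_minus M.a_inv_closed M.a_comm)
qed

text \<open>
  The source and target of an expression are determined by the morphism that it represents, and
  the value does not depend on the expression as long as there are at most \<open>d\<close> strands.
\<close>

definition eval_mor :: "('k, unit, 'a wreath_gen) mexpr set set \<Rightarrow> 'm"
  where "eval_mor f = eval (SOME t. (\<exists>X Y. tp X Y t) \<and> wm t = f) 0"

lemma eval_mor_eq:
  assumes t: "tp X Y t" and X: "length X \<le> d"
  shows "eval_mor (wm t) = eval t 0"
proof -
  interpret P: strict_category K "presented_category K (wreath_signature A) (wreath_relations K A)"
    by (rule presented_strict_category[OF K])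
  define u where "u = (SOME u. (\<exists>X Y. tp X Y u) \<and> wm u = wm t)"
  have "(\<exists>X Y. tp X Y u) \<and> wm u = wm t" unfolding u_def by (rule someI[of _ t]) (use t in blast)
  then obtain X' Y' where u: "tp X' Y' u" "wm u = wm t" by blast
  have "X' = X \<and> Y' = Y"
    using P.Mor_unique presented_mor_closed[OF K t] presented_mor_closed[OF K u(1)] u(2) by metis
  then show ?thesis
    using presented_eval[OF _ t u(2), of 0] u(1) X by (simp add: eval_mor_def u_def)
qed

end

section \<open>Padding morphisms by identities\<close>

context strict_category
begin

abbreviation (input) "ob \<equiv> tens_obj C"

definition pad :: "'o \<Rightarrow> 'm \<Rightarrow> 'o \<Rightarrow> 'm"
  where "pad L f R = ident C L \<boxtimes> f \<boxtimes> ident C R"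

lemma pad_closed: "f \<in> Mor C X Y \<Longrightarrow> pad L f R \<in> Mor C (ob (ob L X) R) (ob (ob L Y) R)"
  unfolding pad_def by (intro tens ident)

lemma pad_ident: "pad L (ident C X) R = ident C (ob (ob L X) R)"
  unfolding pad_def by (simp add: tens_ident')

lemma pad_comp:
  assumes g: "g \<in> Mor C Y Z" and f: "f \<in> Mor C X Y"
  shows "pad L g R \<cdot> pad L f R = pad L (g \<cdot> f) R"
  unfolding pad_def interchange'[OF tens[OF ident g] tens[OF ident f] ident ident, symmetric]
    interchange'[OF ident ident g f, symmetric] comp_ident_left'[OF ident] ..

lemma pad_linear: "linear_map K (hom_module X Y) (hom_module (ob (ob L X) R) (ob (ob L Y) R)) (\<lambda>f. pad L f R)"
  unfolding pad_def by (rule linear_map_comp[OF tens_linear_right[OF ident] tens_linear_left[OF ident]])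

lemma pad_tens_ident:
  assumes f: "f \<in> Mor C X Y"
  shows "pad L (f \<boxtimes> ident C Z) R = pad L f (ob Z R)"
    and "pad L (ident C Z \<boxtimes> f) R = pad (ob L Z) f R"
proof -
  show "pad L (f \<boxtimes> ident C Z) R = pad L f (ob Z R)"
    unfolding pad_def tens_assoc'[OF ident f ident, symmetric]
      tens_assoc'[OF tens[OF ident f] ident ident] tens_ident' ..
  show "pad L (ident C Z \<boxtimes> f) R = pad (ob L Z) f R"
    unfolding pad_def tens_assoc'[OF ident ident f, symmetric] tens_ident' ..
qed

text \<open>
  The two orders in which the factors of a tensor product can be applied.
\<close>

lemma pad_tens:
  assumes f: "f \<in> Mor C X Y" and g: "g \<in> Mor C X' Y'"
  shows "pad L (f \<boxtimes> g) R = pad L f (ob Y' R) \<cdot> pad (ob L X) g R"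
    and "pad L (f \<boxtimes> g) R = pad (ob L Y) g R \<cdot> pad L f (ob X' R)"
proof -
  have "f \<boxtimes> g = (f \<boxtimes> ident C Y') \<cdot> (ident C X \<boxtimes> g)" "f \<boxtimes> g = (ident C Y \<boxtimes> g) \<cdot> (f \<boxtimes> ident C X')"
    unfolding interchange'[OF f ident ident g, symmetric] interchange'[OF ident f g ident, symmetric]
      comp_ident_left'[OF f] comp_ident_right'[OF f] comp_ident_left'[OF g] comp_ident_right'[OF g]
    by (rule HOL.refl)+
  then show "pad L (f \<boxtimes> g) R = pad L f (ob Y' R) \<cdot> pad (ob L X) g R"
    "pad L (f \<boxtimes> g) R = pad (ob L Y) g R \<cdot> pad L f (ob X' R)"
    by (metis pad_comp[OF tens[OF f ident] tens[OF ident g]] pad_tens_ident[OF f] pad_tens_ident[OF g])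
      (metis \<open>f \<boxtimes> g = (ident C Y \<boxtimes> g) \<cdot> (f \<boxtimes> ident C X')\<close> pad_comp[OF tens[OF ident g] tens[OF f ident]] pad_tens_ident[OF f] pad_tens_ident[OF g])
qed

lemma pad_commute:
  assumes f: "f \<in> Mor C X X" and g: "g \<in> Mor C Z Z"
  shows "pad L f (ob (ob N Z) R) \<cdot> pad (ob (ob L X) N) g R = pad (ob (ob L X) N) g R \<cdot> pad L f (ob (ob N Z) R)"
  using pad_tens[OF f tens[OF ident g], of L N R] pad_tens_ident(2)[OF g, of "ob L X" N R] by simp

end

section \<open>The endomorphism algebra of a tensor power of the generating object\<close>

abbreviation ups :: "nat \<Rightarrow> unit list" where "ups n \<equiv> replicate n ()"

lemma unit_list_eq_iff: "(X :: unit list) = Y \<longleftrightarrow> length X = length Y"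
  by (induction X Y rule: list_induct2') auto

context
  fixes K :: "('k, 'r) ring_scheme" and A :: "('k, 'a, 's) module_scheme" and d :: nat
  assumes K: "cring K" and A: "assoc_algebra K A"
begin

private abbreviation (input) "Sg \<equiv> wreath_signature A"
private abbreviation (input) "C \<equiv> wreath_category K A"
private abbreviation (input) "wpm \<equiv> presented_mor K Sg (wreath_relations K A)"

interpretation C: strict_category K C
  unfolding wreath_category_def by (rule presented_strict_category[OF K])

interpretation A: ring A by (rule assoc_algebra_ring[OF A])
interpretation AM: module K A by (rule assoc_algebra_module[OF A])

lemma wreath_tens_obj: "tens_obj C = (@)" "unit_obj C = []"
  unfolding wreath_category_def by (rule presented_obj[OF K])+

lemma obj_power_ups: "obj_power C up d = ups d"
proof -
  have "((@) up ^^ n) [] = ups n" for n by (induction n) auto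
  then show ?thesis by (simp add: obj_power_def wreath_tens_obj)
qed

private abbreviation (input) "E \<equiv> End_algebra C (ups d)"

definition cross :: "('k, unit, 'a wreath_gen) mexpr set set" where "cross = wpm cross_expr"
definition token :: "'a \<Rightarrow> ('k, unit, 'a wreath_gen) mexpr set set" where "token a = wpm (token_expr a)"

lemma cross_mor: "cross \<in> Mor C [(), ()] [(), ()]"
  unfolding cross_def wreath_category_def by (rule presented_mor_closed[OF K typed_generators(1)])

lemma token_mor: "a \<in> carrier A \<Longrightarrow> token a \<in> Mor C up up"
  unfolding token_def wreath_category_def by (rule presented_mor_closed[OF K typed_generators(2)])

lemma relation_holds:
  assumes "(t, u) \<in> relation_exprs K A"
  shows "wpm t = wpm u"
proof -
  obtain X where X: "typed K Sg X X t" "typed K Sg X X u" by (rule relation_exprs_typed[OF A assms])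
  show ?thesis
    by (rule presented_mor_relation[OF K _ X]) (use assms in \<open>auto simp: wreath_relations_exprs[OF K A]\<close>)
qed

lemma pm_comp: "typed K Sg Y Z t \<Longrightarrow> typed K Sg X Y u \<Longrightarrow> wpm (Comp t u) = wpm t \<cdot>\<^bsub>C\<^esub> wpm u"
  and pm_tens: "typed K Sg X Y t \<Longrightarrow> typed K Sg X' Y' v \<Longrightarrow> wpm (Tens t v) = wpm t \<boxtimes>\<^bsub>C\<^esub> wpm v"
  and pm_add: "typed K Sg X Y t \<Longrightarrow> typed K Sg X Y w \<Longrightarrow> wpm (Add t w) = wpm t \<boxplus>\<^bsub>C\<^esub> wpm w"
  and pm_scale: "r \<in> carrier K \<Longrightarrow> typed K Sg X Y t \<Longrightarrow> wpm (Scale r t) = r \<star>\<^bsub>C\<^esub> wpm t"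
  and pm_ident: "wpm (Ident W) = ident C W"
  unfolding wreath_category_def
  by (rule presented_mor_simps[OF K, symmetric]; assumption)+

lemma cross_square: "cross \<cdot>\<^bsub>C\<^esub> cross = ident C [(), ()]"
proof -
  have "wpm (Comp cross_expr cross_expr) = wpm (Ident (up @ up))"
    by (rule relation_holds) (simp add: relation_exprs_def)
  then show ?thesis
    by (simp add: pm_comp[OF typed_generators(1) typed_generators(1)] pm_ident cross_def)
qed

lemma cross_layers:
  "wpm (Tens cross_expr up_expr) = cross \<boxtimes>\<^bsub>C\<^esub> ident C up"
  "wpm (Tens up_expr cross_expr) = ident C up \<boxtimes>\<^bsub>C\<^esub> cross"
  unfolding cross_def pm_ident[symmetric]
  by (rule pm_tens[OF typed_generators(1) typed_Ident] pm_tens[OF typed_Ident typed_generators(1)])+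

lemma token_layers:
  assumes "a \<in> carrier A"
  shows "wpm (Tens (token_expr a) up_expr) = token a \<boxtimes>\<^bsub>C\<^esub> ident C up"
    "wpm (Tens up_expr (token_expr a)) = ident C up \<boxtimes>\<^bsub>C\<^esub> token a"
  unfolding token_def pm_ident[symmetric]
  by (rule pm_tens[OF typed_generators(2)[OF assms] typed_Ident] pm_tens[OF typed_Ident typed_generators(2)[OF assms]])+

lemma cross_braid:
  "(cross \<boxtimes>\<^bsub>C\<^esub> ident C up) \<cdot>\<^bsub>C\<^esub> (ident C up \<boxtimes>\<^bsub>C\<^esub> cross) \<cdot>\<^bsub>C\<^esub> (cross \<boxtimes>\<^bsub>C\<^esub> ident C up)
    = (ident C up \<boxtimes>\<^bsub>C\<^esub> cross) \<cdot>\<^bsub>C\<^esub> (cross \<boxtimes>\<^bsub>C\<^esub> ident C up) \<cdot>\<^bsub>C\<^esub> (ident C up \<boxtimes>\<^bsub>C\<^esub> cross)"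
proof -
  note tl = typed_layers(1,2)[of K A]
  have "wpm (Comp (Comp (Tens cross_expr up_expr) (Tens up_expr cross_expr)) (Tens cross_expr up_expr))
      = wpm (Comp (Comp (Tens up_expr cross_expr) (Tens cross_expr up_expr)) (Tens up_expr cross_expr))"
    by (rule relation_holds) (simp add: relation_exprs_def)
  then show ?thesis
    unfolding pm_comp[OF typed_Comp[OF tl] tl(1)] pm_comp[OF typed_Comp[OF tl(2,1)] tl(2)]
      pm_comp[OF tl] pm_comp[OF tl(2,1)] cross_layers .
qed

lemma token_combination:
  assumes "l \<in> carrier K" "m \<in> carrier K" "a \<in> carrier A" "b \<in> carrier A"
  shows "token (l \<odot>\<^bsub>A\<^esub> a \<oplus>\<^bsub>A\<^esub> m \<odot>\<^bsub>A\<^esub> b) = l \<star>\<^bsub>C\<^esub> token a \<boxplus>\<^bsub>C\<^esub> m \<star>\<^bsub>C\<^esub> token b"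
proof -
  note tg = typed_generators(2)[of _ A K]
  have "wpm (token_expr (l \<odot>\<^bsub>A\<^esub> a \<oplus>\<^bsub>A\<^esub> m \<odot>\<^bsub>A\<^esub> b)) = wpm (Add (Scale l (token_expr a)) (Scale m (token_expr b)))"
    by (rule relation_holds) (use assms in \<open>auto simp: relation_exprs_def\<close>)
  then show ?thesis
    unfolding token_def
      pm_add[OF typed_Scale[OF assms(1) tg[OF assms(3)]] typed_Scale[OF assms(2) tg[OF assms(4)]]]
      pm_scale[OF assms(1) tg[OF assms(3)]] pm_scale[OF assms(2) tg[OF assms(4)]] .
qed

lemma token_linear: "linear_map K A (C.hom_module up up) token"
proof (rule linear_mapI)
  show "token x \<in> carrier (C.hom_module up up)" if "x \<in> carrier A" for x
    using token_mor[OF that] by simp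
  show "token (x \<oplus>\<^bsub>A\<^esub> y) = token x \<oplus>\<^bsub>C.hom_module up up\<^esub> token y" if "x \<in> carrier A" "y \<in> carrier A" for x y
    using token_combination[OF AM.R.one_closed AM.R.one_closed that] that
    by (simp add: C.scale_one'[OF token_mor])
  show "token (r \<odot>\<^bsub>A\<^esub> x) = r \<odot>\<^bsub>C.hom_module up up\<^esub> token x" if "r \<in> carrier K" "x \<in> carrier A" for r x
  proof -
    interpret H: module K "C.hom_module up up" by (rule C.hom_module)
    have "token (r \<odot>\<^bsub>A\<^esub> x) = token (r \<odot>\<^bsub>A\<^esub> x \<oplus>\<^bsub>A\<^esub> \<zero>\<^bsub>K\<^esub> \<odot>\<^bsub>A\<^esub> x)" using that by simp
    also have "\<dots> = r \<odot>\<^bsub>C.hom_module up up\<^esub> token x \<oplus>\<^bsub>C.hom_module up up\<^esub> \<zero>\<^bsub>K\<^esub> \<odot>\<^bsub>C.hom_module up up\<^esub> token x"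
      using token_combination[OF that(1) AM.R.zero_closed that(2,2)] by simp
    also have "\<dots> = r \<odot>\<^bsub>C.hom_module up up\<^esub> token x"
      using token_mor[OF that(2)] that(1) H.smult_l_null[of "token x"] H.smult_closed[of r "token x"]
        H.r_zero[of "r \<odot>\<^bsub>C.hom_module up up\<^esub> token x"] by simp
    finally show ?thesis .
  qed
qed

lemma token_mult:
  assumes "a \<in> carrier A" "b \<in> carrier A"
  shows "token a \<cdot>\<^bsub>C\<^esub> token b = token (a \<otimes>\<^bsub>A\<^esub> b)"
proof -
  have "wpm (Comp (token_expr a) (token_expr b)) = wpm (token_expr (a \<otimes>\<^bsub>A\<^esub> b))"
    by (rule relation_holds) (use assms in \<open>auto simp: relation_exprs_def\<close>)
  then show ?thesis
    unfolding token_def pm_comp[OF typed_generators(2)[OF assms(1)] typed_generators(2)[OF assms(2)]] .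
qed

lemma token_one: "token \<one>\<^bsub>A\<^esub> = ident C up"
  unfolding token_def pm_ident[symmetric]
  by (rule relation_holds) (simp add: relation_exprs_def)

lemma cross_token:
  assumes "a \<in> carrier A"
  shows "cross \<cdot>\<^bsub>C\<^esub> (token a \<boxtimes>\<^bsub>C\<^esub> ident C up) = (ident C up \<boxtimes>\<^bsub>C\<^esub> token a) \<cdot>\<^bsub>C\<^esub> cross"
proof -
  have "wpm (Comp cross_expr (Tens (token_expr a) up_expr)) = wpm (Comp (Tens up_expr (token_expr a)) cross_expr)"
    by (rule relation_holds) (use assms in \<open>auto simp: relation_exprs_def\<close>)
  then show ?thesis
    unfolding pm_comp[OF typed_generators(1) typed_layers(3)[OF assms]]
      pm_comp[OF typed_layers(4)[OF assms] typed_generators(1)] token_layers[OF assms] cross_def .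
qed

text \<open>
  The crossing of the strands \<open>i\<close> and \<open>i + 1\<close>, and a token on strand \<open>i\<close>. Strands are numbered
  from one, so that \<open>i - 1\<close> strands lie to the left.
\<close>

definition strand_cross where "strand_cross i = C.pad (ups (i - 1)) cross (ups (d - i - 1))"
definition strand_token where "strand_token i a = C.pad (ups (i - 1)) (token a) (ups (d - i))"

lemma End_simps:
  "carrier E = Mor C (ups d) (ups d)" "f \<otimes>\<^bsub>E\<^esub> g = f \<cdot>\<^bsub>C\<^esub> g" "\<one>\<^bsub>E\<^esub> = ident C (ups d)"
  "f \<oplus>\<^bsub>E\<^esub> g = f \<boxplus>\<^bsub>C\<^esub> g" "r \<odot>\<^bsub>E\<^esub> f = r \<star>\<^bsub>C\<^esub> f" "\<zero>\<^bsub>E\<^esub> = mzero C (ups d) (ups d)"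
  by (simp_all add: End_algebra_def)

lemma pad_End:
  assumes "f \<in> Mor C X X" "length L + length X + length R = d"
  shows "C.pad L f R \<in> Mor C (ups d) (ups d)"
proof -
  have "(L @ X) @ R = ups d" using assms(2) by (simp add: unit_list_eq_iff)
  then show ?thesis using C.pad_closed[OF assms(1), of L R] by (simp add: wreath_tens_obj)
qed

lemma pad_cong:
  "length L = length L' \<Longrightarrow> length R = length R' \<Longrightarrow> C.pad L f R = C.pad L' f R'"
  by (metis unit_list_eq_iff)

text \<open>
  The object between the two morphisms and the remaining objects are determined by their
  lengths, as all objects are words in a single letter.
\<close>

lemma pads_commute:
  assumes f: "f \<in> Mor C X X" and g: "g \<in> Mor C Z Z"
    and "length L + length X \<le> length L'" "length L + length X + length R = d"
      "length L' + length Z + length R' = d"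
  shows "C.pad L f R \<cdot>\<^bsub>C\<^esub> C.pad L' g R' = C.pad L' g R' \<cdot>\<^bsub>C\<^esub> C.pad L f R"
proof -
  let ?N = "ups (length L' - (length L + length X))"
  have R: "R = (?N @ Z) @ R'" and L': "L' = (L @ X) @ ?N"
    using assms(3-5) by (simp_all add: unit_list_eq_iff)
  show ?thesis
    using C.pad_commute[OF f g, of L ?N R'] unfolding wreath_tens_obj R[symmetric] L'[symmetric] .
qed

lemma strand_cross_closed: "1 \<le> i \<Longrightarrow> i < d \<Longrightarrow> strand_cross i \<in> Mor C (ups d) (ups d)"
  unfolding strand_cross_def by (rule pad_End[OF cross_mor]) auto

lemma End_coxeter_system: "coxeter_system E d strand_cross"
proof -
  interpret E: ring E by (rule assoc_algebra_ring[OF C.End_assoc_algebra])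
  show ?thesis
  proof
    fix i assume i: "1 \<le> i" "i < d"
    show "strand_cross i \<in> carrier E" using strand_cross_closed[OF i] by (simp add: End_simps)
    have "(ups (i - 1) @ [(), ()]) @ ups (d - i - 1) = ups d" using i by (simp add: unit_list_eq_iff)
    then show "strand_cross i \<otimes>\<^bsub>E\<^esub> strand_cross i = \<one>\<^bsub>E\<^esub>"
      unfolding strand_cross_def End_simps C.pad_comp[OF cross_mor cross_mor] cross_square C.pad_ident
      by (simp add: wreath_tens_obj)
  next
    fix i assume i: "1 \<le> i" "Suc i < d"
    let ?L = "ups (i - 1)" and ?R = "ups (d - i - 2)"
    note c1 = C.tens[OF cross_mor C.ident[of up], unfolded wreath_tens_obj append.simps]
      and c2 = C.tens[OF C.ident[of up] cross_mor, unfolded wreath_tens_obj append.simps]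
    have 1: "strand_cross i = C.pad ?L (cross \<boxtimes>\<^bsub>C\<^esub> ident C up) ?R"
      unfolding strand_cross_def C.pad_tens_ident[OF cross_mor]
      by (rule pad_cong) (use i in \<open>simp_all add: wreath_tens_obj\<close>)
    have 2: "strand_cross (Suc i) = C.pad ?L (ident C up \<boxtimes>\<^bsub>C\<^esub> cross) ?R"
      unfolding strand_cross_def C.pad_tens_ident[OF cross_mor]
      by (rule pad_cong) (use i in \<open>simp_all add: wreath_tens_obj\<close>)
    have "(cross \<boxtimes>\<^bsub>C\<^esub> ident C up) \<cdot>\<^bsub>C\<^esub> ((ident C up \<boxtimes>\<^bsub>C\<^esub> cross) \<cdot>\<^bsub>C\<^esub> (cross \<boxtimes>\<^bsub>C\<^esub> ident C up))
      = (ident C up \<boxtimes>\<^bsub>C\<^esub> cross) \<cdot>\<^bsub>C\<^esub> ((cross \<boxtimes>\<^bsub>C\<^esub> ident C up) \<cdot>\<^bsub>C\<^esub> (ident C up \<boxtimes>\<^bsub>C\<^esub> cross))"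
      using cross_braid unfolding C.comp_assoc'[OF c1 c2 c1] C.comp_assoc'[OF c2 c1 c2] .
    then show "strand_cross i \<otimes>\<^bsub>E\<^esub> (strand_cross (Suc i) \<otimes>\<^bsub>E\<^esub> strand_cross i)
      = strand_cross (Suc i) \<otimes>\<^bsub>E\<^esub> (strand_cross i \<otimes>\<^bsub>E\<^esub> strand_cross (Suc i))"
      unfolding 1 2 End_simps C.pad_comp[OF c1 c2] C.pad_comp[OF c2 c1]
        C.pad_comp[OF c1 C.comp[OF c2 c1]] C.pad_comp[OF c2 C.comp[OF c1 c2]] by simp
  next
    fix i j assume "1 \<le> i" "Suc i < j" "j < d"
    then show "strand_cross i \<otimes>\<^bsub>E\<^esub> strand_cross j = strand_cross j \<otimes>\<^bsub>E\<^esub> strand_cross i"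
      unfolding strand_cross_def End_simps by (intro pads_commute[OF cross_mor cross_mor]) auto
  qed
qed

text \<open>
  Relations between generators on common strands are paddings of the defining relations;
  generators on disjoint strands commute by \<open>pads_commute\<close>.
\<close>

lemma End_wreath_system: "wreath_system K A d E strand_cross strand_token"
proof (rule wreath_system.intro)
  show "cring K" "assoc_algebra K A" "assoc_algebra K E" "coxeter_system E d strand_cross"
    by (fact K A C.End_assoc_algebra End_coxeter_system)+
next
  fix i assume i: "i \<in> {1..d}"
  have o: "(ups (i - 1) @ up) @ ups (d - i) = ups d" using i by (simp add: unit_list_eq_iff)
  show "linear_map K A E (strand_token i)"
    using linear_map_comp[OF token_linear C.pad_linear[of up up "ups (i - 1)" "ups (d - i)"]]
    unfolding wreath_tens_obj o C.End_algebra_eq strand_token_def .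
  show "strand_token i \<one>\<^bsub>A\<^esub> = \<one>\<^bsub>E\<^esub>"
    unfolding strand_token_def token_one C.pad_ident wreath_tens_obj o End_simps ..
  fix a b assume ab: "a \<in> carrier A" "b \<in> carrier A"
  show "strand_token i a \<otimes>\<^bsub>E\<^esub> strand_token i b = strand_token i (a \<otimes>\<^bsub>A\<^esub> b)"
    unfolding strand_token_def End_simps C.pad_comp[OF token_mor[OF ab(1)] token_mor[OF ab(2)]]
      token_mult[OF ab] ..
  fix j assume "j \<in> {1..d}" "i < j"
  then show "strand_token i a \<otimes>\<^bsub>E\<^esub> strand_token j b = strand_token j b \<otimes>\<^bsub>E\<^esub> strand_token i a"
    using i unfolding strand_token_def End_simps
    by (intro pads_commute[OF token_mor[OF ab(1)] token_mor[OF ab(2)]]) auto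
next
  fix i a assume i: "1 \<le> i" "i < d" and a: "a \<in> carrier A"
  let ?L = "ups (i - 1)" and ?R = "ups (d - i - 1)"
  note c1 = C.tens[OF token_mor[OF a] C.ident[of up], unfolded wreath_tens_obj append.simps]
    and c2 = C.tens[OF C.ident[of up] token_mor[OF a], unfolded wreath_tens_obj append.simps]
  have 1: "strand_token i a = C.pad ?L (token a \<boxtimes>\<^bsub>C\<^esub> ident C up) ?R"
    unfolding strand_token_def C.pad_tens_ident[OF token_mor[OF a]]
    by (rule pad_cong) (use i in \<open>simp_all add: wreath_tens_obj\<close>)
  have 2: "strand_token (Suc i) a = C.pad ?L (ident C up \<boxtimes>\<^bsub>C\<^esub> token a) ?R"
    unfolding strand_token_def C.pad_tens_ident[OF token_mor[OF a]]
    by (rule pad_cong) (use i in \<open>simp_all add: wreath_tens_obj\<close>)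
  show "strand_cross i \<otimes>\<^bsub>E\<^esub> strand_token i a = strand_token (Suc i) a \<otimes>\<^bsub>E\<^esub> strand_cross i"
    unfolding 1 2 strand_cross_def End_simps C.pad_comp[OF cross_mor c1] C.pad_comp[OF c2 cross_mor]
      cross_token[OF a] ..
  fix j assume j: "j \<in> {1..d}" "j \<noteq> i" "j \<noteq> Suc i"
  show "strand_cross i \<otimes>\<^bsub>E\<^esub> strand_token j a = strand_token j a \<otimes>\<^bsub>E\<^esub> strand_cross i"
  proof (cases "j < i")
    case True
    then have "strand_token j a \<otimes>\<^bsub>E\<^esub> strand_cross i = strand_cross i \<otimes>\<^bsub>E\<^esub> strand_token j a"
      using i j unfolding strand_token_def strand_cross_def End_simps
      by (intro pads_commute[OF token_mor[OF a] cross_mor]) auto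
    then show ?thesis by simp
  next
    case False
    then show ?thesis
      using i j unfolding strand_token_def strand_cross_def End_simps
      by (intro pads_commute[OF cross_mor token_mor[OF a]]) auto
  qed
qed

interpretation E: wreath_system K A d E strand_cross strand_token
  by (rule End_wreath_system)

interpretation T: Group.monoid "tuples A d" by (rule tuples_monoid[OF A.monoid_axioms])

private abbreviation (input) "elems \<equiv> {E.elem a \<pi> | a \<pi>. a \<in> carrier (tuples A d) \<and> \<pi> permutes {1..d}}"

lemma elems_subset: "elems \<subseteq> carrier E"
  using E.elem_closed by blast

text \<open>
  Left multiplication is linear, so it is enough to multiply the normal forms.
\<close>

lemma span_stable:
  assumes x: "x \<in> carrier E" and e: "\<And>y. y \<in> elems \<Longrightarrow> x \<otimes>\<^bsub>E\<^esub> y \<in> elems"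
    and v: "v \<in> span_submodule K E elems"
  shows "x \<otimes>\<^bsub>E\<^esub> v \<in> span_submodule K E elems"
proof -
  let ?V = "span_submodule K E elems"
  note R = bilinear_map_right[OF assoc_algebra_mult_bilinear[OF C.End_assoc_algebra] x]
  note m = E.MM.module_axioms
  have V: "submodule ?V K E" by (rule span_submodule_submodule[OF m elems_subset])
  note VE = E.MM.submoduleE[OF V]
  have "submodule {y \<in> carrier E. x \<otimes>\<^bsub>E\<^esub> y \<in> ?V} K E"
  proof (rule E.MM.submoduleI)
    show "\<zero>\<^bsub>E\<^esub> \<in> {y \<in> carrier E. x \<otimes>\<^bsub>E\<^esub> y \<in> ?V}"
      using linear_map_zero[OF m m R] submodule_zero[OF V] by simp
    show "\<ominus>\<^bsub>E\<^esub> a \<in> {y \<in> carrier E. x \<otimes>\<^bsub>E\<^esub> y \<in> ?V}" if "a \<in> {y \<in> carrier E. x \<otimes>\<^bsub>E\<^esub> y \<in> ?V}" for a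
      using that linear_map_uminus[OF m m R] VE(3) by simp
    show "a \<oplus>\<^bsub>E\<^esub> b \<in> {y \<in> carrier E. x \<otimes>\<^bsub>E\<^esub> y \<in> ?V}"
      if "a \<in> {y \<in> carrier E. x \<otimes>\<^bsub>E\<^esub> y \<in> ?V}" "b \<in> {y \<in> carrier E. x \<otimes>\<^bsub>E\<^esub> y \<in> ?V}" for a b
      using that linear_map_add[OF R] VE(5) by simp
    show "r \<odot>\<^bsub>E\<^esub> a \<in> {y \<in> carrier E. x \<otimes>\<^bsub>E\<^esub> y \<in> ?V}"
      if "r \<in> carrier K" "a \<in> {y \<in> carrier E. x \<otimes>\<^bsub>E\<^esub> y \<in> ?V}" for r a
      using that linear_map_smult[OF R] VE(4) by simp
  qed auto
  moreover have "elems \<subseteq> {y \<in> carrier E. x \<otimes>\<^bsub>E\<^esub> y \<in> ?V}"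
    using elems_subset e span_submodule_superset[of elems K E] by blast
  ultimately have "?V \<subseteq> {y \<in> carrier E. x \<otimes>\<^bsub>E\<^esub> y \<in> ?V}" by (rule span_submodule_least)
  then show ?thesis using v by blast
qed

text \<open>
  The property to be proved by induction for all morphisms. Padded morphisms have to be
  considered since the factors of a tensor product occupy only some of the strands; and the
  vanishing of morphisms between different objects is needed for composites that pass through an
  object of another length.
\<close>

definition stable :: "unit list \<Rightarrow> unit list \<Rightarrow> ('k, unit, 'a wreath_gen) mexpr set set \<Rightarrow> bool"
  where "stable X Y f \<longleftrightarrow>
    (X = Y \<longrightarrow> (\<forall>L R. (L @ X) @ R = ups d \<longrightarrow>
      (\<forall>v \<in> span_submodule K E elems. C.pad L f R \<cdot>\<^bsub>C\<^esub> v \<in> span_submodule K E elems))) \<and>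
    (X \<noteq> Y \<longrightarrow> f = mzero C X Y)"

lemma zero_comp: "f \<in> Mor C X Y \<Longrightarrow> mzero C Y Z \<cdot>\<^bsub>C\<^esub> f = mzero C X Z"
  using linear_map_zero[OF C.hom_module C.hom_module C.comp_linear_left[of f X Y Z]] by simp

lemma comp_zero: "g \<in> Mor C Y Z \<Longrightarrow> g \<cdot>\<^bsub>C\<^esub> mzero C X Y = mzero C X Z"
  using linear_map_zero[OF C.hom_module C.hom_module C.comp_linear_right[of g Y Z X]] by simp

lemma zero_tens: "g \<in> Mor C X' Y' \<Longrightarrow> mzero C X Y \<boxtimes>\<^bsub>C\<^esub> g = mzero C (X @ X') (Y @ Y')"
  using linear_map_zero[OF C.hom_module C.hom_module C.tens_linear_left[of g X' Y' X Y]]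
  by (simp add: wreath_tens_obj)

lemma tens_zero: "g \<in> Mor C X' Y' \<Longrightarrow> g \<boxtimes>\<^bsub>C\<^esub> mzero C X Y = mzero C (X' @ X) (Y' @ Y)"
  using linear_map_zero[OF C.hom_module C.hom_module C.tens_linear_right[of g X' Y' X Y]]
  by (simp add: wreath_tens_obj)

lemma pad_zero: "C.pad L (mzero C X Y) R = mzero C ((L @ X) @ R) ((L @ Y) @ R)"
  using linear_map_zero[OF C.hom_module C.hom_module C.pad_linear[of X Y L R]] by (simp add: wreath_tens_obj)

lemma stable_generator:
  assumes "g \<in> gens Sg"
  shows "stable (source Sg g) (target Sg g) (wpm (Gen g))"
proof (cases g)
  case Crossing
  have "C.pad L cross R \<cdot>\<^bsub>C\<^esub> v \<in> span_submodule K E elems"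
    if LR: "(L @ [(), ()]) @ R = ups d" and v: "v \<in> span_submodule K E elems" for L R v
  proof -
    have len: "length L + 2 + length R = d" using LR by (simp add: unit_list_eq_iff)
    let ?i = "Suc (length L)"
    have i: "1 \<le> ?i" "?i < d" using len by auto
    have p: "C.pad L cross R = strand_cross ?i"
      unfolding strand_cross_def by (rule pad_cong) (use len in auto)
    have "strand_cross ?i \<otimes>\<^bsub>E\<^esub> v \<in> span_submodule K E elems"
    proof (rule span_stable[OF _ _ v])
      show "strand_cross ?i \<in> carrier E" by (rule E.C.S_closed[OF i])
      fix y assume "y \<in> elems"
      then obtain a \<pi> where "y = E.elem a \<pi>" "a \<in> carrier (tuples A d)" "\<pi> permutes {1..d}" by blast
      then show "strand_cross ?i \<otimes>\<^bsub>E\<^esub> y \<in> elems"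
        using E.S_elem[OF i] tuples_permute[OF _ adj_permutes[OF i]] permutes_compose[OF _ adj_permutes[OF i]]
        by blast
    qed
    then show ?thesis by (simp add: p End_simps)
  qed
  then show ?thesis
    unfolding stable_def by (simp add: Crossing wreath_signature_def cross_def)
next
  case (Token a)
  then have a: "a \<in> carrier A" using assms by (auto simp: wreath_signature_def)
  have "C.pad L (token a) R \<cdot>\<^bsub>C\<^esub> v \<in> span_submodule K E elems"
    if LR: "(L @ up) @ R = ups d" and v: "v \<in> span_submodule K E elems" for L R v
  proof -
    have len: "length L + 1 + length R = d" using LR by (simp add: unit_list_eq_iff)
    let ?i = "Suc (length L)"
    have i: "?i \<in> {1..d}" using len by auto
    have p: "C.pad L (token a) R = strand_token ?i a"
      unfolding strand_token_def by (rule pad_cong) (use len in auto)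
    have "strand_token ?i a \<otimes>\<^bsub>E\<^esub> v \<in> span_submodule K E elems"
    proof (rule span_stable[OF _ _ v])
      show "strand_token ?i a \<in> carrier E" by (rule E.\<beta>_closed[OF i a])
      fix y assume "y \<in> elems"
      then obtain b \<pi> where y: "y = E.elem b \<pi>" "b \<in> carrier (tuples A d)" "\<pi> permutes {1..d}" by blast
      have "b(?i := a \<otimes>\<^bsub>A\<^esub> b ?i) \<in> carrier (tuples A d)"
        by (intro tuples_upd[OF y(2) i] A.m_closed a tuples_nth[OF y(2) i])
      then show "strand_token ?i a \<otimes>\<^bsub>E\<^esub> y \<in> elems"
        using E.\<beta>_elem[OF i a y(2,3)] y by blast
    qed
    then show ?thesis by (simp add: p End_simps)
  qed
  then show ?thesis
    unfolding stable_def by (simp add: Token wreath_signature_def token_def)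
qed

lemma all_stable:
  assumes "f \<in> Mor C X Y"
  shows "stable X Y f"
proof -
  let ?V = "span_submodule K E elems"
  have V: "submodule ?V K E" by (rule span_submodule_submodule[OF E.MM.module_axioms elems_subset])
  note VE = E.MM.submoduleE[OF V]
  have Vm: "v \<in> Mor C (ups d) (ups d)" if "v \<in> ?V" for v
    using VE(1) that by (auto simp: End_simps)
  have padm: "C.pad L f R \<in> Mor C (ups d) (ups d)" if "f \<in> Mor C X X" "(L @ X) @ R = ups d" for L f X R
    using C.pad_closed[OF that(1), of L R] that(2) by (simp add: wreath_tens_obj)
  show ?thesis
    using assms
  proof (induct rule: presented_induct[OF K, where \<Sigma> = Sg and R = "wreath_relations K A",
        folded wreath_category_def, consumes 1,
        case_names Gen Ident Comp Tens Zero Add Scale])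
    case (Gen g)
    then show ?case by (rule stable_generator)
  next
    case (Ident X)
    then show ?case
      using C.comp_ident_left'[OF Vm] by (simp add: stable_def C.pad_ident wreath_tens_obj)
  next
    case (Comp X Y Z f g)
    show ?case
    proof (cases "X = Y")
      case True
      show ?thesis
      proof (cases "Y = Z")
        case YZ: True
        have "C.pad L (g \<cdot>\<^bsub>C\<^esub> f) R \<cdot>\<^bsub>C\<^esub> v \<in> ?V" if LR: "(L @ X) @ R = ups d" and v: "v \<in> ?V" for L R v
        proof -
          have g: "g \<in> Mor C X X" and f: "f \<in> Mor C X X" using Comp True YZ by auto
          have "C.pad L (g \<cdot>\<^bsub>C\<^esub> f) R \<cdot>\<^bsub>C\<^esub> v = C.pad L g R \<cdot>\<^bsub>C\<^esub> (C.pad L f R \<cdot>\<^bsub>C\<^esub> v)"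
            unfolding C.pad_comp[OF g f, symmetric]
            by (rule C.comp_assoc'[OF padm[OF g LR] padm[OF f LR] Vm[OF v]])
          then show ?thesis using Comp LR v True YZ by (simp add: stable_def)
        qed
        then show ?thesis using True YZ by (simp add: stable_def)
      next
        case False
        then show ?thesis using Comp True zero_comp[OF Comp(2)] by (simp add: stable_def)
      qed
    next
      case False
      then have f: "f = mzero C X Y" using Comp by (simp add: stable_def)
      then have gf: "g \<cdot>\<^bsub>C\<^esub> f = mzero C X Z" using comp_zero[OF Comp(1)] by simp
      show ?thesis
        using VE(1) submodule_zero[OF V] zero_comp[OF Vm]
        by (auto simp: stable_def gf pad_zero End_simps)
    qed
  next
    case (Tens X Y X' Y' f g)
    show ?case
    proof (cases "X = Y \<and> X' = Y'")
      case True
      have f: "f \<in> Mor C X X" and g: "g \<in> Mor C X' X'" using Tens True by auto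
      have "C.pad L (f \<boxtimes>\<^bsub>C\<^esub> g) R \<cdot>\<^bsub>C\<^esub> v \<in> ?V" if LR: "(L @ (X @ X')) @ R = ups d" and v: "v \<in> ?V" for L R v
      proof -
        have LR1: "(L @ X) @ (X' @ R) = ups d" and LR2: "((L @ X) @ X') @ R = ups d" using LR by simp_all
        have "C.pad L (f \<boxtimes>\<^bsub>C\<^esub> g) R \<cdot>\<^bsub>C\<^esub> v = C.pad L f (X' @ R) \<cdot>\<^bsub>C\<^esub> (C.pad (L @ X) g R \<cdot>\<^bsub>C\<^esub> v)"
          unfolding C.pad_tens(1)[OF f g, unfolded wreath_tens_obj]
          by (rule C.comp_assoc'[OF padm[OF f LR1] padm[OF g LR2] Vm[OF v]])
        moreover have "C.pad (L @ X) g R \<cdot>\<^bsub>C\<^esub> v \<in> ?V"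
          using Tens(4) LR2 v True unfolding stable_def by blast
        ultimately show ?thesis
          using Tens(3) LR1 True unfolding stable_def by simp
      qed
      then show ?thesis using True by (simp add: stable_def)
    next
      case False
      then have fg: "f \<boxtimes>\<^bsub>C\<^esub> g = mzero C (X @ X') (Y @ Y')"
        using Tens zero_tens[OF Tens(2)] tens_zero[OF Tens(1)] by (auto simp: stable_def)
      show ?thesis
        using submodule_zero[OF V] zero_comp[OF Vm]
        by (auto simp: stable_def fg pad_zero End_simps)
    qed
  next
    case (Zero X Y)
    show ?case
      using submodule_zero[OF V] zero_comp[OF Vm] by (auto simp: stable_def pad_zero End_simps)
  next
    case (Add X Y f g)
    show ?case
    proof (cases "X = Y")
      case True
      have f: "f \<in> Mor C X X" and g: "g \<in> Mor C X X" using Add True by auto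
      have "C.pad L (f \<boxplus>\<^bsub>C\<^esub> g) R \<cdot>\<^bsub>C\<^esub> v \<in> ?V" if LR: "(L @ X) @ R = ups d" and v: "v \<in> ?V" for L R v
      proof -
        have "C.pad L (f \<boxplus>\<^bsub>C\<^esub> g) R = C.pad L f R \<boxplus>\<^bsub>C\<^esub> C.pad L g R"
          using linear_map_add[OF C.pad_linear[of X X L R], of f g] f g by simp
        then have "C.pad L (f \<boxplus>\<^bsub>C\<^esub> g) R \<cdot>\<^bsub>C\<^esub> v = C.pad L f R \<cdot>\<^bsub>C\<^esub> v \<boxplus>\<^bsub>C\<^esub> C.pad L g R \<cdot>\<^bsub>C\<^esub> v"
          using C.comp_add_left'[OF padm[OF f LR] padm[OF g LR] Vm[OF v]] by simp
        moreover have "C.pad L f R \<cdot>\<^bsub>C\<^esub> v \<in> ?V" "C.pad L g R \<cdot>\<^bsub>C\<^esub> v \<in> ?V"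
          using Add(3,4) LR v True unfolding stable_def by blast+
        ultimately show ?thesis using VE(5) by (simp add: End_simps)
      qed
      then show ?thesis using True by (simp add: stable_def)
    next
      case False
      then show ?thesis using Add C.add_zero'[OF C.zero] by (simp add: stable_def)
    qed
  next
    case (Scale X Y r f)
    show ?case
    proof (cases "X = Y")
      case True
      have f: "f \<in> Mor C X X" using Scale True by auto
      have "C.pad L (r \<star>\<^bsub>C\<^esub> f) R \<cdot>\<^bsub>C\<^esub> v \<in> ?V" if LR: "(L @ X) @ R = ups d" and v: "v \<in> ?V" for L R v
      proof -
        have "C.pad L (r \<star>\<^bsub>C\<^esub> f) R = r \<star>\<^bsub>C\<^esub> C.pad L f R"
          using linear_map_smult[OF C.pad_linear[of X X L R], of r f] f Scale(1) by simp
        then have "C.pad L (r \<star>\<^bsub>C\<^esub> f) R \<cdot>\<^bsub>C\<^esub> v = r \<star>\<^bsub>C\<^esub> (C.pad L f R \<cdot>\<^bsub>C\<^esub> v)"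
          using C.comp_scale_left'[OF Scale(1) padm[OF f LR] Vm[OF v]] by simp
        moreover have "C.pad L f R \<cdot>\<^bsub>C\<^esub> v \<in> ?V" using Scale(3) LR v True unfolding stable_def by blast
        ultimately show ?thesis using VE(4)[OF Scale(1)] by (simp add: End_simps)
      qed
      then show ?thesis using True by (simp add: stable_def)
    next
      case False
      interpret H: module K "C.hom_module X Y" by (rule C.hom_module)
      show ?thesis using Scale False H.smult_r_null[of r] by (simp add: stable_def)
    qed
  qed
qed

text \<open>
  An endomorphism is its own product with the identity, which is a normal form.
\<close>

lemma elems_span: "spans K E elems"
  unfolding spans_def
proof (intro conjI equalityI elems_subset)
  let ?V = "span_submodule K E elems"
  show "?V \<subseteq> carrier E"
    using E.MM.submoduleE(1)[OF span_submodule_submodule[OF E.MM.module_axioms elems_subset]] .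
  show "carrier E \<subseteq> ?V"
  proof
    fix f assume "f \<in> carrier E"
    then have f: "f \<in> Mor C (ups d) (ups d)" by (simp add: End_simps)
    have "E.elem \<one>\<^bsub>tuples A d\<^esub> id \<in> elems" using permutes_id T.one_closed by blast
    then have one: "ident C (ups d) \<in> ?V"
      using span_submodule_superset[of elems K E] by (auto simp: E.elem_one End_simps)
    have p: "C.pad [] f [] = f"
      using C.tens_unit_left'[OF f] C.tens_unit_right'[OF f] by (simp add: C.pad_def wreath_tens_obj)
    have "C.pad [] f [] \<cdot>\<^bsub>C\<^esub> ident C (ups d) \<in> ?V"
      using all_stable[OF f] one unfolding stable_def by simp
    then show "f \<in> ?V" by (simp add: p C.comp_ident_right'[OF f])
  qed
qed

lemma strand_exprs:
  "strand_cross i = wpm (Tens (Tens (Ident (ups (i - 1))) cross_expr) (Ident (ups (d - i - 1))))"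
  "a \<in> carrier A \<Longrightarrow>
    strand_token i a = wpm (Tens (Tens (Ident (ups (i - 1))) (token_expr a)) (Ident (ups (d - i))))"
  unfolding strand_cross_def strand_token_def C.pad_def cross_def token_def pm_ident[symmetric]
    pm_tens[OF typed_Tens[OF typed_Ident typed_generators(1)] typed_Ident]
    pm_tens[OF typed_Tens[OF typed_Ident typed_generators(2)] typed_Ident]
    pm_tens[OF typed_Ident typed_generators(1)] pm_tens[OF typed_Ident typed_generators(2)]
  by (rule HOL.refl)+

interpretation W: wreath_system K A d "wreath_algebra K A d" "wreath_cross K A d" "wreath_token K A d"
  by (rule wreath_algebra_system[OF K A])

lemma eval_mor_pm: "typed K Sg (ups d) Y t \<Longrightarrow> W.eval_mor (wpm t) = W.eval t 0"
  by (rule W.eval_mor_eq[of "ups d" Y]) simp_all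

lemma EndE:
  assumes "f \<in> carrier E"
  obtains t where "typed K Sg (ups d) (ups d) t" "f = wpm t"
proof -
  have "f \<in> wpm ` {t. typed K Sg (ups d) (ups d) t}"
    using assms unfolding End_simps unfolding wreath_category_def Mor_presented[OF K] .
  then show thesis using that by blast
qed

lemma eval_mor_hom:
  shows eval_mor_closed: "f \<in> carrier E \<Longrightarrow> W.eval_mor f \<in> carrier (wreath_algebra K A d)"
    and eval_mor_mult: "f \<in> carrier E \<Longrightarrow> g \<in> carrier E \<Longrightarrow>
      W.eval_mor (f \<otimes>\<^bsub>E\<^esub> g) = W.eval_mor f \<otimes>\<^bsub>wreath_algebra K A d\<^esub> W.eval_mor g"
    and eval_mor_add: "f \<in> carrier E \<Longrightarrow> g \<in> carrier E \<Longrightarrow>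
      W.eval_mor (f \<oplus>\<^bsub>E\<^esub> g) = W.eval_mor f \<oplus>\<^bsub>wreath_algebra K A d\<^esub> W.eval_mor g"
    and eval_mor_smult: "r \<in> carrier K \<Longrightarrow> f \<in> carrier E \<Longrightarrow>
      W.eval_mor (r \<odot>\<^bsub>E\<^esub> f) = r \<odot>\<^bsub>wreath_algebra K A d\<^esub> W.eval_mor f"
    and eval_mor_one: "W.eval_mor \<one>\<^bsub>E\<^esub> = \<one>\<^bsub>wreath_algebra K A d\<^esub>"
proof -
  show "W.eval_mor f \<in> carrier (wreath_algebra K A d)" if "f \<in> carrier E"
    using that by (rule EndE) (simp add: eval_mor_pm W.eval_closed)
  show "W.eval_mor (f \<otimes>\<^bsub>E\<^esub> g) = W.eval_mor f \<otimes>\<^bsub>wreath_algebra K A d\<^esub> W.eval_mor g"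
    "W.eval_mor (f \<oplus>\<^bsub>E\<^esub> g) = W.eval_mor f \<oplus>\<^bsub>wreath_algebra K A d\<^esub> W.eval_mor g"
    if fg: "f \<in> carrier E" "g \<in> carrier E"
  proof -
    obtain t where t: "typed K Sg (ups d) (ups d) t" "f = wpm t" by (rule EndE[OF fg(1)])
    obtain u where u: "typed K Sg (ups d) (ups d) u" "g = wpm u" by (rule EndE[OF fg(2)])
    show "W.eval_mor (f \<otimes>\<^bsub>E\<^esub> g) = W.eval_mor f \<otimes>\<^bsub>wreath_algebra K A d\<^esub> W.eval_mor g"
      unfolding t(2) u(2) End_simps pm_comp[OF t(1) u(1), symmetric] eval_mor_pm[OF t(1)] eval_mor_pm[OF u(1)]
        eval_mor_pm[OF typed_Comp[OF t(1) u(1)]] by simp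
    show "W.eval_mor (f \<oplus>\<^bsub>E\<^esub> g) = W.eval_mor f \<oplus>\<^bsub>wreath_algebra K A d\<^esub> W.eval_mor g"
      unfolding t(2) u(2) End_simps pm_add[OF t(1) u(1), symmetric] eval_mor_pm[OF t(1)] eval_mor_pm[OF u(1)]
        eval_mor_pm[OF typed_Add[OF t(1) u(1)]] by simp
  qed
  show "W.eval_mor (r \<odot>\<^bsub>E\<^esub> f) = r \<odot>\<^bsub>wreath_algebra K A d\<^esub> W.eval_mor f"
    if r: "r \<in> carrier K" and f: "f \<in> carrier E"
  proof -
    obtain t where t: "typed K Sg (ups d) (ups d) t" "f = wpm t" by (rule EndE[OF f])
    show ?thesis
      unfolding t(2) End_simps pm_scale[OF r t(1), symmetric] eval_mor_pm[OF t(1)]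
        eval_mor_pm[OF typed_Scale[OF r t(1)]] by simp
  qed
  show "W.eval_mor \<one>\<^bsub>E\<^esub> = \<one>\<^bsub>wreath_algebra K A d\<^esub>"
    unfolding End_simps pm_ident[symmetric] eval_mor_pm[OF typed_Ident] by simp
qed

lemma eval_strand_cross:
  assumes "1 \<le> i" "i < d"
  shows "W.eval_mor (strand_cross i) = wreath_cross K A d i"
proof -
  let ?t = "Tens (Tens (Ident (ups (i - 1))) cross_expr) (Ident (ups (d - i - 1)))"
  have "(ups (i - 1) @ [(), ()]) @ ups (d - i - 1) = ups d" using assms by (simp add: unit_list_eq_iff)
  moreover have "typed K Sg ((ups (i - 1) @ [(), ()]) @ ups (d - i - 1)) ((ups (i - 1) @ [(), ()]) @ ups (d - i - 1)) ?t"
    by (rule typed_Tens[OF typed_Tens[OF typed_Ident typed_generators(1)] typed_Ident])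
  ultimately have "typed K Sg (ups d) (ups d) ?t" by (simp only:)
  then show ?thesis
    unfolding strand_exprs using assms W.C.S_closed[OF assms] by (simp add: eval_mor_pm)
qed

lemma eval_strand_token:
  assumes "i \<in> {1..d}" "a \<in> carrier A"
  shows "W.eval_mor (strand_token i a) = wreath_token K A d i a"
proof -
  let ?t = "Tens (Tens (Ident (ups (i - 1))) (token_expr a)) (Ident (ups (d - i)))"
  have "(ups (i - 1) @ up) @ ups (d - i) = ups d" using assms by (simp add: unit_list_eq_iff)
  moreover have "typed K Sg ((ups (i - 1) @ up) @ ups (d - i)) ((ups (i - 1) @ up) @ ups (d - i)) ?t"
    by (rule typed_Tens[OF typed_Tens[OF typed_Ident typed_generators(2)[OF assms(2)]] typed_Ident])
  ultimately have "typed K Sg (ups d) (ups d) ?t" by (simp only:)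
  then show ?thesis
    unfolding strand_exprs(2)[OF assms(2)] using assms W.\<beta>_closed[OF assms] by (simp add: eval_mor_pm)
qed

lemma eval_elem:
  assumes "a \<in> carrier (tuples A d)" "\<pi> permutes {1..d}"
  shows "W.eval_mor (E.elem a \<pi>) = wreath_elem K A d a \<pi>"
  using elem_hom[OF End_wreath_system wreath_algebra_system[OF K A], of W.eval_mor a \<pi>]
    eval_mor_closed eval_mor_one eval_mor_mult eval_strand_cross eval_strand_token assms
    wreath_system_elem_eq[OF K A assms]
  by (auto simp: Pi_iff)

text \<open>
  Evaluation and the linear map \<open>G\<close> provided by \<open>wreath_lift\<close> are mutually inverse, as they
  match normal forms with the tensors \<open>a \<otimes> \<pi>\<close>.
\<close>

lemma End_isomorphic_wreath_algebra: "isomorphic_algebras K E (wreath_algebra K A d)"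
proof -
  let ?W = "wreath_algebra K A d" and ?F = W.eval_mor
  have lin: "linear_map K E ?W ?F"
    by (rule linear_mapI) (fact eval_mor_closed eval_mor_add eval_mor_smult)+
  obtain G where G: "linear_map K ?W E G"
    "\<And>a \<pi>. a \<in> carrier (tuples A d) \<Longrightarrow> \<pi> permutes {1..d} \<Longrightarrow> G (wreath_elem K A d a \<pi>) = E.elem a \<pi>"
    by (rule wreath_lift[OF K A E.MM.module_axioms, where \<psi> = E.elem]) (rule E.elem_multilinear, assumption, rule that)
  have id: "linear_map K E E (\<lambda>x. x)" "linear_map K ?W ?W (\<lambda>x. x)"
    by (auto intro: linear_mapI)
  have FG: "?F (G w) = w" if "w \<in> carrier ?W" for w
  proof (rule linear_map_eqI[OF W.MM.module_axioms W.MM.module_axioms wreath_elem_spans[OF K A]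
        linear_map_comp[OF G(1) lin] id(2) _ that])
    fix s assume "s \<in> {wreath_elem K A d a \<pi> |a \<pi>. a \<in> carrier (tuples A d) \<and> \<pi> permutes {1..d}}"
    then show "?F (G s) = s" by (auto simp: G(2) eval_elem)
  qed
  have GF: "G (?F f) = f" if "f \<in> carrier E" for f
  proof (rule linear_map_eqI[OF E.MM.module_axioms E.MM.module_axioms elems_span
        linear_map_comp[OF lin G(1)] id(1) _ that])
    fix s assume "s \<in> elems"
    then show "G (?F s) = s" by (auto simp: G(2) eval_elem)
  qed
  have "bij_betw ?F (carrier E) (carrier ?W)"
    by (rule bij_betwI[where g = G])
      (use linear_map_closed[OF lin] linear_map_closed[OF G(1)] FG GF in auto)
  moreover have "?F \<in> ring_hom E ?W"
    by (rule ring_hom_memI) (fact eval_mor_closed eval_mor_mult eval_mor_add eval_mor_one)+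
  ultimately have "?F \<in> ring_iso E ?W" by (simp add: ring_iso_def)
  then show ?thesis
    unfolding isomorphic_algebras_def
    by (intro conjI bexI[of _ ?F] ballI C.End_assoc_algebra wreath_assoc_algebra[OF K A] eval_mor_smult)
qed

end

theorem proposition6p1:
  fixes K :: "('k, 'r) ring_scheme" and A :: "('k, 'a, 's) module_scheme" and d :: nat
  assumes "cring K" and "assoc_algebra K A"
  shows "isomorphic_algebras K
    (End_algebra (wreath_category K A) (obj_power (wreath_category K A) up d))
    (wreath_algebra K A d)"
  unfolding obj_power_ups[OF assms] by (rule End_isomorphic_wreath_algebra[OF assms])

end
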